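(* Let $0<\beta<1/2$, $0\le\theta\le1$, and $f\in H^{-1}(0,1)$. Then $u\in H^{1-\beta}_0(0,1)$ is a weak solution to the Petrov-Galerkin formulation $$\big(K\,D I^\beta_\theta u,\,Dv\big)_{L^2(0,1)}=\langle f,v\rangle\qquad\forall v\in H^1_0(0,1)$$ if and only if $u\in H^{1-\beta}_0(0,1)$ satisfies the integral equation $$I^\beta_\theta u-(1-\theta)\big({}_0^{r}I_1^\beta u\big)w_l-\theta\big({}_0^{l}I_1^\beta u\big)w_r=w_f .$$
   Context: $D$ is the first-order derivative in $x$. The diffusivity coefficient $K$ is a (measurable) function on $(0,1)$ with $0<K_m\le K(x)\le K_M<\infty$ for constants $K_m,K_M$. For $\phi$ on $(0,1)$: ${}_0^{l}I_x^{\beta}\phi(x)=\frac1{\Gamma(\beta)}\int_0^x\frac{\phi(s)}{(x-s)^{1-\beta}}ds$, ${}_x^{r}I_1^{\beta}\phi(x)=\frac1{\Gamma(\beta)}\int_x^1\frac{\phi(s)}{(s-x)^{1-\beta}}ds$, and $I^\beta_\theta\phi=\theta\,{}_0^{l}I_x^\beta\phi+(1-\theta)\,{}_x^{r}I_1^\beta\phi$. The numbers ${}_0^{l}I_1^\beta\phi=\frac1{\Gamma(\beta)}\int_0^1(1-s)^{\beta-1}\phi(s)ds$ and ${}_0^{r}I_1^\beta\phi=\frac1{\Gamma(\beta)}\int_0^1 s^{\beta-1}\phi(s)ds$ are the values of the left integral at $x=1$ and of the right integral at $x=0$. For $\mu>0$, $H^\mu_0(0,1)$ is the completion of $C_0^\infty(0,1)$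 (functions extended by zero) in the norm $\|w\|_{H^\mu(\mathbb{R})}=\big(\|w\|_{L^2(\mathbb{R})}^2+\||\omega|^\mu\mathcal{F}(w)\|_{L^2(\mathbb{R})}^2\big)^{1/2}$; $H^{-1}(0,1)$ is the dual of $H^1_0(0,1)$. The functions $w_l,w_r,w_f\in H^1(0,1)$ are the weak solutions of: $(KDw_l,Dv)_{L^2(0,1)}=0$ for all $v\in H^1_0(0,1)$, $w_l(0)=1$, $w_l(1)=0$; $(KDw_r,Dv)_{L^2(0,1)}=0$ for all $v\in H^1_0(0,1)$, $w_r(0)=0$, $w_r(1)=1$; $(KDw_f,Dv)_{L^2(0,1)}=\langle f,v\rangle$ for all $v\in H^1_0(0,1)$, $w_f(0)=w_f(1)=0$. *)

theory Defs
  imports "HOL-Analysis.Analysis"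
begin

text \<open>
  Functions on the unit interval are represented by total functions \<open>real \<Rightarrow> real\<close>; all notions
  below depend only on the restriction to \<open>(0,1)\<close>, and (apart from the test functions and the
  pointwise hypotheses on the diffusivity) only on the class modulo equality almost everywhere.
\<close>

abbreviation unit_ival :: "real set" where
  "unit_ival \<equiv> {0<..<1}"

definition zero_ext :: "(real \<Rightarrow> real) \<Rightarrow> real \<Rightarrow> real" where
  "zero_ext w x = (if x \<in> unit_ival then w x else 0)"

definition test_functions :: "(real \<Rightarrow> real) set" where
  "test_functions = {\<phi>. (\<forall>n x. (deriv ^^ n) \<phi> field_differentiable at x) \<and>
                        (\<exists>S \<subseteq> unit_ival. compact S \<and> (\<forall>x. x \<notin> S \<longrightarrow> \<phi> x = 0))}"

definition L2_unit :: "(real \<Rightarrow> real) set" where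
  "L2_unit = {w \<in> borel_measurable (lebesgue_on unit_ival).
                integrable (lebesgue_on unit_ival) (\<lambda>x. (w x)\<^sup>2)}"

definition L2_inner :: "(real \<Rightarrow> real) \<Rightarrow> (real \<Rightarrow> real) \<Rightarrow> real" where
  "L2_inner v w = (LINT x|lebesgue_on unit_ival. v x * w x)"

definition has_weak_deriv :: "(real \<Rightarrow> real) \<Rightarrow> (real \<Rightarrow> real) \<Rightarrow> bool" where
  "has_weak_deriv w g \<longleftrightarrow>
     (\<forall>a b. 0 < a \<longrightarrow> b < 1 \<longrightarrow>
        w absolutely_integrable_on {a..b} \<and> g absolutely_integrable_on {a..b}) \<and>
     (\<forall>\<phi>\<in>test_functions. L2_inner w (deriv \<phi>) = - L2_inner g \<phi>)"

text \<open>
  The derivative \<open>D\<close> on \<open>(0,1)\<close>. A weak derivative is unique up to null sets, so the choice is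
  irrelevant under integrals. If there is none, the value is arbitrary.
\<close>

definition weak_deriv :: "(real \<Rightarrow> real) \<Rightarrow> real \<Rightarrow> real" where
  "weak_deriv w = (SOME g. has_weak_deriv w g)"

definition H1_unit :: "(real \<Rightarrow> real) set" where
  "H1_unit = {w \<in> L2_unit. \<exists>g \<in> L2_unit. has_weak_deriv w g}"

text \<open>Boundary values of a Sobolev function are those of its continuous representative.\<close>

definition boundary_values :: "(real \<Rightarrow> real) \<Rightarrow> real \<Rightarrow> real \<Rightarrow> bool" where
  "boundary_values w a b \<longleftrightarrow>
     (\<exists>w'. continuous_on {0..1} w' \<and> (AE x in lebesgue_on unit_ival. w x = w' x) \<and>
           w' 0 = a \<and> w' 1 = b)"

text \<open>
  The Fourier transform is only applied to zero extensions of functions in \<open>L\<^sup>2(0,1)\<close>. These are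
  integrable, so that the \<open>L\<^sup>2\<close> transform is given by the integral. A different normalization of
  the transform would give an equivalent Sobolev norm and hence the same spaces.
\<close>

definition fourier :: "(real \<Rightarrow> real) \<Rightarrow> real \<Rightarrow> complex" where
  "fourier w \<omega> = (LINT x|lebesgue. complex_of_real (w x) * exp (- \<i> * complex_of_real (\<omega> * x)))"

definition sobolev_norm :: "real \<Rightarrow> (real \<Rightarrow> real) \<Rightarrow> real" where
  "sobolev_norm \<mu> w =
     sqrt ((LINT x|lebesgue. (zero_ext w x)\<^sup>2) +
           (LINT \<omega>|lebesgue. (\<bar>\<omega>\<bar> powr \<mu> * cmod (fourier (zero_ext w) \<omega>))\<^sup>2))"

text \<open>
  The completion of the test functions, realized as their closure in the complete space
  \<open>H\<^sup>\<mu>(\<real>)\<close>. The first two conditions say that the zero extension of \<open>u\<close> has finite norm.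
\<close>

definition H0_unit :: "real \<Rightarrow> (real \<Rightarrow> real) set" where
  "H0_unit \<mu> =
     {u \<in> L2_unit.
        integrable lebesgue (\<lambda>\<omega>. (\<bar>\<omega>\<bar> powr \<mu> * cmod (fourier (zero_ext u) \<omega>))\<^sup>2) \<and>
        (\<exists>\<phi>. (\<forall>n::nat. \<phi> n \<in> test_functions) \<and>
             (\<lambda>n. sobolev_norm \<mu> (\<lambda>x. \<phi> n x - u x)) \<longlonglongrightarrow> 0)}"

text \<open>
  Boundedness and additivity force such a functional to respect equality almost everywhere on
  \<open>(0,1)\<close>, so it is a functional on the classes. The pairing of \<open>f\<close> with \<open>v\<close> is \<open>f v\<close>.
\<close>

definition H_minus1_unit :: "((real \<Rightarrow> real) \<Rightarrow> real) set" where
  "H_minus1_unit =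
     {f. (\<forall>v\<in>H0_unit 1. \<forall>w\<in>H0_unit 1. f (\<lambda>x. v x + w x) = f v + f w) \<and>
         (\<forall>c. \<forall>v\<in>H0_unit 1. f (\<lambda>x. c * v x) = c * f v) \<and>
         (\<exists>C. \<forall>v\<in>H0_unit 1. \<bar>f v\<bar> \<le> C * sobolev_norm 1 v)}"

definition frac_int_left :: "real \<Rightarrow> (real \<Rightarrow> real) \<Rightarrow> real \<Rightarrow> real" where
  "frac_int_left \<beta> \<phi> x =
     1 / Gamma \<beta> * (LINT s|lebesgue_on {0<..<x}. \<phi> s / (x - s) powr (1 - \<beta>))"

definition frac_int_right :: "real \<Rightarrow> (real \<Rightarrow> real) \<Rightarrow> real \<Rightarrow> real" where
  "frac_int_right \<beta> \<phi> x =
     1 / Gamma \<beta> * (LINT s|lebesgue_on {x<..<1}. \<phi> s / (s - x) powr (1 - \<beta>))"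

definition frac_int :: "real \<Rightarrow> real \<Rightarrow> (real \<Rightarrow> real) \<Rightarrow> real \<Rightarrow> real" where
  "frac_int \<beta> \<theta> \<phi> x = \<theta> * frac_int_left \<beta> \<phi> x + (1 - \<theta>) * frac_int_right \<beta> \<phi> x"

definition diffusion_weak_solution ::
  "(real \<Rightarrow> real) \<Rightarrow> ((real \<Rightarrow> real) \<Rightarrow> real) \<Rightarrow> real \<Rightarrow> real \<Rightarrow> (real \<Rightarrow> real) \<Rightarrow> bool" where
  "diffusion_weak_solution K g a b w \<longleftrightarrow>
     w \<in> H1_unit \<and>
     (\<forall>v\<in>H0_unit 1. L2_inner (\<lambda>x. K x * weak_deriv w x) (weak_deriv v) = g v) \<and>
     boundary_values w a b"

definition petrov_galerkin_solution ::
  "(real \<Rightarrow> real) \<Rightarrow> real \<Rightarrow> real \<Rightarrow> ((real \<Rightarrow> real) \<Rightarrow> real) \<Rightarrow> (real \<Rightarrow> real) \<Rightarrow> bool" where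
  "petrov_galerkin_solution K \<beta> \<theta> f u \<longleftrightarrow>
     u \<in> H0_unit (1 - \<beta>) \<and>
     (\<forall>v\<in>H0_unit 1.
        L2_inner (\<lambda>x. K x * weak_deriv (frac_int \<beta> \<theta> u) x) (weak_deriv v) = f v)"

end

theory Submission
  imports Defs "HOL-Probability.Characteristic_Functions"
begin

text \<open>
  Let \<open>W\<close> be the fractional integral of \<open>u\<close>, let \<open>c\<^sub>l\<close> and \<open>c\<^sub>r\<close> be its values at \<open>0\<close> and \<open>1\<close>, and put
  \<open>z = W - c\<^sub>l w\<^sub>l - c\<^sub>r w\<^sub>r - w\<^sub>f\<close>. The integral equation says that \<open>z = 0\<close> almost everywhere. By the
  equations for \<open>w\<^sub>l\<close>, \<open>w\<^sub>r\<close>, \<open>w\<^sub>f\<close>, the Petrov--Galerkin formulation says that \<open>K Dz\<close> is orthogonal to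
  \<open>Dv\<close> for all \<open>v\<close> in \<open>H\<^sup>1\<^sub>0\<close>. If \<open>z = 0\<close>, this is clear. Conversely, orthogonality to derivatives of test
  functions forces \<open>K Dz\<close> to be a constant \<open>c\<close> (\<open>du_Bois_Reymond\<close>). Since \<open>z\<close> vanishes at both endpoints,
  integration of \<open>Dz = c / K\<close> gives \<open>c = 0\<close>, so \<open>z\<close> is constant and hence zero (\<open>boundary_values_FTC\<close>).

  For this argument \<open>W\<close> must lie in \<open>H\<^sup>1\<close> and attain the values \<open>c\<^sub>l\<close>, \<open>c\<^sub>r\<close>; this is \<open>frac_int_H1\<close>, the
  analytic core. On \<open>[0,1]\<close> the fractional integral is convolution with a kernel \<open>k\<close> supported in
  \<open>[-1,1]\<close>, because the functions involved live on \<open>(0,1)\<close>. This kernel is integrable and its Fourier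
  transform is \<open>O(\<bar>\<omega>\<bar> powr - \<beta>)\<close>, so by Plancherel's theorem the \<open>L\<^sup>2\<close> norm of \<open>(k * \<phi>)' = k * \<phi>'\<close> is
  bounded by that of \<open>\<bar>\<omega>\<bar> powr (1 - \<beta>)\<close> times the transform of \<open>\<phi>\<close>, which is part of
  the Sobolev norm of order \<open>1 - \<beta>\<close> (\<open>kernel_convolution_energy\<close>). Test functions approximating \<open>u\<close> thus give
  derivatives that converge in \<open>L\<^sup>2\<close>, and weak differentiation is closed. As \<open>1 - \<beta> > 1 / 2\<close>, Fourier
  inversion bounds the supremum of \<open>\<phi>\<close> by that Sobolev norm (\<open>test_sup_bound\<close>); the approximation is uniform,
  \<open>u\<close> has a continuous representative, and \<open>W\<close> is continuous up to the boundary.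

  The space \<open>H\<^sup>1\<^sub>0\<close> is given through Fourier transforms as well, and Plancherel's theorem is also what shows
  that its elements have square integrable weak derivatives (\<open>H0_unit_1_subset_H1\<close>). The Fourier analysis
  rests on the inversion formula for continuous functions, proved by Gaussian averaging.
\<close>

section \<open>Smooth functions and test functions\<close>

definition smooth :: "(real \<Rightarrow> real) \<Rightarrow> bool" where
  "smooth f \<longleftrightarrow> (\<forall>n x. (deriv ^^ n) f field_differentiable at x)"

text \<open>A family of functions that is closed under differentiation consists of smooth functions. This
  principle avoids explicit formulas for higher derivatives of products and compositions.\<close>

lemma smooth_coinduct:
  assumes "P f"
    and step: "\<And>g. P g \<Longrightarrow> \<exists>g'. (\<forall>x. (g has_real_derivative g' x) (at x)) \<and> P g'"
  shows "smooth f"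
proof -
  have dP: "P (deriv g)" if "P g" for g
  proof -
    obtain g' where g': "\<forall>x. (g has_real_derivative g' x) (at x)" "P g'"
      using step[OF \<open>P g\<close>] by blast
    then have "deriv g = g'"
      by (auto intro!: ext DERIV_imp_deriv)
    with g' show ?thesis by simp
  qed
  have "P ((deriv ^^ n) f)" for n
    by (induction n) (auto intro: assms(1) dP)
  then show ?thesis
    unfolding smooth_def field_differentiable_def using step by meson
qed

lemma smooth_has_deriv:
  assumes "smooth f"
  shows "(f has_real_derivative deriv f x) (at x)"
  using assms unfolding smooth_def
  by (metis DERIV_deriv_iff_field_differentiable funpow_0)

lemma smooth_deriv: "smooth f \<Longrightarrow> smooth (deriv f)"
  unfolding smooth_def by (metis comp_apply funpow_Suc_right)

lemma smooth_continuous: "smooth f \<Longrightarrow> continuous_on A f"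
  by (meson DERIV_continuous continuous_at_imp_continuous_on smooth_has_deriv)

lemma smooth_measurable: "smooth f \<Longrightarrow> f \<in> borel_measurable borel"
  by (intro borel_measurable_continuous_onI smooth_continuous)

lemma smooth_add:
  assumes "smooth f" "smooth g"
  shows "smooth (\<lambda>x. f x + g x)"
proof (rule smooth_coinduct[where P = "\<lambda>h. \<exists>f g. smooth f \<and> smooth g \<and> h = (\<lambda>x. f x + g x)"])
  show "\<exists>f' g'. smooth f' \<and> smooth g' \<and> (\<lambda>x. f x + g x) = (\<lambda>x. f' x + g' x)"
    using assms by blast
next
  fix h :: "real \<Rightarrow> real"
  assume "\<exists>f g. smooth f \<and> smooth g \<and> h = (\<lambda>x. f x + g x)"
  then obtain f g where fg: "smooth f" "smooth g" "h = (\<lambda>x. f x + g x)" by blast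
  show "\<exists>h'. (\<forall>x. (h has_real_derivative h' x) (at x)) \<and>
             (\<exists>f g. smooth f \<and> smooth g \<and> h' = (\<lambda>x. f x + g x))"
  proof (rule exI[of _ "\<lambda>x. deriv f x + deriv g x"], intro conjI allI)
    show "(h has_real_derivative deriv f x + deriv g x) (at x)" for x
      unfolding fg(3) by (intro DERIV_add smooth_has_deriv fg(1,2))
    show "\<exists>fa ga. smooth fa \<and> smooth ga \<and> (\<lambda>x. deriv f x + deriv g x) = (\<lambda>x. fa x + ga x)"
      using smooth_deriv[OF fg(1)] smooth_deriv[OF fg(2)] by blast
  qed
qed

inductive_set product_span :: "(real \<Rightarrow> real) set" where
  prod: "smooth f \<Longrightarrow> smooth g \<Longrightarrow> (\<lambda>x. f x * g x) \<in> product_span"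
| sum: "f \<in> product_span \<Longrightarrow> g \<in> product_span \<Longrightarrow> (\<lambda>x. f x + g x) \<in> product_span"

text \<open>The derivative of a product is a sum of products, so products alone are not closed under
  differentiation; their sums are.\<close>

lemma smooth_mult:
  assumes "smooth f" "smooth g"
  shows "smooth (\<lambda>x. f x * g x)"
proof (rule smooth_coinduct[where P = "\<lambda>h. h \<in> product_span"])
  show "(\<lambda>x. f x * g x) \<in> product_span" using assms by (rule product_span.prod)
next
  fix h assume "h \<in> product_span"
  then show "\<exists>h'. (\<forall>x. (h has_real_derivative h' x) (at x)) \<and> h' \<in> product_span"
  proof induction
    case (prod f g)
    show ?case
    proof (intro exI[of _ "\<lambda>x. deriv f x * g x + f x * deriv g x"] conjI allI)
      show "((\<lambda>x. f x * g x) has_real_derivative deriv f x * g x + f x * deriv g x) (at x)" for x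
        using DERIV_mult[OF smooth_has_deriv[OF prod(1)] smooth_has_deriv[OF prod(2)], of x]
        by (simp add: mult.commute)
      show "(\<lambda>x. deriv f x * g x + f x * deriv g x) \<in> product_span"
        by (intro product_span.intros prod smooth_deriv[OF prod(1)] smooth_deriv[OF prod(2)])
    qed
  next
    case (sum f g)
    then obtain f' g' where *: "\<And>x. (f has_real_derivative f' x) (at x)"
      "\<And>x. (g has_real_derivative g' x) (at x)" "f' \<in> product_span" "g' \<in> product_span"
      by blast
    show ?case
      using DERIV_add[OF *(1,2)] product_span.sum[OF *(3,4)]
      by (intro exI[of _ "\<lambda>x. f' x + g' x"]) simp
  qed
qed

lemma smooth_const: "smooth (\<lambda>x. c)"
proof (rule smooth_coinduct[where P = "\<lambda>h. \<exists>c. h = (\<lambda>x. c)"])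
  fix h :: "real \<Rightarrow> real"
  assume "\<exists>c. h = (\<lambda>x. c)"
  then show "\<exists>h'. (\<forall>x. (h has_real_derivative h' x) (at x)) \<and> (\<exists>c. h' = (\<lambda>x. c))"
    by (intro exI[of _ "\<lambda>x. 0"]) auto
qed blast

lemma smooth_affine:
  assumes "smooth f"
  shows "smooth (\<lambda>x. f (c * x + d))"
proof -
  have "smooth (\<lambda>x. 1 * f (c * x + d))"
  proof (rule smooth_coinduct[where P = "\<lambda>h. \<exists>a f. smooth f \<and> h = (\<lambda>x. a * f (c * x + d))"])
    show "\<exists>a fa. smooth fa \<and> (\<lambda>x. 1 * f (c * x + d)) = (\<lambda>x. a * fa (c * x + d))"
      using assms by blast
  next
    fix h :: "real \<Rightarrow> real"
    assume "\<exists>a f. smooth f \<and> h = (\<lambda>x. a * f (c * x + d))"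
    then obtain a f where f: "smooth f" "h = (\<lambda>x. a * f (c * x + d))" by blast
    have 1: "((\<lambda>x. f (c * x + d)) has_real_derivative deriv f (c * x + d) * c) (at x)" for x
      by (rule DERIV_chain2[OF smooth_has_deriv[OF f(1)]]) (auto intro!: derivative_eq_intros)
    show "\<exists>h'. (\<forall>x. (h has_real_derivative h' x) (at x)) \<and>
             (\<exists>a f. smooth f \<and> h' = (\<lambda>x. a * f (c * x + d)))"
      unfolding f(2)
    proof (intro exI[of _ "\<lambda>x. (a * c) * deriv f (c * x + d)"] conjI allI)
      show "((\<lambda>x. a * f (c * x + d)) has_real_derivative a * c * deriv f (c * x + d)) (at x)" for x
        by (auto intro!: derivative_eq_intros 1)
      show "\<exists>a' f'. smooth f' \<and>
          (\<lambda>x. a * c * deriv f (c * x + d)) = (\<lambda>x. a' * f' (c * x + d))"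
        using smooth_deriv[OF f(1)] by blast
    qed
  qed
  then show ?thesis by simp
qed

definition flat_exp :: "real \<Rightarrow> real" where
  "flat_exp x = (if x > 0 then exp (- (1 / x)) else 0)"

lemma poly_div_exp_at_top:
  fixes p :: "real poly"
  shows "((\<lambda>y. poly p y * exp (- y)) \<longlongrightarrow> 0) at_top"
proof -
  have "((\<lambda>y. \<Sum>i\<le>degree p. coeff p i * (y ^ i / exp y)) \<longlongrightarrow> (\<Sum>i\<le>degree p. coeff p i * 0)) at_top"
    by (intro tendsto_sum tendsto_mult tendsto_const tendsto_power_div_exp_0)
  moreover have "(\<lambda>y. \<Sum>i\<le>degree p. coeff p i * (y ^ i / exp y)) = (\<lambda>y. poly p y * exp (- y))"
    by (simp add: poly_altdef sum_distrib_right exp_minus divide_inverse mult.assoc)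
  ultimately show ?thesis by simp
qed

text \<open>All derivatives of \<open>exp (- 1 / x)\<close> have the form \<open>p (1 / x) exp (- 1 / x)\<close> with a polynomial
  \<open>p\<close>, and the exponential wins against every polynomial at the origin.\<close>

lemma smooth_flat_exp: "smooth flat_exp"
proof -
  define G :: "real poly \<Rightarrow> real \<Rightarrow> real" where
    "G p x = (if x > 0 then poly p (1 / x) * exp (- (1 / x)) else 0)" for p x
  \<comment> \<open>\<open>q y = y\<^sup>2 (p y - p' y)\<close> arises from differentiating both factors, each through \<open>1 / x\<close>.\<close>
  have G_deriv: "(G p has_real_derivative G ([:0, 0, 1:] * (p - pderiv p)) x) (at x)" for p x
  proof -
    consider "x > 0" | "x < 0" | "x = 0" by linarith
    then show ?thesis
    proof cases
      case 1
      have d: "((\<lambda>x. poly p (1 / x) * exp (- (1 / x))) has_real_derivative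
              G ([:0, 0, 1:] * (p - pderiv p)) x) (at x)"
        using 1 by (auto intro!: derivative_eq_intros DERIV_chain2[OF poly_DERIV]
            simp: G_def power2_eq_square field_simps)
      have "\<forall>\<^sub>F y in nhds x. G p y = poly p (1 / y) * exp (- (1 / y))"
        using eventually_nhds_in_open[of "{0<..}" x] 1
        by (auto elim!: eventually_mono simp: G_def)
      from DERIV_cong_ev[OF refl this refl] d show ?thesis
        by (rule iffD2)
    next
      case 2
      have d: "((\<lambda>x. 0::real) has_real_derivative G ([:0, 0, 1:] * (p - pderiv p)) x) (at x)"
        using 2 by (simp add: G_def)
      have "\<forall>\<^sub>F y in nhds x. G p y = 0"
        using eventually_nhds_in_open[of "{..<0}" x] 2
        by (auto elim!: eventually_mono simp: G_def)
      from DERIV_cong_ev[OF refl this refl] d show ?thesis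
        by (rule iffD2)
    next
      case 3
      have right: "((\<lambda>h. G p h / h) \<longlongrightarrow> 0) (at_right 0)"
      proof -
        have "((\<lambda>h. poly ([:0, 1:] * p) (1 / h) * exp (- (1 / h))) \<longlongrightarrow> 0) (at_right 0)"
          using filterlim_compose[OF poly_div_exp_at_top[of "[:0, 1:] * p"]
              filterlim_inverse_at_top_right]
          by (simp add: inverse_eq_divide)
        moreover have "\<forall>\<^sub>F h in at_right 0.
            poly ([:0, 1:] * p) (1 / h) * exp (- (1 / h)) = G p h / h"
          by (auto simp: eventually_at_filter G_def)
        ultimately show ?thesis
          by (blast intro: Lim_transform_eventually)
      qed
      have "((\<lambda>h. G p h / h) \<longlongrightarrow> 0) (at_left 0)"
      proof -
        have "\<forall>\<^sub>F h in at_left 0. 0 = G p h / h"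
          by (auto simp: eventually_at_filter G_def)
        then show ?thesis
          by (rule Lim_transform_eventually[OF tendsto_const])
      qed
      then have "((\<lambda>h. G p h / h) \<longlongrightarrow> 0) (at 0)"
        using right by (simp add: filterlim_split_at)
      then show ?thesis
        unfolding DERIV_def by (simp add: 3 G_def)
    qed
  qed
  have "smooth (G 1)"
    by (rule smooth_coinduct[where P = "\<lambda>h. \<exists>p. h = G p"]) (use G_deriv in blast)+
  moreover have "G 1 = flat_exp"
    by (auto simp: G_def flat_exp_def)
  ultimately show ?thesis by simp
qed

lemma test_functionsI:
  assumes "smooth \<phi>" "0 < a" "b < 1" "\<And>x. x \<notin> {a..b} \<Longrightarrow> \<phi> x = 0"
  shows "\<phi> \<in> test_functions"
  using assms unfolding test_functions_def smooth_def
  by (auto intro!: exI[of _ "{a..b}"])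

lemma test_smooth: "\<phi> \<in> test_functions \<Longrightarrow> smooth \<phi>"
  unfolding test_functions_def smooth_def by auto

text \<open>The support is enlarged to a nondegenerate interval, so that the zero function needs no separate
  treatment later.\<close>

lemma test_support:
  assumes "\<phi> \<in> test_functions"
  obtains a b where "0 < a" "a < b" "b < 1" "\<And>x. x \<notin> {a..b} \<Longrightarrow> \<phi> x = 0"
proof -
  obtain S where S: "S \<subseteq> unit_ival" "compact S" "\<And>x. x \<notin> S \<Longrightarrow> \<phi> x = 0"
    using assms unfolding test_functions_def by blast
  show ?thesis
  proof (cases "S = {}")
    case True
    then show ?thesis using that[of "1/3" "1/2"] S(3) by auto
  next
    case False
    obtain l where l: "l \<in> S" "\<And>x. x \<in> S \<Longrightarrow> l \<le> x"
      using compact_attains_inf[OF S(2) False] by blast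
    obtain u where u: "u \<in> S" "\<And>x. x \<in> S \<Longrightarrow> x \<le> u"
      using compact_attains_sup[OF S(2) False] by blast
    have lu: "0 < l" "u < 1" "l \<le> u" using l u S(1) by auto
    show ?thesis
    proof (rule that[of l "(u + 1) / 2"])
      fix x assume "x \<notin> {l..(u + 1) / 2}"
      then have "x \<notin> S" using l(2)[of x] u(2)[of x] lu by auto
      then show "\<phi> x = 0" by (rule S(3))
    qed (use lu in auto)
  qed
qed

lemma test_outside: "\<phi> \<in> test_functions \<Longrightarrow> x \<notin> unit_ival \<Longrightarrow> \<phi> x = 0"
  by (metis atLeastAtMost_iff greaterThanLessThan_iff le_less_trans less_le_trans test_support)

lemma test_deriv:
  assumes "\<phi> \<in> test_functions"
  shows "deriv \<phi> \<in> test_functions"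
proof -
  obtain a b where ab: "0 < a" "a < b" "b < 1" "\<And>x. x \<notin> {a..b} \<Longrightarrow> \<phi> x = 0"
    using test_support[OF assms] by blast
  have "deriv \<phi> x = 0" if "x \<notin> {a..b}" for x
  proof -
    have "open (- {a..b})" by auto
    then have "\<forall>\<^sub>F y in nhds x. \<phi> y = 0"
      using eventually_nhds_in_open[of "- {a..b}" x] that ab(4) by (auto elim!: eventually_mono)
    then have "(\<phi> has_real_derivative 0) (at x)"
      using DERIV_cong_ev[of x x \<phi> "\<lambda>_. 0" 0] by auto
    then show ?thesis by (rule DERIV_imp_deriv)
  qed
  then show ?thesis
    using ab smooth_deriv[OF test_smooth[OF assms]] by (intro test_functionsI[of _ a b]) auto
qed

lemma test_add:
  assumes "\<phi> \<in> test_functions" "\<psi> \<in> test_functions"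
  shows "(\<lambda>x. \<phi> x + \<psi> x) \<in> test_functions"
proof -
  obtain a b where ab: "0 < a" "a < b" "b < 1" "\<And>x. x \<notin> {a..b} \<Longrightarrow> \<phi> x = 0"
    using test_support[OF assms(1)] by blast
  obtain c d where cd: "0 < c" "c < d" "d < 1" "\<And>x. x \<notin> {c..d} \<Longrightarrow> \<psi> x = 0"
    using test_support[OF assms(2)] by blast
  show ?thesis
  proof (rule test_functionsI[of _ "min a c" "max b d"])
    show "smooth (\<lambda>x. \<phi> x + \<psi> x)" by (intro smooth_add test_smooth assms)
    show "\<phi> x + \<psi> x = 0" if "x \<notin> {min a c..max b d}" for x
      using ab(4)[of x] cd(4)[of x] that by (cases "x < a"; cases "x < c") auto
  qed (use ab cd in auto)
qed

lemma test_mult_smooth: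
  assumes "\<phi> \<in> test_functions" "smooth g"
  shows "(\<lambda>x. g x * \<phi> x) \<in> test_functions"
proof -
  obtain a b where ab: "0 < a" "a < b" "b < 1" "\<And>x. x \<notin> {a..b} \<Longrightarrow> \<phi> x = 0"
    using test_support[OF assms(1)] by blast
  show ?thesis
    by (rule test_functionsI[of _ a b])
      (use ab assms in \<open>auto intro: smooth_mult test_smooth\<close>)
qed

lemma test_scale: "\<phi> \<in> test_functions \<Longrightarrow> (\<lambda>x. c * \<phi> x) \<in> test_functions"
  by (rule test_mult_smooth) (auto intro: smooth_const)

lemma test_diff:
  assumes "\<phi> \<in> test_functions" "\<psi> \<in> test_functions"
  shows "(\<lambda>x. \<phi> x - \<psi> x) \<in> test_functions"
  using test_add[OF assms(1) test_scale[OF assms(2), of "-1"]] by simp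

lemma deriv_test_diff:
  assumes "\<phi> \<in> test_functions" "\<psi> \<in> test_functions"
  shows "deriv (\<lambda>x. \<phi> x - \<psi> x) = (\<lambda>x. deriv \<phi> x - deriv \<psi> x)"
  using smooth_has_deriv[OF test_smooth[OF assms(1)]] smooth_has_deriv[OF test_smooth[OF assms(2)]]
  by (auto intro!: ext DERIV_imp_deriv derivative_eq_intros)

lemma test_measurable [measurable_dest]: "\<phi> \<in> test_functions \<Longrightarrow> \<phi> \<in> borel_measurable borel"
  by (simp add: smooth_measurable test_smooth)

lemma test_bounded:
  assumes "\<phi> \<in> test_functions"
  obtains B where "B > 0" "\<And>x. \<bar>\<phi> x\<bar> \<le> B"
proof -
  have "bounded (\<phi> ` {0..1})"
    using test_smooth[OF assms] by (intro compact_imp_bounded compact_continuous_image smooth_continuous) auto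
  then obtain B where B: "B > 0" "\<And>x. x \<in> {0..1} \<Longrightarrow> \<bar>\<phi> x\<bar> \<le> B"
    unfolding bounded_pos by auto
  have "\<bar>\<phi> x\<bar> \<le> B" for x
    using B test_outside[OF assms, of x] by (cases "x \<in> {0..1}") auto
  with B(1) show ?thesis by (rule that)
qed

lemma test_integrable:
  assumes "\<phi> \<in> test_functions"
  shows "integrable lborel \<phi>"
proof -
  obtain B where B: "B > 0" "\<And>x. \<bar>\<phi> x\<bar> \<le> B" using test_bounded[OF assms] by blast
  have "integrable lborel (\<lambda>x. indicator {0..1::real} x * B)"
    by (intro integrable_mult_left integrable_real_indicator) (auto simp: emeasure_lborel_Icc_eq)
  then show ?thesis
    by (rule Bochner_Integration.integrable_bound)
      (use B(2) test_outside[OF assms] test_measurable[OF assms] B(1) in \<open>auto simp: indicator_def\<close>)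
qed

text \<open>Smooth bump functions increase to the indicator of an open interval, since
  \<open>flat_exp (n x)\<close> tends to \<open>1\<close> for \<open>x > 0\<close> and vanishes for \<open>x \<le> 0\<close>.\<close>

lemma interval_approx:
  assumes "0 < a" "a < b" "b < 1"
  obtains \<psi> :: "nat \<Rightarrow> real \<Rightarrow> real" where
    "\<And>n. \<psi> n \<in> test_functions" "\<And>n x. \<bar>\<psi> n x\<bar> \<le> indicator {a<..<b} x"
    "\<And>x. (\<lambda>n. \<psi> n x) \<longlonglongrightarrow> indicator {a<..<b} x"
proof -
  define \<psi> where "\<psi> n x = flat_exp (real n * x + (- real n * a)) * flat_exp (- real n * x + real n * b)"
    for n x
  have fe: "0 \<le> flat_exp x" "flat_exp x \<le> 1" for x
    by (auto simp: flat_exp_def)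
  have eq: "\<psi> n x = flat_exp (real n * (x - a)) * flat_exp (real n * (b - x))" for n x
    by (simp add: \<psi>_def algebra_simps)
  have out: "\<psi> n x = 0" if "x \<notin> {a<..<b}" for n x
    using that by (auto simp: eq flat_exp_def zero_less_mult_iff)
  have lim: "(\<lambda>n. flat_exp (real n * y)) \<longlonglongrightarrow> 1" if "y > 0" for y
  proof -
    have "(\<lambda>n. exp (- ((1 / y) * inverse (real n)))) \<longlonglongrightarrow> exp (- ((1 / y) * 0))"
      by (intro tendsto_intros LIMSEQ_inverse_real_of_nat lim_inverse_n)
    moreover have "\<forall>\<^sub>F n in sequentially. exp (- ((1 / y) * inverse (real n))) = flat_exp (real n * y)"
      using eventually_gt_at_top[of 0]
      by eventually_elim (use that in \<open>auto simp: flat_exp_def field_simps\<close>)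
    ultimately show ?thesis
      using Lim_transform_eventually by fastforce
  qed
  show ?thesis
  proof (rule that[of \<psi>])
    show "\<psi> n \<in> test_functions" for n
    proof (rule test_functionsI[of _ a b])
      show "smooth (\<psi> n)"
        unfolding \<psi>_def by (intro smooth_mult smooth_affine smooth_flat_exp)
    qed (use assms out in auto)
    show "\<bar>\<psi> n x\<bar> \<le> indicator {a<..<b} x" for n x
      using out[of x n] fe by (auto simp: indicator_def eq abs_mult intro!: mult_le_one)
    show "(\<lambda>n. \<psi> n x) \<longlonglongrightarrow> indicator {a<..<b} x" for x
    proof (cases "x \<in> {a<..<b}")
      case True
      then show ?thesis
        using tendsto_mult[OF lim[of "x - a"] lim[of "b - x"]] by (simp add: eq)
    qed (simp add: out)
  qed
qed

section \<open>Fourier inversion\<close>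

lemma fourier_lborel:
  assumes [measurable]: "w \<in> borel_measurable borel"
  shows "fourier w \<omega> = (LINT x|lborel. complex_of_real (w x) * iexp (- (\<omega> * x)))"
proof -
  have "fourier w \<omega> = (LINT x|lebesgue. complex_of_real (w x) * iexp (- (\<omega> * x)))"
    unfolding fourier_def by simp
  also have "\<dots> = (LINT x|lborel. complex_of_real (w x) * iexp (- (\<omega> * x)))"
    by (rule integral_completion) measurable
  finally show ?thesis .
qed

lemma fourier_measurable [measurable]:
  assumes [measurable]: "w \<in> borel_measurable borel"
  shows "fourier w \<in> borel_measurable borel"
proof -
  have "(\<lambda>\<omega>. LINT x|lborel. complex_of_real (w x) * iexp (- (\<omega> * x))) \<in> borel_measurable borel"
    by measurable
  moreover have "fourier w = (\<lambda>\<omega>. LINT x|lborel. complex_of_real (w x) * iexp (- (\<omega> * x)))"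
    by (intro ext fourier_lborel) measurable
  ultimately show ?thesis by simp
qed

lemma norm_fourier_le:
  assumes "w \<in> borel_measurable borel"
  shows "cmod (fourier w \<omega>) \<le> (LINT x|lborel. \<bar>w x\<bar>)"
  unfolding fourier_lborel[OF assms]
  using integral_norm_bound[of lborel "\<lambda>x. complex_of_real (w x) * iexp (- (\<omega> * x))"]
  by (simp add: norm_mult)

lemma integrable_mult_iexp:
  assumes "integrable lborel (w :: real \<Rightarrow> real)"
  shows "integrable lborel (\<lambda>x. complex_of_real (w x) * iexp (\<omega> * x))"
proof (rule Bochner_Integration.integrable_bound)
  show "integrable lborel w" by fact
qed (use assms in \<open>auto simp: norm_mult\<close>)

text \<open>The Gaussian is its own Fourier transform (here: the characteristic function of the standard
  normal distribution), so Fubini's theorem moves the average to the Fourier side.\<close>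

lemma gaussian_mean_eq_fourier:
  fixes h :: "real \<Rightarrow> real"
  assumes h: "integrable lborel h" and e: "0 < e"
  shows "(LINT z|lborel. complex_of_real (h (x - e * z)) * complex_of_real (exp (- z\<^sup>2 / 2))) =
    (LINT \<omega>|lborel. complex_of_real (std_normal_density (e * \<omega>)) * (iexp (\<omega> * x) * fourier h \<omega>))"
proof -
  have [measurable]: "h \<in> borel_measurable borel" using h by auto
  interpret N: prob_space std_normal_distribution by (rule prob_space_normal_density) simp
  interpret P: pair_sigma_finite lborel std_normal_distribution
    by unfold_locales
  have int_aff: "integrable lborel (\<lambda>z. h (x - e * z))"
    using lborel_integrable_real_affine[OF h, of "- e" x] e by simp
  have gauss: "complex_of_real (exp (- z\<^sup>2 / 2)) = (LINT Z|std_normal_distribution. iexp (z * Z))" for z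
    using char_std_normal_distribution by (metis char_def)
  let ?F = "\<lambda>z Z. complex_of_real (h (x - e * z)) * iexp (z * Z)"
  have "integrable (lborel \<Otimes>\<^sub>M std_normal_distribution) (case_prod ?F)"
  proof (rule P.Fubini_integrable)
    show "integrable lborel (\<lambda>z. LINT Z|std_normal_distribution. cmod (case (z, Z) of (z, Z) \<Rightarrow> ?F z Z))"
      using int_aff by (simp add: norm_mult N.prob_space)
    show "AE z in lborel. integrable std_normal_distribution (\<lambda>Z. case (z, Z) of (z, Z) \<Rightarrow> ?F z Z)"
      by (auto intro!: AE_I2 N.integrable_const_bound simp: norm_mult)
  qed measurable
  from P.Fubini_integral[OF this]
  have "(LINT z|lborel. complex_of_real (h (x - e * z)) * complex_of_real (exp (- z\<^sup>2 / 2))) =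
        (LINT Z|std_normal_distribution. LINT z|lborel. ?F z Z)"
    by (simp only: gauss integral_mult_right_zero)
  also have "(\<lambda>Z. LINT z|lborel. ?F z Z) = (\<lambda>Z. iexp (Z / e * x) * fourier h (Z / e) / e)"
  proof
    fix Z
    have "iexp (Z / e * x) * fourier h (Z / e) =
          (LINT y|lborel. complex_of_real (h y) * iexp ((x - y) / e * Z))"
      by (subst fourier_lborel, measurable)
        (simp flip: integral_mult_right_zero exp_add add: mult_ac ring_distribs diff_divide_distrib)
    also have "\<dots> = e * (LINT z|lborel. ?F z Z)"
      using e by (subst lborel_integral_real_affine[where c = "- e" and t = x])
        (auto simp: scaleR_conv_of_real)
    finally show "(LINT z|lborel. ?F z Z) = iexp (Z / e * x) * fourier h (Z / e) / e"
      using e by simp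
  qed
  also have "(LINT Z|std_normal_distribution. iexp (Z / e * x) * fourier h (Z / e) / e) =
      (LINT Z|lborel. std_normal_density Z *\<^sub>R (iexp (Z / e * x) * fourier h (Z / e) / e))"
    by (subst integral_density) (auto simp: normal_density_nonneg)
  also have "\<dots> = (LINT \<omega>|lborel. complex_of_real (std_normal_density (e * \<omega>)) * (iexp (\<omega> * x) * fourier h \<omega>))"
  proof -
    let ?G = "\<lambda>\<omega>. complex_of_real (std_normal_density (e * \<omega>)) * (iexp (\<omega> * x) * fourier h \<omega>)"
    have "(LINT Z|lborel. std_normal_density Z *\<^sub>R (iexp (Z / e * x) * fourier h (Z / e) / e)) =
        e *\<^sub>R (LINT \<omega>|lborel. (1 / e) *\<^sub>R ?G \<omega>)"
      using e by (subst lborel_integral_real_affine[where c = e and t = 0])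
        (auto simp: scaleR_conv_of_real mult_ac intro!: Bochner_Integration.integral_cong)
    also have "\<dots> = e *\<^sub>R ((1 / e) *\<^sub>R (LINT \<omega>|lborel. ?G \<omega>))"
      by (simp only: integral_scaleR_right)
    finally show ?thesis using e by simp
  qed
  finally show ?thesis .
qed

lemma integral_gaussian: "(LINT z|lborel. exp (- z\<^sup>2 / 2)) = sqrt (2 * pi)"
proof -
  have "(LINT z|lborel. std_normal_density z) = 1"
    by (rule integral_normal_density) simp
  then have "1 / sqrt (2 * pi) * (LINT z|lborel. exp (- z\<^sup>2 / 2)) = 1"
    by (simp only: std_normal_density_def integral_mult_right_zero)
  then have "sqrt (2 * pi) * (1 / sqrt (2 * pi) * (LINT z|lborel. exp (- z\<^sup>2 / 2))) = sqrt (2 * pi)"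
    by (simp only: mult_1_right)
  then show ?thesis by (simp only: mult.assoc[symmetric]) simp
qed

lemma integrable_gaussian: "integrable lborel (\<lambda>z::real. exp (- z\<^sup>2 / 2))"
proof -
  have "integrable lborel (\<lambda>z. sqrt (2 * pi) * std_normal_density z)"
    by (intro integrable_mult_right integrable_normal_density) simp
  then show ?thesis by (simp add: std_normal_density_def)
qed

text \<open>Averaging \<open>h\<close> over Gaussians of vanishing width gives \<open>h\<close> by continuity, while on the
  Fourier side the weight increases to a constant.\<close>

theorem fourier_inversion:
  fixes h :: "real \<Rightarrow> real"
  assumes h: "integrable lborel h" and cont: "continuous_on UNIV h"
    and bound: "\<And>x. \<bar>h x\<bar> \<le> B"
    and Fh: "integrable lborel (fourier h)"
  shows "complex_of_real (2 * pi * h x) = (LINT \<omega>|lborel. iexp (\<omega> * x) * fourier h \<omega>)"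
proof -
  have [measurable]: "h \<in> borel_measurable borel" using h by auto
  define e where "e n = 1 / real (Suc n)" for n
  have e: "e n > 0" for n by (simp add: e_def)
  have e0: "e \<longlonglongrightarrow> 0"
    unfolding e_def by (rule LIMSEQ_Suc[OF lim_1_over_n])
  have "(\<lambda>n. LINT z|lborel. complex_of_real (h (x - e n * z)) * complex_of_real (exp (- z\<^sup>2 / 2)))
      \<longlonglongrightarrow> (LINT z|lborel. complex_of_real (h x) * complex_of_real (exp (- z\<^sup>2 / 2)))"
  proof (rule integral_dominated_convergence[where w = "\<lambda>z. B * exp (- z\<^sup>2 / 2)"])
    show "integrable lborel (\<lambda>z. B * exp (- z\<^sup>2 / 2))"
      by (intro integrable_mult_right integrable_gaussian)
    show "AE z in lborel. (\<lambda>n. complex_of_real (h (x - e n * z)) * complex_of_real (exp (- z\<^sup>2 / 2)))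
        \<longlonglongrightarrow> complex_of_real (h x) * complex_of_real (exp (- z\<^sup>2 / 2))"
    proof (intro AE_I2 tendsto_mult tendsto_of_real tendsto_const)
      fix z :: real
      have "(\<lambda>n. x - e n * z) \<longlonglongrightarrow> x - 0 * z"
        by (intro tendsto_intros e0)
      with cont show "(\<lambda>n. h (x - e n * z)) \<longlonglongrightarrow> h x"
        by (auto intro: continuous_on_tendsto_compose)
    qed
    show "AE z in lborel. cmod (complex_of_real (h (x - e n * z)) * complex_of_real (exp (- z\<^sup>2 / 2))) \<le> B * exp (- z\<^sup>2 / 2)" for n
      using bound by (auto simp: norm_mult)
  qed measurable
  moreover have "(LINT z|lborel. complex_of_real (h x) * complex_of_real (exp (- z\<^sup>2 / 2))) = complex_of_real (h x * sqrt (2 * pi))"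
    using integral_gaussian by simp
  moreover have "(\<lambda>n. LINT z|lborel. complex_of_real (h (x - e n * z)) * complex_of_real (exp (- z\<^sup>2 / 2)))
      \<longlonglongrightarrow> (LINT \<omega>|lborel. complex_of_real (1 / sqrt (2 * pi)) * (iexp (\<omega> * x) * fourier h \<omega>))"
    unfolding gaussian_mean_eq_fourier[OF h e]
  proof (rule integral_dominated_convergence[where w = "\<lambda>\<omega>. cmod (fourier h \<omega>)"])
    show "integrable lborel (\<lambda>\<omega>. cmod (fourier h \<omega>))" using Fh by simp
    show "AE \<omega> in lborel. (\<lambda>n. complex_of_real (std_normal_density (e n * \<omega>)) * (iexp (\<omega> * x) * fourier h \<omega>))
       \<longlonglongrightarrow> complex_of_real (1 / sqrt (2 * pi)) * (iexp (\<omega> * x) * fourier h \<omega>)"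
    proof (intro AE_I2 tendsto_mult tendsto_of_real tendsto_const)
      fix \<omega> :: real
      have "(\<lambda>n. std_normal_density (e n * \<omega>)) \<longlonglongrightarrow> 1 / sqrt (2 * pi) * exp (- (0 * \<omega>)\<^sup>2 / 2)"
        unfolding std_normal_density_def by (intro tendsto_intros e0) auto
      then show "(\<lambda>n. std_normal_density (e n * \<omega>)) \<longlonglongrightarrow> 1 / sqrt (2 * pi)" by simp
    qed
    have "std_normal_density t \<le> 1" for t
    proof -
      have "exp (- t\<^sup>2 / 2) \<le> 1" by simp
      also have "1 \<le> sqrt (2 * pi)" using pi_gt3 by simp
      finally show ?thesis by (simp add: std_normal_density_def)
    qed
    then show "AE \<omega> in lborel. cmod (complex_of_real (std_normal_density (e n * \<omega>)) * (iexp (\<omega> * x) * fourier h \<omega>))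
        \<le> cmod (fourier h \<omega>)" for n
      by (auto simp: norm_mult normal_density_nonneg intro!: mult_left_le_one_le)
  qed measurable
  ultimately have "complex_of_real (h x * sqrt (2 * pi)) =
      complex_of_real (1 / sqrt (2 * pi)) * (LINT \<omega>|lborel. iexp (\<omega> * x) * fourier h \<omega>)"
    by (auto dest: LIMSEQ_unique)
  then have "complex_of_real (sqrt (2 * pi)) * complex_of_real (h x * sqrt (2 * pi)) =
      complex_of_real (sqrt (2 * pi) * (1 / sqrt (2 * pi))) * (LINT \<omega>|lborel. iexp (\<omega> * x) * fourier h \<omega>)"
    by simp
  also have "sqrt (2 * pi) * (1 / sqrt (2 * pi)) = 1" by simp
  also have "complex_of_real (sqrt (2 * pi)) * complex_of_real (h x * sqrt (2 * pi)) =
      complex_of_real (2 * pi * h x)"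
    by (metis (no_types, lifting) mult.commute mult.left_commute of_real_mult pi_ge_zero
        real_sqrt_mult_self abs_of_nonneg mult_nonneg_nonneg zero_le_numeral)
  finally show ?thesis by simp
qed

lemma abs_le_integral_fourier:
  fixes h :: "real \<Rightarrow> real"
  assumes "integrable lborel h" "continuous_on UNIV h" "\<And>x. \<bar>h x\<bar> \<le> B" "integrable lborel (fourier h)"
  shows "2 * pi * \<bar>h x\<bar> \<le> (LINT \<omega>|lborel. cmod (fourier h \<omega>))"
proof -
  have "2 * pi * \<bar>h x\<bar> = cmod (complex_of_real (2 * pi * h x))"
    by (simp only: norm_of_real abs_mult) simp
  also have "\<dots> = cmod (LINT \<omega>|lborel. iexp (\<omega> * x) * fourier h \<omega>)"
    by (simp only: fourier_inversion[OF assms])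
  also have "\<dots> \<le> (LINT \<omega>|lborel. cmod (iexp (\<omega> * x) * fourier h \<omega>))"
    by (rule integral_norm_bound)
  finally show ?thesis by (simp add: norm_mult)
qed

text \<open>Inserting the inversion formula for one of the two factors \<open>h\<close> and exchanging the integrals leaves
  the product of the transform with its conjugate, because \<open>h\<close> is real.\<close>

theorem plancherel:
  fixes h :: "real \<Rightarrow> real"
  assumes h: "integrable lborel h" and cont: "continuous_on UNIV h"
    and bound: "\<And>x. \<bar>h x\<bar> \<le> B"
    and Fh: "integrable lborel (fourier h)"
  shows "integrable lborel (\<lambda>\<omega>. (cmod (fourier h \<omega>))\<^sup>2)"
    and "2 * pi * (LINT x|lborel. (h x)\<^sup>2) = (LINT \<omega>|lborel. (cmod (fourier h \<omega>))\<^sup>2)"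
proof -
  have [measurable]: "h \<in> borel_measurable borel" using h by auto
  let ?A = "LINT x|lborel. \<bar>h x\<bar>"
  show int2: "integrable lborel (\<lambda>\<omega>. (cmod (fourier h \<omega>))\<^sup>2)"
  proof (rule Bochner_Integration.integrable_bound)
    show "integrable lborel (\<lambda>\<omega>. ?A * cmod (fourier h \<omega>))" using Fh by simp
    show "AE \<omega> in lborel. norm ((cmod (fourier h \<omega>))\<^sup>2) \<le> norm (?A * cmod (fourier h \<omega>))"
      using norm_fourier_le[of h] by (auto simp: power2_eq_square abs_mult intro!: mult_right_mono)
  qed measurable
  let ?F = "\<lambda>x \<omega>. complex_of_real (h x) * (iexp (\<omega> * x) * fourier h \<omega>)"
  have "integrable (lborel \<Otimes>\<^sub>M lborel) (case_prod ?F)"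
  proof (rule lborel_pair.Fubini_integrable)
    show "integrable lborel (\<lambda>x. LINT \<omega>|lborel. cmod (case (x, \<omega>) of (x, \<omega>) \<Rightarrow> ?F x \<omega>))"
      using h by (simp add: norm_mult)
    show "AE x in lborel. integrable lborel (\<lambda>\<omega>. case (x, \<omega>) of (x, \<omega>) \<Rightarrow> ?F x \<omega>)"
    proof (intro AE_I2)
      fix x
      show "integrable lborel (\<lambda>\<omega>. case (x, \<omega>) of (x, \<omega>) \<Rightarrow> ?F x \<omega>)"
        by (rule Bochner_Integration.integrable_bound[where f = "\<lambda>\<omega>. h x *\<^sub>R fourier h \<omega>"])
          (use Fh in \<open>auto simp: norm_mult\<close>)
    qed
  qed measurable
  note fub = lborel_pair.Fubini_integral[OF this]
  have "complex_of_real (2 * pi * (LINT x|lborel. (h x)\<^sup>2)) =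
      (LINT x|lborel. complex_of_real (h x) * complex_of_real (2 * pi * h x))"
    by (simp flip: integral_mult_right_zero integral_complex_of_real add: power2_eq_square mult_ac)
  also have "\<dots> = (LINT x|lborel. LINT \<omega>|lborel. ?F x \<omega>)"
    by (simp only: fourier_inversion[OF assms] integral_mult_right_zero)
  also have "\<dots> = (LINT \<omega>|lborel. LINT x|lborel. ?F x \<omega>)"
    by (rule fub[symmetric])
  also have "\<dots> = (LINT \<omega>|lborel. complex_of_real ((cmod (fourier h \<omega>))\<^sup>2))"
  proof (rule Bochner_Integration.integral_cong[OF refl])
    fix \<omega>
    have "(LINT x|lborel. ?F x \<omega>) =
        (LINT x|lborel. complex_of_real (h x) * iexp (\<omega> * x)) * fourier h \<omega>"
      by (simp flip: integral_mult_left_zero add: mult_ac)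
    also have "(LINT x|lborel. complex_of_real (h x) * iexp (\<omega> * x)) = cnj (fourier h \<omega>)"
    proof -
      have "cnj (fourier h \<omega>) = (LINT x|lborel. cnj (complex_of_real (h x) * iexp (- (\<omega> * x))))"
        unfolding fourier_lborel[OF \<open>h \<in> borel_measurable borel\<close>] by (rule Bochner_Integration.integral_cnj[symmetric])
      also have "\<dots> = (LINT x|lborel. complex_of_real (h x) * iexp (\<omega> * x))"
        by (rule Bochner_Integration.integral_cong[OF refl]) (simp add: exp_cnj)
      finally show ?thesis ..
    qed
    finally show "(LINT x|lborel. ?F x \<omega>) = complex_of_real ((cmod (fourier h \<omega>))\<^sup>2)"
      by (simp only: complex_norm_square mult.commute)
  qed
  also have "\<dots> = complex_of_real (LINT \<omega>|lborel. (cmod (fourier h \<omega>))\<^sup>2)"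
    by (rule integral_complex_of_real)
  finally show "2 * pi * (LINT x|lborel. (h x)\<^sup>2) = (LINT \<omega>|lborel. (cmod (fourier h \<omega>))\<^sup>2)"
    by (simp only: of_real_eq_iff)
qed

section \<open>Fourier transforms of test functions and convolutions\<close>

lemma lborel_nonneg_has_integral:
  fixes f :: "real \<Rightarrow> real"
  assumes "f \<in> borel_measurable borel" "S \<in> sets borel" "\<And>x. x \<in> S \<Longrightarrow> 0 \<le> f x" "(f has_integral I) S"
  shows "integrable lborel (\<lambda>x. indicator S x * f x)"
    and "(LINT x|lborel. indicator S x * f x) = I"
proof -
  have "0 \<le> I" using assms(3,4) by (rule has_integral_nonneg[rotated])
  moreover have "(\<integral>\<^sup>+x. ennreal (indicator S x * f x) \<partial>lborel) = ennreal I"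
    using nn_integral_has_integral_lebesgue[of S f I, OF assms(3,4)] by simp
  ultimately have "has_bochner_integral lborel (\<lambda>x. indicator S x * f x) I"
    using assms by (intro has_bochner_integral_nn_integral) (auto simp: indicator_def)
  then show "integrable lborel (\<lambda>x. indicator S x * f x)"
    "(LINT x|lborel. indicator S x * f x) = I"
    by (auto simp: has_bochner_integral_iff)
qed

lemma integral_deriv_compact_support:
  fixes F :: "real \<Rightarrow> 'a::euclidean_space"
  assumes "\<And>x. (F has_vector_derivative f x) (at x)" "continuous_on UNIV f"
    and "\<And>x. x \<notin> unit_ival \<Longrightarrow> F x = 0" "\<And>x. x \<notin> unit_ival \<Longrightarrow> f x = 0"
  shows "(LINT x|lborel. f x) = 0"
proof -
  have "(LINT x|lborel. indicator {0..1} x *\<^sub>R f x) = F 1 - F 0"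
    using assms(1,2) by (intro integral_FTC_atLeastAtMost)
      (auto intro: has_vector_derivative_at_within continuous_on_subset)
  moreover have "(\<lambda>x. indicator {0..1} x *\<^sub>R f x) = f"
    using assms(4) by (auto simp: indicator_def fun_eq_iff)
  ultimately show ?thesis using assms(3) by simp
qed

lemma fourier_deriv:
  assumes \<phi>: "\<phi> \<in> test_functions"
  shows "fourier (deriv \<phi>) \<omega> = \<i> * \<omega> * fourier \<phi> \<omega>"
proof -
  note d\<phi> = test_deriv[OF \<phi>]
  have [measurable]: "\<phi> \<in> borel_measurable borel" "deriv \<phi> \<in> borel_measurable borel"
    using \<phi> d\<phi> by (auto intro: test_measurable)
  let ?e = "\<lambda>x. iexp (- (\<omega> * x))"
  have "(LINT x|lborel. complex_of_real (deriv \<phi> x) * ?e x - \<i> * \<omega> * (complex_of_real (\<phi> x) * ?e x)) = 0"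
  proof (rule integral_deriv_compact_support)
    fix x
    have 1: "((\<lambda>x. complex_of_real (\<phi> x)) has_vector_derivative complex_of_real (deriv \<phi> x)) (at x)"
      using smooth_has_deriv[OF test_smooth[OF \<phi>]]
      by (intro has_vector_derivative_of_real) (simp add: has_real_derivative_iff_has_vector_derivative)
    have 2: "(?e has_vector_derivative - (\<i> * \<omega>) * ?e x) (at x)"
    proof -
      have "((\<lambda>z. exp (- (\<i> * \<omega>) * z)) has_field_derivative - (\<i> * \<omega>) * exp (- (\<i> * \<omega>) * of_real x)) (at (of_real x))"
        by (auto intro!: derivative_eq_intros)
      from has_vector_derivative_real_field[OF this] show ?thesis
        by (simp add: mult.assoc)
    qed
    show "((\<lambda>x. complex_of_real (\<phi> x) * ?e x) has_vector_derivative
        complex_of_real (deriv \<phi> x) * ?e x - \<i> * \<omega> * (complex_of_real (\<phi> x) * ?e x)) (at x)"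
      using has_vector_derivative_mult[OF 1 2] by (simp add: algebra_simps)
  qed (use test_outside[OF \<phi>] test_outside[OF d\<phi>] in
      \<open>auto intro!: continuous_intros smooth_continuous test_smooth \<phi> d\<phi>\<close>)
  also have "(LINT x|lborel. complex_of_real (deriv \<phi> x) * ?e x - \<i> * \<omega> * (complex_of_real (\<phi> x) * ?e x)) =
      fourier (deriv \<phi>) \<omega> - \<i> * \<omega> * fourier \<phi> \<omega>"
    using integrable_mult_iexp[OF test_integrable[OF \<phi>], of "- \<omega>"]
      integrable_mult_iexp[OF test_integrable[OF d\<phi>], of "- \<omega>"]
    by (simp add: fourier_lborel)
  finally show ?thesis by simp
qed

text \<open>Exponent \<open>2\<close> yields integrability of transforms of test functions; exponent \<open>2 \<mu>\<close> with
  \<open>\<mu> > 1 / 2\<close> yields the Sobolev embedding.\<close>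

lemma integrable_inverse_powr:
  fixes e :: real
  assumes "1 < e"
  shows "integrable lborel (\<lambda>\<omega>. 1 / (1 + \<bar>\<omega>\<bar> powr e))"
proof -
  have tail: "integrable lborel (\<lambda>\<omega>. indicator {1..} \<omega> * \<omega> powr (- e))"
    using has_integral_powr_to_inf[of "- e" 1] assms
    by (intro lborel_nonneg_has_integral(1)[where I = "- (1 powr (- e + 1)) / (- e + 1)"]) auto
  then have tail': "integrable lborel (\<lambda>\<omega>. indicator {1..} (- \<omega>) * (- \<omega>) powr (- e))"
    using lborel_integrable_real_affine[OF tail, of "-1" 0] by simp
  have "integrable lborel (\<lambda>\<omega>. indicator {-1..1::real} \<omega> + indicator {1..} \<omega> * \<omega> powr (- e)
      + indicator {1..} (- \<omega>) * (- \<omega>) powr (- e))"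
    by (intro Bochner_Integration.integrable_add tail tail' integrable_real_indicator)
       (auto simp: emeasure_lborel_Icc_eq)
  then show ?thesis
  proof (rule Bochner_Integration.integrable_bound)
    have bd: "1 / (1 + \<bar>\<omega>\<bar> powr e) \<le> indicator {-1..1::real} \<omega> + indicator {1..} \<omega> * \<omega> powr (- e)
      + indicator {1..} (- \<omega>) * (- \<omega>) powr (- e)" for \<omega>
    proof (cases "\<omega> \<in> {-1..1}")
      case True
      have "1 / (1 + \<bar>\<omega>\<bar> powr e) \<le> 1"
        by (simp add: divide_le_eq_1 add_pos_nonneg)
      then show ?thesis using True by (auto simp: indicator_def)
    next
      case False
      then have "1 / (1 + \<bar>\<omega>\<bar> powr e) \<le> 1 / \<bar>\<omega>\<bar> powr e"
        by (intro divide_left_mono) (auto simp: add_pos_nonneg)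
      then show ?thesis using False by (auto simp: indicator_def powr_minus_divide)
    qed
    have "0 \<le> 1 / (1 + \<bar>\<omega>\<bar> powr e)" for \<omega> by simp
    then show "AE \<omega> in lborel. norm (1 / (1 + \<bar>\<omega>\<bar> powr e)) \<le> norm (indicator {-1..1::real} \<omega>
        + indicator {1..} \<omega> * \<omega> powr (- e) + indicator {1..} (- \<omega>) * (- \<omega>) powr (- e))"
      using bd by (intro AE_I2) (smt (verit, best) real_norm_def)
  qed measurable
qed

text \<open>Each derivative of \<open>\<phi>\<close> gains a factor \<open>1 / \<bar>\<omega>\<bar>\<close>; two suffice for integrability.\<close>

lemma fourier_test_decay:
  assumes \<phi>: "\<phi> \<in> test_functions"
  obtains C where "C \<ge> 0" "\<And>\<omega>. cmod (fourier \<phi> \<omega>) \<le> C / (1 + \<bar>\<omega>\<bar> powr 2)"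
proof -
  define C where "C = (LINT x|lborel. \<bar>\<phi> x\<bar>) + (LINT x|lborel. \<bar>deriv (deriv \<phi>) x\<bar>)"
  have "cmod (fourier \<phi> \<omega>) \<le> C / (1 + \<bar>\<omega>\<bar> powr 2)" for \<omega>
  proof -
    have "\<omega>\<^sup>2 * cmod (fourier \<phi> \<omega>) = cmod (fourier (deriv (deriv \<phi>)) \<omega>)"
      by (simp add: fourier_deriv test_deriv \<phi> norm_mult power2_eq_square)
    also have "\<dots> \<le> (LINT x|lborel. \<bar>deriv (deriv \<phi>) x\<bar>)"
      by (intro norm_fourier_le test_measurable test_deriv \<phi>)
    finally have "(1 + \<omega>\<^sup>2) * cmod (fourier \<phi> \<omega>) \<le> C"
      using norm_fourier_le[OF test_measurable[OF \<phi>], of \<omega>] by (simp add: C_def algebra_simps)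
    moreover have "1 + \<omega>\<^sup>2 > 0" by (simp add: add_pos_nonneg)
    ultimately show ?thesis by (simp add: pos_le_divide_eq mult.commute)
  qed
  moreover have "C \<ge> 0" by (simp add: C_def)
  ultimately show ?thesis using that by blast
qed

lemma fourier_test_integrable:
  assumes \<phi>: "\<phi> \<in> test_functions"
  shows "integrable lborel (fourier \<phi>)"
proof -
  obtain C where C: "C \<ge> 0" "\<And>\<omega>. cmod (fourier \<phi> \<omega>) \<le> C / (1 + \<bar>\<omega>\<bar> powr 2)"
    using fourier_test_decay[OF \<phi>] by blast
  have "integrable lborel (\<lambda>\<omega>. C * (1 / (1 + \<bar>\<omega>\<bar> powr 2)))"
    by (intro integrable_mult_right integrable_inverse_powr) simp
  then show ?thesis
    by (rule Bochner_Integration.integrable_bound)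
      (use C test_measurable[OF \<phi>] in auto)
qed

lemma test_plancherel:
  assumes "\<phi> \<in> test_functions"
  shows "integrable lborel (\<lambda>\<omega>. (cmod (fourier \<phi> \<omega>))\<^sup>2)"
    and "2 * pi * (LINT x|lborel. (\<phi> x)\<^sup>2) = (LINT \<omega>|lborel. (cmod (fourier \<phi> \<omega>))\<^sup>2)"
proof -
  obtain B where B: "B > 0" "\<And>x. \<bar>\<phi> x\<bar> \<le> B" using test_bounded[OF assms] by blast
  note * = test_integrable[OF assms] smooth_continuous[OF test_smooth[OF assms]] B(2)
    fourier_test_integrable[OF assms]
  show "integrable lborel (\<lambda>\<omega>. (cmod (fourier \<phi> \<omega>))\<^sup>2)"
    "2 * pi * (LINT x|lborel. (\<phi> x)\<^sup>2) = (LINT \<omega>|lborel. (cmod (fourier \<phi> \<omega>))\<^sup>2)"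
    by (rule plancherel[OF *])+
qed

abbreviation fourier_energy :: "real \<Rightarrow> (real \<Rightarrow> real) \<Rightarrow> real" where
  "fourier_energy \<mu> \<phi> \<equiv> LINT \<omega>|lborel. (\<bar>\<omega>\<bar> powr \<mu> * cmod (fourier \<phi> \<omega>))\<^sup>2"

lemma powr_weight_le:
  fixes \<mu> :: real
  assumes "0 \<le> \<mu>" "\<mu> \<le> 1"
  shows "(\<bar>\<omega>\<bar> powr \<mu> * c)\<^sup>2 \<le> c\<^sup>2 + (\<omega> * c)\<^sup>2"
proof -
  have "(\<bar>\<omega>\<bar> powr \<mu>)\<^sup>2 \<le> 1 + \<omega>\<^sup>2"
  proof (cases "\<bar>\<omega>\<bar> \<le> 1")
    case True
    then have "\<bar>\<omega>\<bar> powr \<mu> \<le> 1" using assms by (intro powr_le1) auto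
    then have "(\<bar>\<omega>\<bar> powr \<mu>)\<^sup>2 \<le> 1" by (simp add: power_le_one)
    then show ?thesis using zero_le_power2[of \<omega>] by linarith
  next
    case False
    then have "\<bar>\<omega>\<bar> powr \<mu> \<le> \<bar>\<omega>\<bar> powr 1" using assms by (intro powr_mono) auto
    then have "(\<bar>\<omega>\<bar> powr \<mu>)\<^sup>2 \<le> (\<bar>\<omega>\<bar>)\<^sup>2" using False by (intro power_mono) auto
    then show ?thesis by simp
  qed
  then have "(\<bar>\<omega>\<bar> powr \<mu>)\<^sup>2 * c\<^sup>2 \<le> (1 + \<omega>\<^sup>2) * c\<^sup>2" by (rule mult_right_mono) simp
  then show ?thesis by (simp add: power_mult_distrib algebra_simps)
qed

lemma test_weighted_fourier_integrable:
  assumes \<phi>: "\<phi> \<in> test_functions" and \<mu>: "0 \<le> \<mu>" "\<mu> \<le> 1"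
  shows "integrable lborel (\<lambda>\<omega>. (\<bar>\<omega>\<bar> powr \<mu> * cmod (fourier \<phi> \<omega>))\<^sup>2)"
proof -
  have "integrable lborel (\<lambda>\<omega>. (cmod (fourier \<phi> \<omega>))\<^sup>2 + (cmod (fourier (deriv \<phi>) \<omega>))\<^sup>2)"
    by (intro Bochner_Integration.integrable_add test_plancherel(1) test_deriv \<phi>)
  then show ?thesis
    by (rule Bochner_Integration.integrable_bound)
      (use powr_weight_le[OF \<mu>] test_measurable[OF \<phi>] in
        \<open>auto simp: fourier_deriv[OF \<phi>] norm_mult power_mult_distrib\<close>)
qed

definition convolution :: "(real \<Rightarrow> real) \<Rightarrow> (real \<Rightarrow> real) \<Rightarrow> real \<Rightarrow> real" where
  "convolution k \<psi> x = (LINT t|lborel. k t * \<psi> (x - t))"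

lemma abs_mult_le:
  fixes a b B :: real
  assumes "\<bar>b\<bar> \<le> B"
  shows "\<bar>a * b\<bar> \<le> B * \<bar>a\<bar>"
  using assms by (metis abs_ge_zero abs_mult mult.commute mult_right_mono)

lemma convolution_integrand:
  fixes k \<psi> :: "real \<Rightarrow> real"
  assumes "integrable lborel k" "\<psi> \<in> borel_measurable borel" "\<And>x. \<bar>\<psi> x\<bar> \<le> B"
  shows "integrable lborel (\<lambda>t. k t * \<psi> (x - t))"
proof (rule Bochner_Integration.integrable_bound)
  show "integrable lborel (\<lambda>t. B * k t)" using assms(1) by simp
  have "B \<ge> 0" using assms(3)[of 0] by linarith
  show "AE t in lborel. norm (k t * \<psi> (x - t)) \<le> norm (B * k t)"
    using abs_mult_le[OF assms(3)] \<open>B \<ge> 0\<close> by (auto simp: abs_mult)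
qed (use assms in measurable)

lemma convolution_bound:
  assumes "integrable lborel k" "\<psi> \<in> borel_measurable borel" "\<And>x. \<bar>\<psi> x\<bar> \<le> B"
  shows "\<bar>convolution k \<psi> x\<bar> \<le> B * (LINT t|lborel. \<bar>k t\<bar>)"
proof -
  have B: "B \<ge> 0" using assms(3)[of 0] by linarith
  have "\<bar>convolution k \<psi> x\<bar> \<le> (LINT t|lborel. \<bar>k t * \<psi> (x - t)\<bar>)"
    unfolding convolution_def
    using integral_norm_bound[of lborel "\<lambda>t. k t * \<psi> (x - t)"] by simp
  also have "\<dots> \<le> (LINT t|lborel. B * \<bar>k t\<bar>)"
    using convolution_integrand[OF assms, of x] assms(1) abs_mult_le[OF assms(3)]
    by (intro integral_mono) auto
  finally show ?thesis by simp
qed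

lemma convolution_continuous:
  assumes "integrable lborel k" "continuous_on UNIV \<psi>" "\<And>x. \<bar>\<psi> x\<bar> \<le> B"
  shows "continuous_on UNIV (convolution k \<psi>)"
  unfolding continuous_on_sequentially comp_def
proof safe
  fix X and x :: real assume X: "X \<longlonglongrightarrow> x"
  have [measurable]: "\<psi> \<in> borel_measurable borel"
    using assms(2) by (rule borel_measurable_continuous_onI)
  have [measurable]: "k \<in> borel_measurable borel" using assms(1) by auto
  show "(\<lambda>n. convolution k \<psi> (X n)) \<longlonglongrightarrow> convolution k \<psi> x"
    unfolding convolution_def
  proof (rule integral_dominated_convergence[where w = "\<lambda>t. B * \<bar>k t\<bar>"])
    show "integrable lborel (\<lambda>t. B * \<bar>k t\<bar>)" using assms(1) by simp
    show "AE t in lborel. (\<lambda>n. k t * \<psi> (X n - t)) \<longlonglongrightarrow> k t * \<psi> (x - t)"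
      using assms(2) X
      by (intro AE_I2 tendsto_intros continuous_on_tendsto_compose[OF assms(2)]) auto
    show "AE t in lborel. norm (k t * \<psi> (X n - t)) \<le> B * \<bar>k t\<bar>" for n
      using abs_mult_le[OF assms(3)] by auto
  qed measurable
qed

text \<open>This majorant justifies all uses of Fubini's theorem for convolutions: translation invariance makes
  the iterated integral of \<open>\<bar>k t * \<psi> (x - t)\<bar>\<close> a product of two norms.\<close>

lemma convolution_product_integrable:
  fixes F :: "real \<Rightarrow> real \<Rightarrow> 'a::{banach, second_countable_topology}"
  assumes "integrable lborel k" "integrable lborel \<psi>"
    and [measurable]: "case_prod F \<in> borel_measurable (lborel \<Otimes>\<^sub>M lborel)"
    and F: "\<And>t x. norm (F t x) \<le> B * \<bar>k t * \<psi> (x - t)\<bar>"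
  shows "integrable (lborel \<Otimes>\<^sub>M lborel) (case_prod F)"
proof -
  have [measurable]: "k \<in> borel_measurable borel" "\<psi> \<in> borel_measurable borel"
    using assms by auto
  have shift: "integrable lborel (\<lambda>x. \<psi> (x - t))" "(LINT x|lborel. \<bar>\<psi> (x - t)\<bar>) = (LINT x|lborel. \<bar>\<psi> x\<bar>)" for t
    using lborel_integrable_real_affine[OF assms(2), of 1 "- t"]
      lborel_integral_real_affine[of 1 "\<lambda>x. \<bar>\<psi> x\<bar>" "- t"]
    by simp_all
  have int: "integrable (lborel \<Otimes>\<^sub>M lborel) (\<lambda>(t, x). B * (k t * \<psi> (x - t)))"
  proof (rule lborel_pair.Fubini_integrable)
    show "integrable lborel (\<lambda>t. LINT x|lborel. norm (case (t, x) of (t, x) \<Rightarrow> B * (k t * \<psi> (x - t))))"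
      using assms(1) by (simp add: abs_mult shift(2))
  qed (use shift in auto)
  show ?thesis
  proof (rule Bochner_Integration.integrable_bound[OF int])
    have "norm (F t x) \<le> norm (B * (k t * \<psi> (x - t)))" for t x
    proof -
      have "norm (F t x) \<le> B * \<bar>k t * \<psi> (x - t)\<bar>" by (rule F)
      also have "\<dots> \<le> \<bar>B\<bar> * \<bar>k t * \<psi> (x - t)\<bar>" by (intro mult_right_mono) auto
      finally show ?thesis by (simp add: abs_mult)
    qed
    then show "AE p in lborel \<Otimes>\<^sub>M lborel. norm (case_prod F p)
        \<le> norm (case p of (t, x) \<Rightarrow> B * (k t * \<psi> (x - t)))"
      by auto
  qed measurable
qed

lemma convolution_integrable:
  assumes "integrable lborel k" "integrable lborel \<psi>"
  shows "integrable lborel (convolution k \<psi>)"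
proof -
  have [measurable]: "k \<in> borel_measurable borel" "\<psi> \<in> borel_measurable borel"
    using assms by auto
  have "integrable (lborel \<Otimes>\<^sub>M lborel) (\<lambda>(t, x). k t * \<psi> (x - t))"
    by (rule convolution_product_integrable[OF assms, of _ 1]) auto
  from lborel_pair.integrable_snd[OF this] show ?thesis
    by (simp add: convolution_def[abs_def])
qed

lemma fourier_convolution:
  assumes "integrable lborel k" "integrable lborel \<psi>"
  shows "fourier (convolution k \<psi>) \<omega> = fourier k \<omega> * fourier \<psi> \<omega>"
proof -
  have [measurable]: "k \<in> borel_measurable borel" "\<psi> \<in> borel_measurable borel"
    "convolution k \<psi> \<in> borel_measurable borel"
    using assms convolution_integrable[OF assms] by auto
  let ?F = "\<lambda>t x. complex_of_real (k t * \<psi> (x - t)) * iexp (- (\<omega> * x))"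
  have int: "integrable (lborel \<Otimes>\<^sub>M lborel) (case_prod ?F)"
    by (rule convolution_product_integrable[OF assms, of _ 1]) (auto simp: norm_mult)
  have "fourier (convolution k \<psi>) \<omega> = (LINT x|lborel. LINT t|lborel. ?F t x)"
    by (simp only: fourier_lborel[OF \<open>convolution k \<psi> \<in> borel_measurable borel\<close>] convolution_def
        integral_complex_of_real integral_mult_left_zero)
  also have "\<dots> = (LINT t|lborel. LINT x|lborel. ?F t x)"
    by (rule lborel_pair.Fubini_integral[OF int])
  also have "\<dots> = (LINT t|lborel. complex_of_real (k t) * iexp (- (\<omega> * t)) * fourier \<psi> \<omega>)"
  proof (rule Bochner_Integration.integral_cong[OF refl])
    fix t
    have "(LINT x|lborel. ?F t x) = (LINT x|lborel. ?F t (t + 1 * x))"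
      by (subst lborel_integral_real_affine[where c = 1 and t = t]) auto
    also have "\<dots> = (LINT x|lborel. (complex_of_real (k t) * iexp (- (\<omega> * t))) *
        (complex_of_real (\<psi> x) * iexp (- (\<omega> * x))))"
      by (rule Bochner_Integration.integral_cong[OF refl])
        (simp add: algebra_simps flip: exp_add)
    also have "\<dots> = complex_of_real (k t) * iexp (- (\<omega> * t)) * fourier \<psi> \<omega>"
      by (simp only: integral_mult_right_zero fourier_lborel[OF \<open>\<psi> \<in> borel_measurable borel\<close>])
    finally show "(LINT x|lborel. ?F t x) = complex_of_real (k t) * iexp (- (\<omega> * t)) * fourier \<psi> \<omega>" .
  qed
  also have "\<dots> = fourier k \<omega> * fourier \<psi> \<omega>"
    by (simp only: integral_mult_left_zero fourier_lborel[OF \<open>k \<in> borel_measurable borel\<close>])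
  finally show ?thesis .
qed

section \<open>The fundamental lemma of the calculus of variations\<close>

abbreviation unit_measure :: "real measure" where
  "unit_measure \<equiv> lebesgue_on unit_ival"

text \<open>The positive and negative parts of \<open>h\<close> are densities of two finite measures that agree on all open
  half lines, and hence everywhere.\<close>

lemma AE_zero_if_integrals_zero:
  fixes h :: "real \<Rightarrow> real"
  assumes h: "integrable lborel h" and zero: "\<And>c. (LINT x|lborel. indicator {c<..} x * h x) = 0"
  shows "AE x in lborel. h x = 0"
proof -
  have [measurable]: "h \<in> borel_measurable borel" using h by auto
  define p where "p x = max (h x) 0" for x
  define q where "q x = max (- h x) 0" for x
  have [measurable]: "p \<in> borel_measurable borel" "q \<in> borel_measurable borel"
    by (simp_all add: p_def[abs_def] q_def[abs_def])
  have nonneg: "0 \<le> p x" "0 \<le> q x" for x by (auto simp: p_def q_def)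
  have ip: "integrable lborel (\<lambda>x. indicator {c<..} x * p x)"
    and iq: "integrable lborel (\<lambda>x. indicator {c<..} x * q x)" for c
    by (rule Bochner_Integration.integrable_bound[OF h], measurable, rule AE_I2,
        simp add: p_def q_def indicator_def abs_ge_self abs_ge_minus_self)+
  have em: "emeasure (density lborel (\<lambda>x. ennreal (p x))) {c<..} = ennreal (LINT x|lborel. indicator {c<..} x * p x)"
    "emeasure (density lborel (\<lambda>x. ennreal (q x))) {c<..} = ennreal (LINT x|lborel. indicator {c<..} x * q x)" for c
    using nn_integral_eq_integral[OF ip[of c]] nn_integral_eq_integral[OF iq[of c]] nonneg
    by (simp_all add: emeasure_density ennreal_mult'' ennreal_indicator mult.commute)
  have "density lborel (\<lambda>x. ennreal (p x)) = density lborel (\<lambda>x. ennreal (q x))"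
  proof (rule measure_eqI_lessThan)
    fix c
    have "(LINT x|lborel. indicator {c<..} x * p x) - (LINT x|lborel. indicator {c<..} x * q x) =
        (LINT x|lborel. indicator {c<..} x * p x - indicator {c<..} x * q x)"
      by (rule Bochner_Integration.integral_diff[symmetric]) (rule ip iq)+
    also have "(\<lambda>x. indicator {c<..} x * p x - indicator {c<..} x * q x) = (\<lambda>x. indicator {c<..} x * h x)"
      by (auto simp: fun_eq_iff p_def q_def indicator_def max_def)
    finally show "emeasure (density lborel (\<lambda>x. ennreal (p x))) {c<..} =
        emeasure (density lborel (\<lambda>x. ennreal (q x))) {c<..}"
      by (simp add: em zero)
    show "emeasure (density lborel (\<lambda>x. ennreal (p x))) {c<..} < \<infinity>"
      by (simp add: em)
  qed auto
  then have "AE x in lborel. ennreal (p x) = ennreal (q x)"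
    by (intro sigma_finite_measure.density_unique[OF sigma_finite_lborel]) auto
  then show ?thesis
    by eventually_elim (use nonneg in \<open>auto simp: p_def q_def max_def split: if_splits\<close>)
qed

text \<open>By dominated convergence along smooth bumps, \<open>h\<close> has integral zero over every open interval whose
  closure lies in \<open>(0,1)\<close>.\<close>

lemma fundamental_lemma:
  assumes h: "\<And>a b. 0 < a \<Longrightarrow> b < 1 \<Longrightarrow> h absolutely_integrable_on {a..b::real}"
    and zero: "\<And>\<phi>. \<phi> \<in> test_functions \<Longrightarrow> L2_inner h \<phi> = 0"
  shows "AE x in unit_measure. h x = 0"
proof -
  have int: "(LINT x|lebesgue. indicator {a<..<b} x * h x) = 0" if ab: "0 < a" "b < 1" for a b
  proof (cases "a < b")
    case True
    obtain \<psi> where \<psi>: "\<And>n. \<psi> n \<in> test_functions" "\<And>n x. \<bar>\<psi> n x\<bar> \<le> indicator {a<..<b} x"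
      "\<And>x. (\<lambda>n. \<psi> n x) \<longlonglongrightarrow> indicator {a<..<b} x"
      using interval_approx[OF ab(1) True ab(2)] by blast
    have hi: "integrable lebesgue (\<lambda>x. indicator {a..b} x * h x)"
      using h[OF ab] by (simp add: set_integrable_def)
    have hm: "(\<lambda>x. indicator {a..b} x * h x) \<in> borel_measurable lebesgue"
      using hi by auto
    have eq: "h x * \<psi> n x = (indicator {a..b} x * h x) * \<psi> n x" for n x
      using \<psi>(2)[of n x] by (cases "x \<in> {a<..<b}") auto
    have "(\<lambda>n. LINT x|lebesgue. h x * \<psi> n x) \<longlonglongrightarrow> (LINT x|lebesgue. h x * indicator {a<..<b} x)"
    proof (rule integral_dominated_convergence[where w = "\<lambda>x. \<bar>indicator {a..b} x * h x\<bar>"])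
      show "integrable lebesgue (\<lambda>x. \<bar>indicator {a..b} x * h x\<bar>)" using hi by simp
      show "(\<lambda>x. h x * \<psi> n x) \<in> borel_measurable lebesgue" for n
        unfolding eq
        by (intro borel_measurable_times hm measurable_completion)
          (simp add: test_measurable \<psi>)
      have "(\<lambda>x. (indicator {a..b} x * h x) * indicator {a<..<b} x) \<in> borel_measurable lebesgue"
        by (intro borel_measurable_times hm measurable_completion) auto
      moreover have "(\<lambda>x. (indicator {a..b} x * h x) * indicator {a<..<b} x) = (\<lambda>x. h x * indicator {a<..<b} x)"
        by (auto simp: indicator_def)
      ultimately show "(\<lambda>x. h x * indicator {a<..<b} x) \<in> borel_measurable lebesgue" by simp
      show "AE x in lebesgue. (\<lambda>n. h x * \<psi> n x) \<longlonglongrightarrow> h x * indicator {a<..<b} x"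
        by (intro AE_I2 tendsto_intros \<psi>)
      show "AE x in lebesgue. norm (h x * \<psi> n x) \<le> \<bar>indicator {a..b} x * h x\<bar>" for n
      proof (rule AE_I2)
        fix x
        have "\<bar>\<psi> n x\<bar> \<le> 1" using \<psi>(2)[of n x] by (cases "x \<in> {a<..<b}") auto
        then show "norm (h x * \<psi> n x) \<le> \<bar>indicator {a..b} x * h x\<bar>"
          unfolding eq by (simp add: abs_mult mult_left_le)
      qed
    qed
    moreover have "(LINT x|lebesgue. h x * \<psi> n x) = 0" for n
    proof -
      have "(LINT x|lebesgue. h x * \<psi> n x) = (LINT x|lebesgue. indicator unit_ival x *\<^sub>R (h x * \<psi> n x))"
        using test_outside[OF \<psi>(1)] by (intro Bochner_Integration.integral_cong) (auto simp: indicator_def)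
      also have "\<dots> = L2_inner h (\<psi> n)"
        unfolding L2_inner_def by (rule integral_restrict_space[symmetric]) simp
      finally show ?thesis using zero[OF \<psi>(1)] by simp
    qed
    ultimately show ?thesis by (simp add: LIMSEQ_const_iff mult.commute)
  qed auto
  have "AE x in lebesgue. x \<in> {a<..<b} \<longrightarrow> h x = 0" if ab: "0 < a" "b < 1" for a b
  proof -
    have hi: "integrable lebesgue (\<lambda>x. indicator {a<..<b} x * h x)"
    proof -
      have "h absolutely_integrable_on {a<..<b}"
        using h[OF ab] by (rule set_integrable_subset) auto
      then show ?thesis by (simp add: set_integrable_def)
    qed
    then have "(\<lambda>x. indicator {a<..<b} x * h x) \<in> borel_measurable lebesgue" by auto
    from completion_ex_borel_measurable_real[OF this]
    obtain h' where h'[measurable]: "h' \<in> borel_measurable lborel"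
      and eq: "AE x in lborel. indicator {a<..<b} x * h x = h' x" by blast
    have eq': "AE x in lebesgue. indicator {a<..<b} x * h x = h' x"
      using eq by (rule AE_completion)
    have m: "h' \<in> borel_measurable lebesgue" using h' by (rule measurable_completion)
    have "integrable lebesgue h'"
      using integrable_cong_AE_imp[OF hi m] eq' by (auto simp: eq_commute)
    then have hi': "integrable lborel h'" by (simp add: integrable_completion)
    have "AE x in lborel. h' x = 0"
    proof (rule AE_zero_if_integrals_zero[OF hi'])
      fix c
      have "(LINT x|lborel. indicator {c<..} x * h' x) = (LINT x|lebesgue. indicator {c<..} x * h' x)"
        by (rule integral_completion[symmetric]) measurable
      also have "\<dots> = (LINT x|lebesgue. indicator {max a c<..<b} x * h x)"
      proof (rule integral_cong_AE)
        show "AE x in lebesgue. indicator {c<..} x * h' x = indicator {max a c<..<b} x * h x"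
          using eq' by eventually_elim (auto simp: indicator_def split: if_splits)
        have "h absolutely_integrable_on {max a c<..<b}"
          using h[OF ab] by (rule set_integrable_subset) auto
        then show "(\<lambda>x. indicator {max a c<..<b} x * h x) \<in> borel_measurable lebesgue"
          by (auto simp: set_integrable_def)
        show "(\<lambda>x. indicator {c<..} x * h' x) \<in> borel_measurable lebesgue"
          by (rule measurable_completion) measurable
      qed
      also have "\<dots> = 0" using int[of "max a c" b] ab by simp
      finally show "(LINT x|lborel. indicator {c<..} x * h' x) = 0" .
    qed
    then have "AE x in lebesgue. h' x = 0" by (rule AE_completion)
    with eq' show ?thesis by eventually_elim auto
  qed
  from this[of "1 / real (n + 3)" "1 - 1 / real (n + 3)" for n]
  have "AE x in lebesgue. \<forall>n. x \<in> {1 / real (n + 3)<..<1 - 1 / real (n + 3)} \<longrightarrow> h x = 0"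
    by (subst AE_all_countable) auto
  then have "AE x in lebesgue. x \<in> unit_ival \<longrightarrow> h x = 0"
  proof eventually_elim
    case (elim x)
    show ?case
    proof
      assume x: "x \<in> unit_ival"
      obtain n where n: "1 / real (Suc n) < min x (1 - x)"
        using x reals_Archimedean[of "min x (1 - x)"] by (auto simp: inverse_eq_divide)
      have "1 / real (n + 3) \<le> 1 / real (Suc n)" by (intro divide_left_mono) auto
      with n have "x \<in> {1 / real (n + 3)<..<1 - 1 / real (n + 3)}" by auto
      with elim show "h x = 0" by blast
    qed
  qed
  then show ?thesis by (simp add: AE_restrict_space_iff)
qed

text \<open>The primitive vanishes to the right of the support precisely because \<open>\<eta>\<close> has total mass zero.\<close>

lemma test_antiderivative:
  assumes \<eta>: "\<eta> \<in> test_functions" and zero: "(LINT x|lborel. \<eta> x) = 0"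
  obtains \<Phi> where "\<Phi> \<in> test_functions" "deriv \<Phi> = \<eta>"
proof -
  obtain a b where ab: "0 < a" "a < b" "b < 1" "\<And>x. x \<notin> {a..b} \<Longrightarrow> \<eta> x = 0"
    using test_support[OF \<eta>] by blast
  have cont: "continuous_on S \<eta>" for S by (intro smooth_continuous test_smooth \<eta>)
  define \<Phi> where "\<Phi> x = (if x \<in> unit_ival then integral {0..x} \<eta> else 0)" for x
  have int0: "integral S \<eta> = 0" if "\<And>x. x \<in> S \<Longrightarrow> \<eta> x = 0" for S
    using Henstock_Kurzweil_Integration.integral_cong[of S \<eta> "\<lambda>_. 0"] that by simp
  have left: "\<Phi> x = 0" if "x < a" for x
    unfolding \<Phi>_def using ab(4) that by (auto intro!: int0)
  have total: "integral {0..1} \<eta> = 0"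
  proof -
    have "(\<eta> has_integral 0) UNIV"
      using has_integral_integral_lborel[OF test_integrable[OF \<eta>]] zero by simp
    then have "((\<lambda>x. if x \<in> {0..1} then \<eta> x else 0) has_integral 0) UNIV"
      by (rule has_integral_eq[rotated]) (use test_outside[OF \<eta>] in auto)
    then show ?thesis unfolding has_integral_restrict_UNIV by (rule integral_unique)
  qed
  have right: "\<Phi> x = 0" if "b < x" for x
  proof (cases "x < 1")
    case True
    have "integral {0..x} \<eta> + integral {x..1} \<eta> = integral {0..1} \<eta>"
      using that ab True by (intro Henstock_Kurzweil_Integration.integral_combine
          integrable_continuous_interval cont) auto
    moreover have "integral {x..1} \<eta> = 0" using ab(4) that by (auto intro!: int0)
    ultimately show ?thesis using total by (simp add: \<Phi>_def)
  qed (auto simp: \<Phi>_def)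
  have D: "(\<Phi> has_real_derivative \<eta> x) (at x)" for x
  proof (cases "x \<in> {a..b}")
    case True
    then have x: "x \<in> unit_ival" using ab by auto
    have "((\<lambda>x. integral {0..x} \<eta>) has_real_derivative \<eta> x) (at x within {0..1})"
      by (rule integral_has_real_derivative) (use x cont in auto)
    then have "((\<lambda>x. integral {0..x} \<eta>) has_real_derivative \<eta> x) (at x)"
      using x by (simp add: at_within_Icc_at)
    moreover have "\<forall>\<^sub>F y in nhds x. \<Phi> y = integral {0..y} \<eta>"
      using eventually_nhds_in_open[of unit_ival x] x by (auto elim!: eventually_mono simp: \<Phi>_def)
    ultimately show ?thesis
      using DERIV_cong_ev[OF refl _ refl, of \<Phi> "\<lambda>x. integral {0..x} \<eta>"] by simp
  next
    case False
    have "\<forall>\<^sub>F y in nhds x. y \<in> - {a..b}"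
      using eventually_nhds_in_open[of "- {a..b}" x] False by auto
    then have ev: "\<forall>\<^sub>F y in nhds x. \<Phi> y = 0"
      by eventually_elim (use left right in force)
    show ?thesis
      using DERIV_cong_ev[OF refl ev refl] ab(4)[OF False] by simp
  qed
  have "smooth \<Phi>"
    by (rule smooth_coinduct[where P = "\<lambda>h. h = \<Phi> \<or> smooth h"])
      (use D test_smooth[OF \<eta>] smooth_has_deriv smooth_deriv in blast)+
  then have "\<Phi> \<in> test_functions"
    using ab left right by (intro test_functionsI[of _ a b]) force+
  moreover have "deriv \<Phi> = \<eta>" using D by (auto intro!: DERIV_imp_deriv)
  ultimately show ?thesis by (rule that)
qed

lemma exists_normalized_test:
  obtains \<psi> where "\<psi> \<in> test_functions" "(LINT x|lborel. \<psi> x) = 1"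
proof -
  obtain \<psi> where \<psi>: "\<And>n. \<psi> n \<in> test_functions" "\<And>n x. \<bar>\<psi> n x\<bar> \<le> indicator {1/3<..<2/3} x"
    "\<And>x. (\<lambda>n. \<psi> n x) \<longlonglongrightarrow> indicator {1/3<..<2/3::real} x"
    using interval_approx[of "1/3" "2/3"] by auto
  have "(\<lambda>n. LINT x|lborel. \<psi> n x) \<longlonglongrightarrow> (LINT x|lborel. indicator {1/3<..<2/3::real} x)"
    by (rule integral_dominated_convergence[where w = "indicator {1/3<..<2/3}"])
      (use \<psi> in \<open>auto intro!: test_measurable integrable_real_indicator\<close>)
  also have "(LINT x|lborel. indicator {1/3<..<2/3::real} x) = (1/3 :: real)"
    by simp
  finally have "\<forall>\<^sub>F n in sequentially. (LINT x|lborel. \<psi> n x) > 0"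
    by (rule order_tendstoD) simp
  then obtain n where n: "(LINT x|lborel. \<psi> n x) > 0"
    by (auto simp: eventually_sequentially)
  show ?thesis
    by (rule that[of "\<lambda>x. 1 / (LINT x|lborel. \<psi> n x) * \<psi> n x"])
      (use n in \<open>simp_all add: test_scale \<psi>(1) del: times_divide_eq_left, simp\<close>)
qed

lemma L2_inner_test_lborel:
  assumes "\<phi> \<in> test_functions" "g \<in> borel_measurable borel"
  shows "L2_inner g \<phi> = (LINT x|lborel. g x * \<phi> x)"
proof -
  have "L2_inner g \<phi> = (LINT x|lebesgue. indicator unit_ival x *\<^sub>R (g x * \<phi> x))"
    unfolding L2_inner_def by (rule integral_restrict_space) simp
  also have "\<dots> = (LINT x|lebesgue. g x * \<phi> x)"
    using test_outside[OF assms(1)] by (intro Bochner_Integration.integral_cong) (auto simp: indicator_def)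
  also have "\<dots> = (LINT x|lborel. g x * \<phi> x)"
    using assms test_measurable by (intro integral_completion) auto
  finally show ?thesis .
qed

lemma integrable_times_test:
  assumes "integrable unit_measure m" "\<phi> \<in> test_functions"
  shows "integrable unit_measure (\<lambda>x. m x * \<phi> x)"
proof -
  obtain B where B: "B > 0" "\<And>x. \<bar>\<phi> x\<bar> \<le> B" using test_bounded[OF assms(2)] by blast
  have "\<phi> \<in> borel_measurable unit_measure"
    using test_measurable[OF assms(2)] by (intro measurable_restrict_space1 measurable_completion) simp
  moreover have "\<bar>m x * \<phi> x\<bar> \<le> \<bar>B * m x\<bar>" for x
    using mult_left_mono[OF B(2)[of x], of "\<bar>m x\<bar>"] B(1) by (simp add: abs_mult mult.commute)
  ultimately show ?thesis
    using assms(1)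
    by (intro Bochner_Integration.integrable_bound[where f = "\<lambda>x. B * m x" and g = "\<lambda>x. m x * \<phi> x"]) auto
qed

lemma finite_measure_unit: "finite_measure unit_measure"
  by (rule finite_measure_lebesgue_on) simp

lemma integrable_unit_imp_local:
  assumes "integrable unit_measure h" "0 < a" "b < 1"
  shows "h absolutely_integrable_on {a..b}"
proof -
  have "h absolutely_integrable_on unit_ival"
    using assms(1) by (simp add: set_integrable_def integrable_restrict_space)
  then show ?thesis by (rule set_integrable_subset) (use assms in auto)
qed

lemma test_integral_const:
  assumes "\<phi> \<in> test_functions"
  shows "L2_inner (\<lambda>x. c) \<phi> = c * (LINT x|lborel. \<phi> x)"
  by (simp add: L2_inner_test_lborel[OF assms])

text \<open>A function with vanishing weak derivative is constant: subtracting a multiple of a fixed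
  test function of mass one turns any test function into a derivative.\<close>

lemma du_Bois_Reymond:
  assumes m: "integrable unit_measure m"
    and zero: "\<And>\<phi>. \<phi> \<in> test_functions \<Longrightarrow> L2_inner m (deriv \<phi>) = 0"
  obtains c where "AE x in unit_measure. m x = c"
proof -
  interpret finite_measure unit_measure by (rule finite_measure_unit)
  obtain \<psi>0 where \<psi>0: "\<psi>0 \<in> test_functions" "(LINT x|lborel. \<psi>0 x) = 1"
    using exists_normalized_test by blast
  define c where "c = L2_inner m \<psi>0"
  have "AE x in unit_measure. m x - c = 0"
  proof (rule fundamental_lemma)
    fix \<phi> assume \<phi>: "\<phi> \<in> test_functions"
    define I where "I = (LINT x|lborel. \<phi> x)"
    let ?\<eta> = "\<lambda>x. \<phi> x - I * \<psi>0 x"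
    have \<eta>: "?\<eta> \<in> test_functions" by (intro test_diff test_scale \<phi> \<psi>0)
    have "(LINT x|lborel. ?\<eta> x) = 0"
      using test_integrable[OF \<phi>] test_integrable[OF \<psi>0(1)] \<psi>0(2) by (simp add: I_def)
    with test_antiderivative[OF \<eta>] obtain \<Phi> where \<Phi>: "\<Phi> \<in> test_functions" "deriv \<Phi> = ?\<eta>" by blast
    have "0 = L2_inner m ?\<eta>" using zero[OF \<Phi>(1)] \<Phi>(2) by simp
    also have "\<dots> = (LINT x|unit_measure. m x * \<phi> x - I * (m x * \<psi>0 x))"
      unfolding L2_inner_def by (simp add: algebra_simps)
    also have "\<dots> = L2_inner m \<phi> - I * c"
      using integrable_times_test[OF m \<phi>] integrable_times_test[OF m \<psi>0(1)]
      by (simp add: L2_inner_def c_def)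
    also have "I * c = L2_inner (\<lambda>x. c) \<phi>"
      using test_integral_const[OF \<phi>] by (simp add: I_def)
    also have "L2_inner m \<phi> - L2_inner (\<lambda>x. c) \<phi> = L2_inner (\<lambda>x. m x - c) \<phi>"
      using integrable_times_test[OF m \<phi>] integrable_times_test[OF integrable_const[of c] \<phi>]
      by (simp add: L2_inner_def left_diff_distrib)
    finally show "L2_inner (\<lambda>x. m x - c) \<phi> = 0" by simp
  next
    fix a b :: real assume "0 < a" "b < 1"
    then show "(\<lambda>x. m x - c) absolutely_integrable_on {a..b}"
      by (intro integrable_unit_imp_local Bochner_Integration.integrable_diff m integrable_const)
  qed
  then show ?thesis by (intro that[of c]) simp
qed

section \<open>The kernel of the fractional integral\<close>

text \<open>The truncation at \<open>1\<close> makes the kernel integrable and does not affect convolutions evaluated on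
  \<open>[0,1]\<close> with functions that live there. At the singularity the value is \<open>0\<close>.\<close>

definition half_kernel :: "real \<Rightarrow> real \<Rightarrow> real" where
  "half_kernel \<beta> t = indicator {0..1} t * t powr (\<beta> - 1)"

text \<open>Positive arguments carry the left-sided integral and negative ones the right-sided integral, up to
  the common factor \<open>1 / Gamma \<beta>\<close>.\<close>

definition kernel :: "real \<Rightarrow> real \<Rightarrow> real \<Rightarrow> real" where
  "kernel \<beta> \<theta> t = \<theta> * half_kernel \<beta> t + (1 - \<theta>) * half_kernel \<beta> (- t)"

lemma half_kernel_measurable [measurable]: "half_kernel \<beta> \<in> borel_measurable borel"
  unfolding half_kernel_def[abs_def] by measurable

lemma powr_integral_0:
  fixes \<beta> c :: real
  assumes "0 < \<beta>" "0 \<le> c"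
  shows "integrable lborel (\<lambda>t. indicator {0..c} t * t powr (\<beta> - 1))"
    and "(LINT t|lborel. indicator {0..c} t * t powr (\<beta> - 1)) = c powr \<beta> / \<beta>"
  using lborel_nonneg_has_integral[of "\<lambda>t. t powr (\<beta> - 1)" "{0..c}"]
    has_integral_powr_from_0[of "\<beta> - 1" c] assms by simp_all

lemma half_kernel_integrable: "0 < \<beta> \<Longrightarrow> integrable lborel (half_kernel \<beta>)"
  using powr_integral_0(1)[of \<beta> 1] by (simp add: half_kernel_def[abs_def])

lemma half_kernel_nonneg: "0 \<le> half_kernel \<beta> t"
  by (simp add: half_kernel_def)

lemma half_kernel_integral: "0 < \<beta> \<Longrightarrow> (LINT t|lborel. \<bar>half_kernel \<beta> t\<bar>) = 1 / \<beta>"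
  using powr_integral_0(2)[of \<beta> 1] half_kernel_nonneg by (simp add: half_kernel_def)

lemma kernel_integrable: "0 < \<beta> \<Longrightarrow> integrable lborel (kernel \<beta> \<theta>)"
  using half_kernel_integrable[of \<beta>] lborel_integrable_real_affine[of "half_kernel \<beta>" "-1" 0]
  by (simp add: kernel_def[abs_def])

text \<open>Away from the singularity one integration by parts gains a factor \<open>1 / \<bar>\<omega>\<bar>\<close>.\<close>

lemma oscillatory_tail:
  assumes \<beta>: "0 < \<beta>" "\<beta> < 1" and a: "0 < a" "a \<le> 1" and \<omega>: "\<omega> \<noteq> 0"
  shows "cmod (LINT t|lborel. indicator {a..1} t *\<^sub>R (complex_of_real (t powr (\<beta> - 1)) * iexp (- (\<omega> * t))))
    \<le> 2 * a powr (\<beta> - 1) / \<bar>\<omega>\<bar>"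
proof -
  let ?E = "\<lambda>t. iexp (- (\<omega> * t)) * (\<i> / \<omega>)"
  let ?p = "\<lambda>t. t powr (\<beta> - 1)"
  let ?p' = "\<lambda>t. (\<beta> - 1) * t powr (\<beta> - 2)"
  let ?u = "\<lambda>t. complex_of_real (?p t) * iexp (- (\<omega> * t))"
  let ?v = "\<lambda>t. complex_of_real (?p' t) * ?E t"
  let ?G = "\<lambda>t. complex_of_real (?p t) * ?E t"
  have tri: "cmod (x - y - z) \<le> cmod x + cmod y + cmod z" for x y z
    using norm_triangle_ineq4[of "x - y" z] norm_triangle_ineq4[of x y] by linarith
  have nE: "cmod (?E t) = 1 / \<bar>\<omega>\<bar>" for t
    by (simp add: norm_mult norm_divide)
  have Dp: "(?p has_real_derivative ?p' t) (at t)" if "t > 0" for t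
    using has_real_derivative_powr[OF that, of "\<beta> - 1"] by simp
  have DE: "(?E has_vector_derivative iexp (- (\<omega> * t))) (at t)" for t
  proof -
    have "((\<lambda>z. exp (- (\<i> * \<omega>) * z) * (\<i> / \<omega>)) has_field_derivative exp (- (\<i> * \<omega>) * of_real t)) (at (of_real t))"
      using \<omega> by (auto intro!: derivative_eq_intros)
    from has_vector_derivative_real_field[OF this] show ?thesis
      by (simp add: mult.assoc)
  qed
  have contu: "continuous_on {a..1} ?u" and contv: "continuous_on {a..1} ?v"
    and contp': "continuous_on {a..1} ?p'"
    using a \<omega> by (auto intro!: continuous_intros)
  have iu: "integrable lborel (\<lambda>t. indicator {a..1} t *\<^sub>R ?u t)"
    and iv: "integrable lborel (\<lambda>t. indicator {a..1} t *\<^sub>R ?v t)"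
    using borel_integrable_atLeastAtMost'[OF contu] borel_integrable_atLeastAtMost'[OF contv]
    by (simp_all add: set_integrable_def)
  have "(LINT t|lborel. indicator {a..1} t *\<^sub>R (?u t + ?v t)) = ?G 1 - ?G a"
  proof (rule integral_FTC_atLeastAtMost)
    fix t assume t: "a \<le> t" "t \<le> 1"
    have "((\<lambda>x. complex_of_real (?p x)) has_vector_derivative complex_of_real (?p' t)) (at t)"
      using Dp[of t] t a by (intro has_vector_derivative_of_real)
        (simp add: has_real_derivative_iff_has_vector_derivative)
    from has_vector_derivative_mult[OF this DE]
    show "(?G has_vector_derivative ?u t + ?v t) (at t within {a..1})"
      by (rule has_vector_derivative_at_within)
  qed (use a contu contv in \<open>auto intro!: continuous_on_add\<close>)
  also have "(LINT t|lborel. indicator {a..1} t *\<^sub>R (?u t + ?v t)) =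
      (LINT t|lborel. indicator {a..1} t *\<^sub>R ?u t) + (LINT t|lborel. indicator {a..1} t *\<^sub>R ?v t)"
    unfolding scaleR_add_right by (rule Bochner_Integration.integral_add[OF iu iv])
  finally have split: "(LINT t|lborel. indicator {a..1} t *\<^sub>R ?u t) =
      ?G 1 - ?G a - (LINT t|lborel. indicator {a..1} t *\<^sub>R ?v t)"
    by (simp only: eq_diff_eq)
  have G: "cmod (?G t) = t powr (\<beta> - 1) / \<bar>\<omega>\<bar>" for t
  proof -
    have "cmod (?G t) = cmod (complex_of_real (?p t)) * cmod (?E t)" by (rule norm_mult)
    then show ?thesis by (simp only: nE) simp
  qed
  have nv: "cmod (indicator {a..1} t *\<^sub>R ?v t) = (indicator {a..1} t *\<^sub>R (- ?p' t)) * (1 / \<bar>\<omega>\<bar>)" for t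
  proof -
    have "cmod (?v t) = cmod (complex_of_real (?p' t)) * cmod (?E t)" by (rule norm_mult)
    also have "cmod (complex_of_real (?p' t)) = - ?p' t"
      using \<beta> by (simp only: norm_of_real abs_mult) (simp add: algebra_simps)
    finally have "cmod (?v t) = - ?p' t * (1 / \<bar>\<omega>\<bar>)" by (simp only: nE)
    then show ?thesis by (auto simp: indicator_def)
  qed
  have "cmod (LINT t|lborel. indicator {a..1} t *\<^sub>R ?v t) \<le>
      (LINT t|lborel. cmod (indicator {a..1} t *\<^sub>R ?v t))"
    by (rule integral_norm_bound)
  also have "\<dots> = (LINT t|lborel. indicator {a..1} t *\<^sub>R (- ?p' t)) * (1 / \<bar>\<omega>\<bar>)"
    by (simp only: nv integral_mult_left_zero)
  also have "(LINT t|lborel. indicator {a..1} t *\<^sub>R (- ?p' t)) = - ?p 1 - - ?p a"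
  proof (rule integral_FTC_atLeastAtMost)
    fix t assume t: "a \<le> t" "t \<le> 1"
    show "((\<lambda>t. - ?p t) has_vector_derivative - ?p' t) (at t within {a..1})"
      using DERIV_minus[OF Dp[of t]] t a
      by (auto simp: has_real_derivative_iff_has_vector_derivative intro: has_vector_derivative_at_within)
  qed (use a contp' in \<open>auto intro!: continuous_on_minus\<close>)
  finally have J: "cmod (LINT t|lborel. indicator {a..1} t *\<^sub>R ?v t) \<le> (a powr (\<beta> - 1) - 1) / \<bar>\<omega>\<bar>"
    by simp
  have "cmod (LINT t|lborel. indicator {a..1} t *\<^sub>R ?u t) \<le>
      cmod (?G 1) + cmod (?G a) + cmod (LINT t|lborel. indicator {a..1} t *\<^sub>R ?v t)"
    by (simp only: split tri)
  also have "\<dots> \<le> 1 / \<bar>\<omega>\<bar> + a powr (\<beta> - 1) / \<bar>\<omega>\<bar> + (a powr (\<beta> - 1) - 1) / \<bar>\<omega>\<bar>"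
    using J G[of a] G[of 1] by (intro add_mono) (simp_all only: powr_one_eq_one order_refl)
  also have "\<dots> = 2 * a powr (\<beta> - 1) / \<bar>\<omega>\<bar>"
    by (simp add: diff_divide_distrib)
  finally show ?thesis .
qed

lemma fourier_half_kernel:
  assumes \<beta>: "0 < \<beta>" "\<beta> < 1" and \<omega>: "\<omega> \<noteq> 0"
  shows "cmod (fourier (half_kernel \<beta>) \<omega>) \<le> (2 + 1 / \<beta>) * \<bar>\<omega>\<bar> powr (- \<beta>)"
proof (cases "\<bar>\<omega>\<bar> < 1")
  case True
  have "cmod (fourier (half_kernel \<beta>) \<omega>) \<le> 1 / \<beta>"
    using norm_fourier_le[of "half_kernel \<beta>" \<omega>] half_kernel_integral[OF \<beta>(1)] by simp
  also have "\<dots> \<le> (2 + 1 / \<beta>) * 1" by simp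
  also have "\<dots> \<le> (2 + 1 / \<beta>) * \<bar>\<omega>\<bar> powr (- \<beta>)"
  proof (rule mult_left_mono)
    have "\<bar>\<omega>\<bar> powr \<beta> \<le> 1" using True \<beta> by (intro powr_le1) auto
    then show "1 \<le> \<bar>\<omega>\<bar> powr (- \<beta>)" using \<omega> by (simp add: powr_minus field_simps)
  qed (use \<beta> in auto)
  finally show ?thesis .
next
  case False
  \<comment> \<open>The window below one wavelength is estimated by size, the rest by oscillation.\<close>
  define a where "a = 1 / \<bar>\<omega>\<bar>"
  have a: "0 < a" "a \<le> 1" using False \<omega> by (auto simp: a_def)
  let ?f = "\<lambda>t. complex_of_real (half_kernel \<beta> t) * iexp (- (\<omega> * t))"
  let ?u = "\<lambda>t. complex_of_real (indicator {0..<a} t * t powr (\<beta> - 1)) * iexp (- (\<omega> * t))"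
  let ?v = "\<lambda>t. indicator {a..1} t *\<^sub>R (complex_of_real (t powr (\<beta> - 1)) * iexp (- (\<omega> * t)))"
  have hk: "integrable lborel (\<lambda>t. complex_of_real (half_kernel \<beta> t))"
    using half_kernel_integrable[OF \<beta>(1)] by simp
  have iu: "integrable lborel ?u"
    by (rule Bochner_Integration.integrable_bound[OF hk])
      (use a in \<open>auto simp: half_kernel_def norm_mult indicator_def\<close>)
  have iv: "integrable lborel ?v"
    by (rule Bochner_Integration.integrable_bound[OF hk])
      (use a in \<open>auto simp: half_kernel_def norm_mult indicator_def\<close>)
  have "fourier (half_kernel \<beta>) \<omega> = (LINT t|lborel. ?u t + ?v t)"
    unfolding fourier_lborel[OF half_kernel_measurable]
    by (rule Bochner_Integration.integral_cong[OF refl])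
      (use a in \<open>auto simp: half_kernel_def indicator_def\<close>)
  also have "\<dots> = (LINT t|lborel. ?u t) + (LINT t|lborel. ?v t)"
    by (rule Bochner_Integration.integral_add[OF iu iv])
  finally have "cmod (fourier (half_kernel \<beta>) \<omega>) \<le> cmod (LINT t|lborel. ?u t) + cmod (LINT t|lborel. ?v t)"
    by (simp only: norm_triangle_ineq)
  moreover have "cmod (LINT t|lborel. ?u t) \<le> a powr \<beta> / \<beta>"
  proof -
    have "cmod (LINT t|lborel. ?u t) \<le> (LINT t|lborel. cmod (?u t))"
      by (rule integral_norm_bound)
    also have "\<dots> \<le> (LINT t|lborel. indicator {0..a} t * t powr (\<beta> - 1))"
      using integrable_norm[OF iu] powr_integral_0(1)[OF \<beta>(1), of a] a
      by (intro integral_mono) (auto simp: norm_mult indicator_def)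
    also have "\<dots> = a powr \<beta> / \<beta>" using powr_integral_0(2)[OF \<beta>(1), of a] a by simp
    finally show ?thesis .
  qed
  moreover have "cmod (LINT t|lborel. ?v t) \<le> 2 * a powr (\<beta> - 1) / \<bar>\<omega>\<bar>"
    by (rule oscillatory_tail[OF \<beta> a \<omega>])
  moreover have "a powr \<beta> / \<beta> + 2 * a powr (\<beta> - 1) / \<bar>\<omega>\<bar> = (2 + 1 / \<beta>) * \<bar>\<omega>\<bar> powr (- \<beta>)"
  proof -
    have 1: "\<bar>\<omega>\<bar> powr (- \<beta>) = a powr \<beta>"
      by (simp add: a_def powr_divide powr_minus field_simps)
    have "a powr \<beta> = a powr (\<beta> - 1) * a"
      using powr_add[of a "\<beta> - 1" 1] a by simp
    also have "\<dots> = a powr (\<beta> - 1) / \<bar>\<omega>\<bar>"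
      by (simp add: a_def)
    finally have 2: "2 * a powr (\<beta> - 1) / \<bar>\<omega>\<bar> = 2 * a powr \<beta>" by simp
    show ?thesis unfolding 1 2 by (simp add: algebra_simps)
  qed
  ultimately show ?thesis by linarith
qed

lemma fourier_kernel:
  assumes \<beta>: "0 < \<beta>" "\<beta> < 1" and \<theta>: "0 \<le> \<theta>" "\<theta> \<le> 1" and \<omega>: "\<omega> \<noteq> 0"
  shows "cmod (fourier (kernel \<beta> \<theta>) \<omega>) \<le> (2 + 1 / \<beta>) * \<bar>\<omega>\<bar> powr (- \<beta>)"
proof -
  let ?h = "half_kernel \<beta>"
  have m: "kernel \<beta> \<theta> \<in> borel_measurable borel"
    using kernel_integrable[OF \<beta>(1)] by auto
  have ih: "integrable lborel (\<lambda>t. complex_of_real (?h t) * iexp (- (\<omega> * t)))"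
    "integrable lborel (\<lambda>t. complex_of_real (?h (- t)) * iexp (- (\<omega> * t)))"
    using integrable_mult_iexp[OF half_kernel_integrable[OF \<beta>(1)], of "- \<omega>"]
      integrable_mult_iexp[of "\<lambda>t. ?h (- t)" "- \<omega>"]
      lborel_integrable_real_affine[of ?h "-1" 0] half_kernel_integrable[OF \<beta>(1)]
    by simp_all
  have refl: "(LINT t|lborel. complex_of_real (?h (- t)) * iexp (- (\<omega> * t))) = fourier ?h (- \<omega>)"
    unfolding fourier_lborel[OF half_kernel_measurable]
    by (subst lborel_integral_real_affine[where c = "-1" and t = 0]) auto
  have "fourier (kernel \<beta> \<theta>) \<omega> = (LINT t|lborel.
      \<theta> *\<^sub>R (complex_of_real (?h t) * iexp (- (\<omega> * t))) + (1 - \<theta>) *\<^sub>R (complex_of_real (?h (- t)) * iexp (- (\<omega> * t))))"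
    unfolding fourier_lborel[OF m] kernel_def
    by (rule Bochner_Integration.integral_cong) (auto simp: scaleR_conv_of_real algebra_simps)
  also have "\<dots> = \<theta> *\<^sub>R fourier ?h \<omega> + (1 - \<theta>) *\<^sub>R fourier ?h (- \<omega>)"
    using ih by (simp add: refl[simplified] fourier_lborel[OF half_kernel_measurable, symmetric, simplified]
        fourier_lborel[OF half_kernel_measurable, of \<omega>])
  also have "cmod \<dots> \<le> \<theta> * cmod (fourier ?h \<omega>) + (1 - \<theta>) * cmod (fourier ?h (- \<omega>))"
    using \<theta> by (intro norm_triangle_le) simp
  also have "\<dots> \<le> \<theta> * ((2 + 1 / \<beta>) * \<bar>\<omega>\<bar> powr (- \<beta>)) + (1 - \<theta>) * ((2 + 1 / \<beta>) * \<bar>\<omega>\<bar> powr (- \<beta>))"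
    using fourier_half_kernel[OF \<beta> \<omega>] fourier_half_kernel[OF \<beta>, of "- \<omega>"] \<omega> \<theta>
    by (intro add_mono mult_left_mono) auto
  finally show ?thesis by (simp flip: distrib_right)
qed

text \<open>The decay of the transformed kernel trades the full derivative of \<open>\<phi>\<close> for a
  derivative of order \<open>1 - \<beta>\<close>.\<close>

lemma kernel_convolution_energy:
  assumes \<beta>: "0 < \<beta>" "\<beta> < 1" and \<theta>: "0 \<le> \<theta>" "\<theta> \<le> 1" and \<phi>: "\<phi> \<in> test_functions"
  shows "integrable lborel (\<lambda>x. (convolution (kernel \<beta> \<theta>) (deriv \<phi>) x)\<^sup>2)"
    and "2 * pi * (LINT x|lborel. (convolution (kernel \<beta> \<theta>) (deriv \<phi>) x)\<^sup>2) \<le>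
      (2 + 1 / \<beta>)\<^sup>2 * fourier_energy (1 - \<beta>) \<phi>"
proof -
  let ?k = "kernel \<beta> \<theta>" and ?d = "deriv \<phi>"
  let ?g = "convolution ?k ?d"
  note d\<phi> = test_deriv[OF \<phi>]
  note ik = kernel_integrable[OF \<beta>(1), of \<theta>]
  have [measurable]: "?k \<in> borel_measurable borel" using ik by auto
  obtain B where B: "B > 0" "\<And>x. \<bar>?d x\<bar> \<le> B" using test_bounded[OF d\<phi>] by blast
  have ig: "integrable lborel ?g"
    by (rule convolution_integrable[OF ik test_integrable[OF d\<phi>]])
  have [measurable]: "?g \<in> borel_measurable borel" using ig by auto
  have cg: "continuous_on UNIV ?g"
    by (rule convolution_continuous[OF ik smooth_continuous[OF test_smooth[OF d\<phi>]] B(2)])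
  have bg: "\<bar>?g x\<bar> \<le> B * (LINT t|lborel. \<bar>?k t\<bar>)" for x
    by (rule convolution_bound[OF ik test_measurable[OF d\<phi>] B(2)])
  have Fg: "fourier ?g = (\<lambda>\<omega>. fourier ?k \<omega> * fourier ?d \<omega>)"
    by (intro ext fourier_convolution ik test_integrable d\<phi>)
  have iFg: "integrable lborel (fourier ?g)"
  proof (rule Bochner_Integration.integrable_bound)
    show "integrable lborel (\<lambda>\<omega>. complex_of_real (LINT t|lborel. \<bar>?k t\<bar>) * fourier ?d \<omega>)"
      by (intro integrable_mult_right fourier_test_integrable d\<phi>)
    show "AE \<omega> in lborel. cmod (fourier ?g \<omega>) \<le> cmod (complex_of_real (LINT t|lborel. \<bar>?k t\<bar>) * fourier ?d \<omega>)"
      unfolding Fg using norm_fourier_le[of ?k] by (auto simp: norm_mult intro!: mult_right_mono)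
  qed measurable
  show "integrable lborel (\<lambda>x. (?g x)\<^sup>2)"
  proof (rule Bochner_Integration.integrable_bound)
    let ?C = "B * (LINT t|lborel. \<bar>?k t\<bar>)"
    show "integrable lborel (\<lambda>x. ?C * ?g x)" by (rule integrable_mult_right[OF ig])
    show "AE x in lborel. norm ((?g x)\<^sup>2) \<le> norm (?C * ?g x)"
    proof (rule AE_I2)
      fix x
      have "\<bar>?g x\<bar> \<le> \<bar>?C\<bar>" using bg[of x] by linarith
      then show "norm ((?g x)\<^sup>2) \<le> norm (?C * ?g x)"
        unfolding power2_eq_square real_norm_def abs_mult by (rule mult_right_mono) simp
    qed
  qed measurable
  have "2 * pi * (LINT x|lborel. (?g x)\<^sup>2) = (LINT \<omega>|lborel. (cmod (fourier ?g \<omega>))\<^sup>2)"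
    by (rule plancherel(2)[OF ig cg bg iFg])
  also have "\<dots> \<le> (LINT \<omega>|lborel. (2 + 1 / \<beta>)\<^sup>2 * (\<bar>\<omega>\<bar> powr (1 - \<beta>) * cmod (fourier \<phi> \<omega>))\<^sup>2)"
  proof (rule integral_mono)
    show "integrable lborel (\<lambda>\<omega>. (cmod (fourier ?g \<omega>))\<^sup>2)"
      by (rule plancherel(1)[OF ig cg bg iFg])
    show "integrable lborel (\<lambda>\<omega>. (2 + 1 / \<beta>)\<^sup>2 * (\<bar>\<omega>\<bar> powr (1 - \<beta>) * cmod (fourier \<phi> \<omega>))\<^sup>2)"
      using \<beta> by (intro integrable_mult_right test_weighted_fourier_integrable \<phi>) auto
    fix \<omega> :: real
    have "cmod (fourier ?g \<omega>) \<le> (2 + 1 / \<beta>) * (\<bar>\<omega>\<bar> powr (1 - \<beta>) * cmod (fourier \<phi> \<omega>))"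
    proof (cases "\<omega> = 0")
      case True
      then show ?thesis by (simp add: Fg fourier_deriv[OF \<phi>])
    next
      case False
      have "cmod (fourier ?g \<omega>) = cmod (fourier ?k \<omega>) * (\<bar>\<omega>\<bar> * cmod (fourier \<phi> \<omega>))"
        by (simp add: Fg fourier_deriv[OF \<phi>] norm_mult)
      also have "\<dots> \<le> ((2 + 1 / \<beta>) * \<bar>\<omega>\<bar> powr (- \<beta>)) * (\<bar>\<omega>\<bar> * cmod (fourier \<phi> \<omega>))"
        using fourier_kernel[OF \<beta> \<theta> False] by (intro mult_right_mono) auto
      also have "\<dots> = (2 + 1 / \<beta>) * ((\<bar>\<omega>\<bar> powr (- \<beta>) * \<bar>\<omega>\<bar> powr 1) * cmod (fourier \<phi> \<omega>))"
        using False by simp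
      also have "\<bar>\<omega>\<bar> powr (- \<beta>) * \<bar>\<omega>\<bar> powr 1 = \<bar>\<omega>\<bar> powr (1 - \<beta>)"
        by (subst powr_add[symmetric]) simp
      finally show ?thesis .
    qed
    then show "(cmod (fourier ?g \<omega>))\<^sup>2 \<le> (2 + 1 / \<beta>)\<^sup>2 * (\<bar>\<omega>\<bar> powr (1 - \<beta>) * cmod (fourier \<phi> \<omega>))\<^sup>2"
      unfolding power_mult_distrib[symmetric] by (rule power_mono) simp
  qed
  finally show "2 * pi * (LINT x|lborel. (?g x)\<^sup>2) \<le>
      (2 + 1 / \<beta>)\<^sup>2 * fourier_energy (1 - \<beta>) \<phi>"
    by simp
qed

section \<open>Square integrable functions on the unit interval\<close>

abbreviation L2_sq :: "(real \<Rightarrow> real) \<Rightarrow> real" where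
  "L2_sq w \<equiv> LINT x|unit_measure. (w x)\<^sup>2"

lemma L2_unitI:
  "w \<in> borel_measurable unit_measure \<Longrightarrow> integrable unit_measure (\<lambda>x. (w x)\<^sup>2) \<Longrightarrow> w \<in> L2_unit"
  by (simp add: L2_unit_def)

lemma L2_unit_measurable: "w \<in> L2_unit \<Longrightarrow> w \<in> borel_measurable unit_measure"
  and L2_unit_integrable_square: "w \<in> L2_unit \<Longrightarrow> integrable unit_measure (\<lambda>x. (w x)\<^sup>2)"
  by (simp_all add: L2_unit_def)

lemma L2_unit_integrable_mult:
  assumes "v \<in> L2_unit" "w \<in> L2_unit"
  shows "integrable unit_measure (\<lambda>x. v x * w x)"
proof (rule Bochner_Integration.integrable_bound)
  show "integrable unit_measure (\<lambda>x. (v x)\<^sup>2 + (w x)\<^sup>2)"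
    using assms by (intro Bochner_Integration.integrable_add L2_unit_integrable_square)
  show "(\<lambda>x. v x * w x) \<in> borel_measurable unit_measure"
    using assms by (intro borel_measurable_times L2_unit_measurable)
  show "AE x in unit_measure. norm (v x * w x) \<le> norm ((v x)\<^sup>2 + (w x)\<^sup>2)"
  proof (rule AE_I2)
    fix x
    have "2 * (\<bar>v x\<bar> * \<bar>w x\<bar>) \<le> (v x)\<^sup>2 + (w x)\<^sup>2"
      using sum_squares_bound[of "\<bar>v x\<bar>" "\<bar>w x\<bar>"] by (simp add: mult.assoc)
    moreover have "0 \<le> \<bar>v x\<bar> * \<bar>w x\<bar>" by simp
    ultimately have "\<bar>v x\<bar> * \<bar>w x\<bar> \<le> (v x)\<^sup>2 + (w x)\<^sup>2" by linarith
    then show "norm (v x * w x) \<le> norm ((v x)\<^sup>2 + (w x)\<^sup>2)"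
      by (simp add: abs_mult)
  qed
qed

lemma L2_unit_add:
  assumes "v \<in> L2_unit" "w \<in> L2_unit"
  shows "(\<lambda>x. v x + w x) \<in> L2_unit"
proof (rule L2_unitI)
  show "(\<lambda>x. v x + w x) \<in> borel_measurable unit_measure"
    using assms by (intro borel_measurable_add L2_unit_measurable)
  have "integrable unit_measure (\<lambda>x. (v x)\<^sup>2 + (w x)\<^sup>2 + 2 * (v x * w x))"
    using assms by (intro Bochner_Integration.integrable_add integrable_mult_right
        L2_unit_integrable_square L2_unit_integrable_mult)
  then show "integrable unit_measure (\<lambda>x. (v x + w x)\<^sup>2)"
    by (simp add: power2_sum mult.assoc)
qed

lemma L2_unit_mult_bounded:
  assumes "w \<in> L2_unit" "k \<in> borel_measurable unit_measure" "\<And>x. x \<in> unit_ival \<Longrightarrow> \<bar>k x\<bar> \<le> B"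
  shows "(\<lambda>x. k x * w x) \<in> L2_unit"
proof (rule L2_unitI)
  show m: "(\<lambda>x. k x * w x) \<in> borel_measurable unit_measure"
    by (rule borel_measurable_times[OF assms(2) L2_unit_measurable[OF assms(1)]])
  show "integrable unit_measure (\<lambda>x. (k x * w x)\<^sup>2)"
  proof (rule Bochner_Integration.integrable_bound)
    show "integrable unit_measure (\<lambda>x. B\<^sup>2 * (w x)\<^sup>2)"
      using assms by (intro integrable_mult_right L2_unit_integrable_square)
    show "(\<lambda>x. (k x * w x)\<^sup>2) \<in> borel_measurable unit_measure"
      using m by simp
    show "AE x in unit_measure. norm ((k x * w x)\<^sup>2) \<le> norm (B\<^sup>2 * (w x)\<^sup>2)"
    proof (rule AE_I2)
      fix x assume "x \<in> space unit_measure"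
      then have "\<bar>k x\<bar> \<le> \<bar>B\<bar>" using assms(3)[of x] by auto
      then have "(k x)\<^sup>2 \<le> B\<^sup>2" by (simp add: abs_le_square_iff)
      then show "norm ((k x * w x)\<^sup>2) \<le> norm (B\<^sup>2 * (w x)\<^sup>2)"
        by (simp add: power_mult_distrib mult_right_mono)
    qed
  qed
qed

lemma L2_unit_scale: "w \<in> L2_unit \<Longrightarrow> (\<lambda>x. c * w x) \<in> L2_unit"
  by (rule L2_unit_mult_bounded[where B = "\<bar>c\<bar>"]) auto

lemma L2_unit_diff:
  assumes "v \<in> L2_unit" "w \<in> L2_unit"
  shows "(\<lambda>x. v x - w x) \<in> L2_unit"
  using L2_unit_add[OF assms(1) L2_unit_scale[OF assms(2), of "-1"]] by simp

lemma L2_unit_bounded: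
  assumes "w \<in> borel_measurable unit_measure" "\<And>x. x \<in> unit_ival \<Longrightarrow> \<bar>w x\<bar> \<le> B"
  shows "w \<in> L2_unit"
proof -
  interpret finite_measure unit_measure by (rule finite_measure_unit)
  have "(\<lambda>x. 1) \<in> L2_unit" by (rule L2_unitI) auto
  from L2_unit_mult_bounded[OF this assms] show ?thesis by simp
qed

lemma L2_unit_one: "(\<lambda>x. 1) \<in> L2_unit"
  by (rule L2_unit_bounded[where B = 1]) auto

lemma L2_unit_integrable: "w \<in> L2_unit \<Longrightarrow> integrable unit_measure w"
  using L2_unit_integrable_mult[OF L2_unit_one] by simp

text \<open>Lebesgue measure is complete.\<close>

lemma unit_measurable_AE:
  fixes v w :: "real \<Rightarrow> real"
  assumes v: "v \<in> borel_measurable unit_measure" and eq: "AE x in unit_measure. v x = w x"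
  shows "w \<in> borel_measurable unit_measure"
proof -
  have "(\<lambda>x. indicator unit_ival x *\<^sub>R v x) \<in> borel_measurable lebesgue"
    using v by (subst (asm) borel_measurable_restrict_space_iff) auto
  moreover have "AE x in lebesgue. indicator unit_ival x *\<^sub>R v x = indicator unit_ival x *\<^sub>R w x"
  proof -
    have "AE x in lebesgue. x \<in> unit_ival \<longrightarrow> v x = w x"
      using eq by (simp add: AE_restrict_space_iff)
    then show ?thesis by eventually_elim (auto simp: indicator_def)
  qed
  ultimately have "(\<lambda>x. indicator unit_ival x *\<^sub>R w x) \<in> borel_measurable lebesgue"
    by (rule borel_measurable_AE)
  then show ?thesis by (subst borel_measurable_restrict_space_iff) auto
qed

lemma L2_unit_cong_AE:
  assumes v: "v \<in> L2_unit" and eq: "AE x in unit_measure. v x = w x"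
  shows "w \<in> L2_unit"
proof (rule L2_unitI)
  show m: "w \<in> borel_measurable unit_measure"
    using unit_measurable_AE[OF L2_unit_measurable[OF v] eq] .
  show "integrable unit_measure (\<lambda>x. (w x)\<^sup>2)"
  proof (rule integrable_cong_AE_imp[OF L2_unit_integrable_square[OF v]])
    show "AE x in unit_measure. (v x)\<^sup>2 = (w x)\<^sup>2"
      using eq by eventually_elim simp
  qed (use m in simp)
qed

lemma test_L2_unit: "\<phi> \<in> test_functions \<Longrightarrow> \<phi> \<in> L2_unit"
proof -
  assume \<phi>: "\<phi> \<in> test_functions"
  obtain B where "\<And>x. \<bar>\<phi> x\<bar> \<le> B" using test_bounded[OF \<phi>] by blast
  moreover have "\<phi> \<in> borel_measurable unit_measure"
    using test_measurable[OF \<phi>] by (intro measurable_restrict_space1 measurable_completion) simp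
  ultimately show ?thesis by (intro L2_unit_bounded)
qed

lemma L2_unit_Cauchy_Schwarz:
  assumes v: "v \<in> L2_unit" and w: "w \<in> L2_unit"
  shows "(L2_inner v w)\<^sup>2 \<le> L2_sq v * L2_sq w"
proof -
  \<comment> \<open>The quadratic polynomial \<open>s \<mapsto> \<integral>(v - s w)\<^sup>2\<close> is nonnegative; its minimum gives the inequality.\<close>
  define A X B where "A = L2_sq v" and "X = L2_inner v w"
    and "B = L2_sq w"
  have AB: "0 \<le> A" "0 \<le> B" by (simp_all add: A_def B_def)
  have quad: "0 \<le> A - 2 * s * X + s\<^sup>2 * B" for s
  proof -
    have "0 \<le> L2_sq (\<lambda>x. v x - s * w x)" by simp
    also have "L2_sq (\<lambda>x. v x - s * w x) =
        (LINT x|unit_measure. (v x)\<^sup>2 - 2 * s * (v x * w x) + s\<^sup>2 * (w x)\<^sup>2)"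
      by (simp add: power2_diff power_mult_distrib algebra_simps)
    also have "\<dots> = A - 2 * s * X + s\<^sup>2 * B"
      using L2_unit_integrable_square[OF v] L2_unit_integrable_square[OF w] L2_unit_integrable_mult[OF v w]
      by (simp add: A_def X_def B_def L2_inner_def)
    finally show ?thesis .
  qed
  have "X\<^sup>2 \<le> A * B"
  proof (cases "B = 0")
    case True
    have "X = 0"
    proof (rule ccontr)
      assume "X \<noteq> 0"
      then show False using quad[of "(A + 1) / (2 * X)"] True by simp
    qed
    with AB show ?thesis by simp
  next
    case False
    then have "B > 0" using AB by simp
    have "0 \<le> B * (A - 2 * (X / B) * X + (X / B)\<^sup>2 * B)"
      using quad[of "X / B"] AB by (intro mult_nonneg_nonneg)
    also have "\<dots> = A * B - X\<^sup>2"
      using \<open>B > 0\<close> by (simp add: field_simps power2_eq_square)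
    finally show ?thesis by simp
  qed
  then show ?thesis by (simp add: A_def X_def B_def)
qed

lemma L2_inner_diff_left:
  assumes "v \<in> L2_unit" "v' \<in> L2_unit" "w \<in> L2_unit"
  shows "L2_inner (\<lambda>x. v x - v' x) w = L2_inner v w - L2_inner v' w"
  using L2_unit_integrable_mult[OF assms(1,3)] L2_unit_integrable_mult[OF assms(2,3)]
  by (simp add: L2_inner_def left_diff_distrib)

lemma L2_inner_tendsto:
  assumes v: "\<And>n. v n \<in> L2_unit" and v': "v' \<in> L2_unit" and w: "w \<in> L2_unit"
    and lim: "(\<lambda>n. L2_sq (\<lambda>x. v n x - v' x)) \<longlonglongrightarrow> 0"
  shows "(\<lambda>n. L2_inner (v n) w) \<longlonglongrightarrow> L2_inner v' w"
proof -
  have "(\<lambda>n. (L2_inner (v n) w - L2_inner v' w)\<^sup>2) \<longlonglongrightarrow> 0"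
  proof (rule tendsto_sandwich[OF _ _ tendsto_const])
    show "\<forall>\<^sub>F n in sequentially. (L2_inner (v n) w - L2_inner v' w)\<^sup>2 \<le>
        L2_sq (\<lambda>x. v n x - v' x) * L2_sq w"
      using L2_unit_Cauchy_Schwarz[OF L2_unit_diff[OF v v'] w]
      by (simp add: L2_inner_diff_left[OF v v' w])
    show "(\<lambda>n. L2_sq (\<lambda>x. v n x - v' x) * L2_sq w) \<longlonglongrightarrow> 0"
      using tendsto_mult[OF lim tendsto_const] by simp
  qed auto
  then have "(\<lambda>n. L2_inner (v n) w - L2_inner v' w) \<longlonglongrightarrow> 0"
    using tendsto_real_sqrt[of "\<lambda>n. (L2_inner (v n) w - L2_inner v' w)\<^sup>2" 0]
    by (simp add: tendsto_rabs_zero_iff)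
  then show ?thesis by (simp add: LIM_zero_iff)
qed

lemma L1_le_L2:
  assumes "w \<in> L2_unit"
  shows "(LINT x|unit_measure. \<bar>w x\<bar>)\<^sup>2 \<le> L2_sq w"
proof -
  have "(\<lambda>x. \<bar>w x\<bar>) \<in> L2_unit"
    using L2_unit_measurable[OF assms] L2_unit_integrable_square[OF assms] by (intro L2_unitI) simp_all
  from L2_unit_Cauchy_Schwarz[OF this L2_unit_one] show ?thesis
    by (simp add: L2_inner_def measure_restrict_space)
qed

text \<open>Riesz--Fischer: a subsequence with increments summable in \<open>L\<^sup>1\<close> converges almost
  everywhere, and Fatou's lemma turns the pointwise limit into the \<open>L\<^sup>2\<close> limit.\<close>

lemma L2_unit_complete:
  assumes g: "\<And>n. g n \<in> L2_unit"
    and Cauchy: "\<And>e. e > 0 \<Longrightarrow> \<exists>N. \<forall>m\<ge>N. \<forall>n\<ge>N. L2_sq (\<lambda>x. g m x - g n x) < e"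
  obtains h where "h \<in> L2_unit" "(\<lambda>n. L2_sq (\<lambda>x. g n x - h x)) \<longlonglongrightarrow> 0"
proof -
  let ?M = unit_measure
  have [measurable]: "g n \<in> borel_measurable ?M" for n by (rule L2_unit_measurable[OF g])
  \<comment> \<open>Squared \<open>L\<^sup>2\<close> distances below \<open>4 ^ - k\<close> bound the \<open>L\<^sup>1\<close> norms of the increments by \<open>2 ^ - k\<close>.\<close>
  have "\<exists>N. \<forall>m\<ge>N. \<forall>n\<ge>N. L2_sq (\<lambda>x. g m x - g n x) < (1 / 4) ^ k" for k :: nat
    by (rule Cauchy) simp
  then obtain N where N: "\<And>k m n. m \<ge> N k \<Longrightarrow> n \<ge> N k \<Longrightarrow> L2_sq (\<lambda>x. g m x - g n x) < (1 / 4) ^ k"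
    by metis
  define r where "r k = (\<Sum>i\<le>k. N i) + k" for k
  have rN: "r k \<ge> N k" for k unfolding r_def by (intro trans_le_add1 member_le_sum) auto
  have r_mono: "r k \<le> r (Suc k)" for k by (simp add: r_def)
  have r_ge: "r k \<ge> k" for k by (simp add: r_def)
  let ?D = "\<lambda>k x. \<bar>g (r (Suc k)) x - g (r k) x\<bar>"
  have int_D: "(\<integral>\<^sup>+x. ennreal (?D k x) \<partial>?M) \<le> ennreal ((1 / 2) ^ k)" for k
  proof -
    have L2: "(\<lambda>x. g (r (Suc k)) x - g (r k) x) \<in> L2_unit" by (intro L2_unit_diff g)
    have "(LINT x|?M. ?D k x)\<^sup>2 \<le> L2_sq (\<lambda>x. g (r (Suc k)) x - g (r k) x)"
      by (rule L1_le_L2[OF L2])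
    also have "\<dots> \<le> (1 / 4) ^ k"
      using N[of k "r (Suc k)" "r k"] rN[of k] r_mono[of k] by simp
    also have "\<dots> = ((1 / 2) ^ k)\<^sup>2"
      by (simp add: power2_eq_square flip: power_mult_distrib)
    finally have "(LINT x|?M. ?D k x) \<le> (1 / 2) ^ k"
      by (rule power2_le_imp_le) simp
    moreover have "(\<integral>\<^sup>+x. ennreal (?D k x) \<partial>?M) = ennreal (LINT x|?M. ?D k x)"
      using L2_unit_integrable[OF L2] by (intro nn_integral_eq_integral) auto
    ultimately show ?thesis by (simp add: ennreal_leI)
  qed
  have "(\<integral>\<^sup>+x. (\<Sum>k. ennreal (?D k x)) \<partial>?M) = (\<Sum>k. \<integral>\<^sup>+x. ennreal (?D k x) \<partial>?M)"
    by (rule nn_integral_suminf) measurable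
  also have "\<dots> \<le> (\<Sum>k. ennreal ((1 / 2) ^ k))"
    by (intro suminf_le int_D) auto
  also have "\<dots> = ennreal (\<Sum>k. (1 / 2) ^ k)"
    by (intro suminf_ennreal2 summable_geometric) auto
  also have "\<dots> < \<infinity>" by simp
  finally have "(\<integral>\<^sup>+x. (\<Sum>k. ennreal (?D k x)) \<partial>?M) \<noteq> \<infinity>" by simp
  then have "AE x in ?M. (\<Sum>k. ennreal (?D k x)) \<noteq> \<infinity>"
    by (intro nn_integral_PInf_AE) auto
  then have conv: "AE x in ?M. convergent (\<lambda>k. g (r k) x)"
  proof eventually_elim
    case (elim x)
    have "summable (\<lambda>k. ?D k x)"
      using elim by (intro summable_suminf_not_top) (auto simp: infinity_ennreal_def)
    then have "summable (\<lambda>k. g (r (Suc k)) x - g (r k) x)"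
      by (rule summable_rabs_cancel)
    then have "convergent (\<lambda>n. \<Sum>k<n. g (r (Suc k)) x - g (r k) x)"
      by (simp add: summable_iff_convergent)
    then have "convergent (\<lambda>n. g (r n) x - g (r 0) x)"
      using sum_lessThan_telescope[of "\<lambda>k. g (r k) x"] by simp
    then have "convergent (\<lambda>n. (g (r n) x - g (r 0) x) + g (r 0) x)"
      by (intro convergent_add convergent_const)
    then show ?case by simp
  qed
  define h where "h x = lim (\<lambda>k. g (r k) x)" for x
  have [measurable]: "h \<in> borel_measurable ?M"
    unfolding h_def[abs_def] by measurable
  have lim: "AE x in ?M. (\<lambda>k. g (r k) x) \<longlonglongrightarrow> h x"
    using conv by eventually_elim (simp add: h_def convergent_LIMSEQ_iff)
  have fatou: "(\<integral>\<^sup>+x. ennreal ((g n x - h x)\<^sup>2) \<partial>?M) \<le> ennreal e"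
    if e: "e > 0" and M: "\<And>m n. m \<ge> M \<Longrightarrow> n \<ge> M \<Longrightarrow> L2_sq (\<lambda>x. g m x - g n x) < e" and n: "n \<ge> M" for n M e
  proof -
    have "(\<integral>\<^sup>+x. ennreal ((g n x - h x)\<^sup>2) \<partial>?M) = (\<integral>\<^sup>+x. liminf (\<lambda>k. ennreal ((g n x - g (r k) x)\<^sup>2)) \<partial>?M)"
    proof (rule nn_integral_cong_AE)
      show "AE x in ?M. ennreal ((g n x - h x)\<^sup>2) = liminf (\<lambda>k. ennreal ((g n x - g (r k) x)\<^sup>2))"
        using lim
      proof eventually_elim
        case (elim x)
        have "(\<lambda>k. ennreal ((g n x - g (r k) x)\<^sup>2)) \<longlonglongrightarrow> ennreal ((g n x - h x)\<^sup>2)"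
          by (intro tendsto_ennrealI tendsto_intros elim)
        then show ?case by (rule lim_imp_Liminf[OF sequentially_bot, symmetric])
      qed
    qed
    also have "\<dots> \<le> liminf (\<lambda>k. \<integral>\<^sup>+x. ennreal ((g n x - g (r k) x)\<^sup>2) \<partial>?M)"
      by (rule nn_integral_liminf) measurable
    also have "\<dots> \<le> ennreal e"
    proof -
      have "\<forall>\<^sub>F k in sequentially. (\<integral>\<^sup>+x. ennreal ((g n x - g (r k) x)\<^sup>2) \<partial>?M) \<le> ennreal e"
        using eventually_ge_at_top[of M]
      proof eventually_elim
        case (elim k)
        have "(\<integral>\<^sup>+x. ennreal ((g n x - g (r k) x)\<^sup>2) \<partial>?M) = ennreal (L2_sq (\<lambda>x. g n x - g (r k) x))"
          by (intro nn_integral_eq_integral L2_unit_integrable_square L2_unit_diff g) auto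
        also have "\<dots> \<le> ennreal e"
          using M[OF n, of "r k"] r_ge[of k] elim by (intro ennreal_leI) auto
        finally show ?case .
      qed
      then have "liminf (\<lambda>k. \<integral>\<^sup>+x. ennreal ((g n x - g (r k) x)\<^sup>2) \<partial>?M) \<le> liminf (\<lambda>k. ennreal e)"
        by (rule Liminf_mono)
      then show ?thesis by (simp add: Liminf_const)
    qed
    finally show ?thesis .
  qed
  have L2: "(\<lambda>x. g n x - h x) \<in> L2_unit" and small: "L2_sq (\<lambda>x. g n x - h x) \<le> e"
    if e: "e > 0" and M: "\<And>m n. m \<ge> M \<Longrightarrow> n \<ge> M \<Longrightarrow> L2_sq (\<lambda>x. g m x - g n x) < e" and n: "n \<ge> M" for n M e
  proof -
    note f = fatou[OF e M n]
    have int: "integrable ?M (\<lambda>x. (g n x - h x)\<^sup>2)"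
      using f by (intro integrableI_bounded) (auto simp: le_less_trans)
    then show "(\<lambda>x. g n x - h x) \<in> L2_unit" by (intro L2_unitI) auto
    have "ennreal (L2_sq (\<lambda>x. g n x - h x)) = (\<integral>\<^sup>+x. ennreal ((g n x - h x)\<^sup>2) \<partial>?M)"
      using int by (intro nn_integral_eq_integral[symmetric]) auto
    with f have "ennreal (L2_sq (\<lambda>x. g n x - h x)) \<le> ennreal e" by simp
    then show "L2_sq (\<lambda>x. g n x - h x) \<le> e" using e by (subst (asm) ennreal_le_iff) auto
  qed
  obtain M1 where M1: "\<And>m n. m \<ge> M1 \<Longrightarrow> n \<ge> M1 \<Longrightarrow> L2_sq (\<lambda>x. g m x - g n x) < 1"
    using Cauchy[of 1] by auto
  have "(\<lambda>x. g M1 x - (g M1 x - h x)) \<in> L2_unit"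
    by (rule L2_unit_diff[OF g L2[OF _ M1]]) auto
  then have "h \<in> L2_unit" by simp
  moreover have "(\<lambda>n. L2_sq (\<lambda>x. g n x - h x)) \<longlonglongrightarrow> 0"
  proof (rule LIMSEQ_I)
    fix e :: real assume "e > 0"
    then obtain M where M: "\<And>m n. m \<ge> M \<Longrightarrow> n \<ge> M \<Longrightarrow> L2_sq (\<lambda>x. g m x - g n x) < e / 2"
      using Cauchy[of "e / 2"] by auto
    have "norm (L2_sq (\<lambda>x. g n x - h x) - 0) < e" if "n \<ge> M" for n
      using small[OF _ M that] \<open>e > 0\<close> by simp
    then show "\<exists>no. \<forall>n\<ge>no. norm (L2_sq (\<lambda>x. g n x - h x) - 0) < e" by blast
  qed
  ultimately show ?thesis by (rule that)
qed

section \<open>Weak derivatives\<close>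

lemma has_weak_derivI:
  assumes "w \<in> L2_unit" "g \<in> L2_unit"
    and "\<And>\<phi>. \<phi> \<in> test_functions \<Longrightarrow> L2_inner w (deriv \<phi>) = - L2_inner g \<phi>"
  shows "has_weak_deriv w g"
  unfolding has_weak_deriv_def
  using assms by (auto intro: integrable_unit_imp_local L2_unit_integrable)

lemma has_weak_deriv_cong_AE:
  assumes "has_weak_deriv w g" "w' \<in> L2_unit" "AE x in unit_measure. w x = w' x"
  shows "has_weak_deriv w' g"
proof -
  have "L2_inner w' \<psi> = L2_inner w \<psi>" if "\<psi> \<in> test_functions" for \<psi>
    unfolding L2_inner_def
  proof (rule integral_cong_AE)
    have "w \<in> borel_measurable unit_measure"
      using unit_measurable_AE[OF L2_unit_measurable[OF assms(2)]] assms(3) by (simp add: eq_commute)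
    then show "(\<lambda>x. w x * \<psi> x) \<in> borel_measurable unit_measure" "(\<lambda>x. w' x * \<psi> x) \<in> borel_measurable unit_measure"
      using L2_unit_measurable[OF assms(2)] L2_unit_measurable[OF test_L2_unit[OF that]]
      by (simp_all add: borel_measurable_times)
    show "AE x in unit_measure. w' x * \<psi> x = w x * \<psi> x"
      using assms(3) by eventually_elim simp
  qed
  then show ?thesis
    using assms(1) test_deriv unfolding has_weak_deriv_def
    by (auto intro: integrable_unit_imp_local L2_unit_integrable assms(2))
qed

text \<open>Local integrability suffices, since test functions vanish near the endpoints.\<close>

lemma local_integrable_times_test:
  assumes g: "\<And>a b. 0 < a \<Longrightarrow> b < 1 \<Longrightarrow> g absolutely_integrable_on {a..b::real}" and \<phi>: "\<phi> \<in> test_functions"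
  shows "integrable unit_measure (\<lambda>x. g x * \<phi> x)"
proof -
  obtain a b where ab: "0 < a" "a < b" "b < 1" "\<And>x. x \<notin> {a..b} \<Longrightarrow> \<phi> x = 0"
    using test_support[OF \<phi>] by blast
  have "integrable unit_measure (\<lambda>x. indicator {a..b} x * g x)"
  proof -
    have "(\<lambda>x. indicator unit_ival x *\<^sub>R (indicator {a..b} x * g x)) = (\<lambda>x. indicator {a..b} x *\<^sub>R g x)"
      using ab by (auto simp: indicator_def)
    then show ?thesis
      using g[of a b] ab by (simp add: integrable_restrict_space set_integrable_def)
  qed
  from integrable_times_test[OF this \<phi>]
  have "integrable unit_measure (\<lambda>x. indicator {a..b} x * g x * \<phi> x)" .
  moreover have "(\<lambda>x. indicator {a..b} x * g x * \<phi> x) = (\<lambda>x. g x * \<phi> x)"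
    using ab(4) by (auto simp: indicator_def fun_eq_iff)
  ultimately show ?thesis by simp
qed

lemma has_weak_deriv_unique:
  assumes "has_weak_deriv w g" "has_weak_deriv w h"
  shows "AE x in unit_measure. g x = h x"
proof -
  have g: "g absolutely_integrable_on {a..b}" and h: "h absolutely_integrable_on {a..b}"
    if "0 < a" "b < 1" for a b
    using assms that by (auto simp: has_weak_deriv_def)
  have "AE x in unit_measure. g x - h x = 0"
  proof (rule fundamental_lemma)
    show "(\<lambda>x. g x - h x) absolutely_integrable_on {a..b}" if "0 < a" "b < 1" for a b
      using g[OF that] h[OF that] by (rule set_integral_diff(1))
    fix \<phi> assume \<phi>: "\<phi> \<in> test_functions"
    have "L2_inner (\<lambda>x. g x - h x) \<phi> = L2_inner g \<phi> - L2_inner h \<phi>"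
      unfolding L2_inner_def left_diff_distrib
      by (intro Bochner_Integration.integral_diff local_integrable_times_test g h \<phi>)
    also have "\<dots> = 0"
      using assms \<phi> unfolding has_weak_deriv_def by force
    finally show "L2_inner (\<lambda>x. g x - h x) \<phi> = 0" .
  qed
  then show ?thesis by eventually_elim simp
qed

lemma weak_deriv_AE_eq:
  assumes "has_weak_deriv w g"
  shows "AE x in unit_measure. weak_deriv w x = g x"
proof -
  have "has_weak_deriv w (weak_deriv w)"
    unfolding weak_deriv_def using assms by (rule someI[where P = "has_weak_deriv w"])
  then show ?thesis using assms by (rule has_weak_deriv_unique)
qed

lemma H1_unit_weak_deriv:
  assumes "w \<in> H1_unit"
  shows "w \<in> L2_unit" "weak_deriv w \<in> L2_unit" "has_weak_deriv w (weak_deriv w)"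
proof -
  obtain g where g: "w \<in> L2_unit" "g \<in> L2_unit" "has_weak_deriv w g"
    using assms unfolding H1_unit_def by blast
  show "w \<in> L2_unit" by fact
  show "has_weak_deriv w (weak_deriv w)"
    unfolding weak_deriv_def using g(3) by (rule someI[where P = "has_weak_deriv w"])
  show "weak_deriv w \<in> L2_unit"
    using weak_deriv_AE_eq[OF g(3)] by (intro L2_unit_cong_AE[OF g(2)]) (simp add: eq_commute)
qed

lemma H1_unit_cong_AE:
  assumes "w \<in> H1_unit" "AE x in unit_measure. w x = w' x"
  shows "w' \<in> H1_unit"
proof -
  note w = H1_unit_weak_deriv[OF assms(1)]
  have "w' \<in> L2_unit" by (rule L2_unit_cong_AE[OF w(1) assms(2)])
  with has_weak_deriv_cong_AE[OF w(3) this assms(2)] w(2) show ?thesis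
    by (auto simp: H1_unit_def)
qed

text \<open>Weak differentiation is a closed operator on \<open>L\<^sup>2\<close>.\<close>

lemma weak_deriv_closed:
  assumes "\<And>n. w n \<in> L2_unit" "\<And>n. g n \<in> L2_unit" "w' \<in> L2_unit"
    and ibp: "\<And>n \<phi>. \<phi> \<in> test_functions \<Longrightarrow> L2_inner (w n) (deriv \<phi>) = - L2_inner (g n) \<phi>"
    and lim: "(\<lambda>n. L2_sq (\<lambda>x. w n x - w' x)) \<longlonglongrightarrow> 0"
    and Cauchy: "\<And>e. e > 0 \<Longrightarrow> \<exists>N. \<forall>m\<ge>N. \<forall>n\<ge>N. L2_sq (\<lambda>x. g m x - g n x) < e"
  shows "w' \<in> H1_unit"
proof -
  obtain h where h: "h \<in> L2_unit" "(\<lambda>n. L2_sq (\<lambda>x. g n x - h x)) \<longlonglongrightarrow> 0"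
    using L2_unit_complete[of g, OF assms(2) Cauchy] by blast
  have "has_weak_deriv w' h"
  proof (rule has_weak_derivI[OF assms(3) h(1)])
    fix \<phi> assume \<phi>: "\<phi> \<in> test_functions"
    have "(\<lambda>n. L2_inner (w n) (deriv \<phi>)) \<longlonglongrightarrow> L2_inner w' (deriv \<phi>)"
      by (intro L2_inner_tendsto assms lim test_L2_unit test_deriv \<phi>)
    moreover have "(\<lambda>n. - L2_inner (g n) \<phi>) \<longlonglongrightarrow> - L2_inner h \<phi>"
      by (intro tendsto_minus L2_inner_tendsto assms h test_L2_unit \<phi>)
    ultimately show "L2_inner w' (deriv \<phi>) = - L2_inner h \<phi>"
      unfolding ibp[OF \<phi>] by (rule LIMSEQ_unique)
  qed
  then show ?thesis using assms(3) h(1) by (auto simp: H1_unit_def)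
qed

section \<open>Approximation by test functions\<close>

lemma zero_ext_indicator: "zero_ext w = (\<lambda>x. indicator unit_ival x *\<^sub>R w x)"
  by (auto simp: zero_ext_def indicator_def)

lemma zero_ext_test: "\<phi> \<in> test_functions \<Longrightarrow> zero_ext \<phi> = \<phi>"
  using test_outside by (auto simp: zero_ext_def)

lemma zero_ext_integrable: "w \<in> L2_unit \<Longrightarrow> integrable lebesgue (zero_ext w)"
  using L2_unit_integrable[of w] by (simp add: zero_ext_indicator integrable_restrict_space)

lemma zero_ext_square_integral: "(LINT x|lebesgue. (zero_ext w x)\<^sup>2) = L2_sq w"
proof -
  have "(\<lambda>x. (zero_ext w x)\<^sup>2) = (\<lambda>x. indicator unit_ival x *\<^sub>R (w x)\<^sup>2)"
    by (auto simp: zero_ext_def indicator_def)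
  then show ?thesis by (simp add: integral_restrict_space)
qed

lemma test_square_integral:
  assumes "\<phi> \<in> test_functions"
  shows "L2_sq \<phi> = (LINT x|lborel. (\<phi> x)\<^sup>2)"
  using L2_inner_test_lborel[OF assms test_measurable[OF assms]]
  by (simp add: L2_inner_def power2_eq_square)

lemma fourier_integrand_integrable:
  assumes "integrable lebesgue w"
  shows "integrable lebesgue (\<lambda>x. complex_of_real (w x) * exp (- \<i> * complex_of_real (\<omega> * x)))"
proof (rule Bochner_Integration.integrable_bound[OF assms])
  show "(\<lambda>x. complex_of_real (w x) * exp (- \<i> * complex_of_real (\<omega> * x))) \<in> borel_measurable lebesgue"
  proof (rule borel_measurable_times)
    have "w \<in> borel_measurable lebesgue" using assms by auto
    then show "(\<lambda>x. complex_of_real (w x)) \<in> borel_measurable lebesgue" by simp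
    show "(\<lambda>x. exp (- \<i> * complex_of_real (\<omega> * x))) \<in> borel_measurable lebesgue"
      by (rule measurable_completion) measurable
  qed
qed (auto simp: norm_mult)

lemma fourier_diff:
  assumes "integrable lebesgue v" "integrable lebesgue w"
  shows "fourier (\<lambda>x. v x - w x) \<omega> = fourier v \<omega> - fourier w \<omega>"
  using fourier_integrand_integrable[OF assms(1), of \<omega>] fourier_integrand_integrable[OF assms(2), of \<omega>]
  by (simp add: fourier_def left_diff_distrib)

lemma fourier_measurable_lebesgue:
  assumes w: "integrable lebesgue w"
  shows "fourier w \<in> borel_measurable borel"
proof -
  have "w \<in> borel_measurable lebesgue" using w by auto
  from completion_ex_borel_measurable_real[OF this]
  obtain w' where w': "w' \<in> borel_measurable lborel" and eq: "AE x in lborel. w x = w' x" by blast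
  have eq': "AE x in lebesgue. w x = w' x" using eq by (rule AE_completion)
  have m: "w' \<in> borel_measurable lebesgue" using w' by (rule measurable_completion)
  have w'i: "integrable lebesgue w'"
    by (rule integrable_cong_AE_imp[OF w m eq'])
  have "fourier w = fourier w'"
  proof
    fix \<omega>
    show "fourier w \<omega> = fourier w' \<omega>"
      unfolding fourier_def
    proof (rule integral_cong_AE)
      show "AE x in lebesgue. complex_of_real (w x) * exp (- \<i> * complex_of_real (\<omega> * x)) =
          complex_of_real (w' x) * exp (- \<i> * complex_of_real (\<omega> * x))"
        using eq' by eventually_elim simp
    qed (use fourier_integrand_integrable[OF w, of \<omega>] fourier_integrand_integrable[OF w'i, of \<omega>]
        in \<open>auto dest: borel_measurable_integrable\<close>)
  qed
  with w' show ?thesis using fourier_measurable[of w'] by simp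
qed

lemma square_diff_le:
  fixes a b c :: real
  assumes "0 \<le> a" "a \<le> b + c"
  shows "a\<^sup>2 \<le> 2 * b\<^sup>2 + 2 * c\<^sup>2"
proof -
  have "a\<^sup>2 \<le> (b + c)\<^sup>2" using assms by (intro power_mono)
  also have "\<dots> \<le> 2 * b\<^sup>2 + 2 * c\<^sup>2" using sum_squares_bound[of b c] by (simp add: power2_sum)
  finally show ?thesis .
qed

lemma L2_unit_distance_le:
  assumes "f \<in> L2_unit" "g \<in> L2_unit" "u \<in> L2_unit"
  shows "L2_sq (\<lambda>x. f x - g x) \<le>
    2 * L2_sq (\<lambda>x. f x - u x) + 2 * L2_sq (\<lambda>x. g x - u x)"
proof -
  have i: "integrable unit_measure (\<lambda>x. (v x - w x)\<^sup>2)" if "v \<in> L2_unit" "w \<in> L2_unit" for v w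
    by (intro L2_unit_integrable_square L2_unit_diff that)
  have "L2_sq (\<lambda>x. f x - g x) \<le>
      (LINT x|unit_measure. 2 * (f x - u x)\<^sup>2 + 2 * (g x - u x)\<^sup>2)"
  proof (rule integral_mono)
    fix x
    have "\<bar>f x - g x\<bar>\<^sup>2 \<le> 2 * \<bar>f x - u x\<bar>\<^sup>2 + 2 * \<bar>g x - u x\<bar>\<^sup>2"
      by (rule square_diff_le) auto
    then show "(f x - g x)\<^sup>2 \<le> 2 * (f x - u x)\<^sup>2 + 2 * (g x - u x)\<^sup>2" by simp
  qed (use i assms in auto)
  also have "\<dots> = 2 * L2_sq (\<lambda>x. f x - u x) + 2 * L2_sq (\<lambda>x. g x - u x)"
    using i[OF assms(1,3)] i[OF assms(2,3)] by simp
  finally show ?thesis .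
qed

text \<open>The approximating sequence is Cauchy in the Sobolev norm. In this form the convergence only involves
  differences of test functions, to which inversion and Plancherel's theorem apply.\<close>

lemma H0_unit_approx:
  assumes u: "u \<in> H0_unit \<mu>" and \<mu>: "0 \<le> \<mu>" "\<mu> \<le> 1"
  obtains \<phi> where "\<And>n::nat. \<phi> n \<in> test_functions"
    "(\<lambda>n. L2_sq (\<lambda>x. \<phi> n x - u x)) \<longlonglongrightarrow> 0"
    "\<And>e. e > 0 \<Longrightarrow> \<exists>N. \<forall>m\<ge>N. \<forall>n\<ge>N. (LINT x|lborel. (\<phi> m x - \<phi> n x)\<^sup>2) < e \<and>
       fourier_energy \<mu> (\<lambda>x. \<phi> m x - \<phi> n x) < e"
proof -
  have uL2: "u \<in> L2_unit" using u by (simp add: H0_unit_def)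
  obtain \<phi> where \<phi>: "\<And>n::nat. \<phi> n \<in> test_functions"
    and lim: "(\<lambda>n. sobolev_norm \<mu> (\<lambda>x. \<phi> n x - u x)) \<longlonglongrightarrow> 0"
    using u unfolding H0_unit_def by auto
  define A where "A n = L2_sq (\<lambda>x. \<phi> n x - u x)" for n
  define b where "b n \<omega> = \<bar>\<omega>\<bar> powr \<mu> * cmod (fourier (zero_ext (\<lambda>x. \<phi> n x - u x)) \<omega>)" for n \<omega>
  define B where "B n = (LINT \<omega>|lebesgue. (b n \<omega>)\<^sup>2)" for n
  have AB: "A n \<ge> 0" "B n \<ge> 0" for n by (simp_all add: A_def B_def)
  have S: "sobolev_norm \<mu> (\<lambda>x. \<phi> n x - u x) = sqrt (A n + B n)" for n
    unfolding sobolev_norm_def zero_ext_square_integral A_def B_def b_def ..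
  have AB0: "(\<lambda>n. A n + B n) \<longlonglongrightarrow> 0"
    using tendsto_power[OF lim, of 2] AB by (simp add: S add_nonneg_nonneg)
  have A0: "A \<longlonglongrightarrow> 0"
    by (rule tendsto_sandwich[OF _ _ tendsto_const AB0]) (use AB in auto)
  have B0: "B \<longlonglongrightarrow> 0"
    by (rule tendsto_sandwich[OF _ _ tendsto_const AB0]) (use AB in auto)
  have ze: "zero_ext (\<lambda>x. \<phi> n x - u x) = (\<lambda>x. \<phi> n x - zero_ext u x)" for n
    using test_outside[OF \<phi>[of n]] by (auto simp: zero_ext_def)
  have i\<phi>: "integrable lebesgue (\<phi> n)" for n
    using zero_ext_integrable[OF test_L2_unit[OF \<phi>[of n]]] zero_ext_test[OF \<phi>[of n]] by simp
  have iu: "integrable lebesgue (zero_ext u)" by (rule zero_ext_integrable[OF uL2])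
  have F: "fourier (zero_ext (\<lambda>x. \<phi> n x - u x)) \<omega> = fourier (\<phi> n) \<omega> - fourier (zero_ext u) \<omega>" for n \<omega>
    unfolding ze by (rule fourier_diff[OF i\<phi> iu])
  have [measurable]: "fourier (\<phi> n) \<in> borel_measurable borel" "fourier (zero_ext u) \<in> borel_measurable borel" for n
    using fourier_measurable_lebesgue i\<phi> iu by auto
  have b_meas: "b n \<in> borel_measurable borel" for n
    unfolding b_def[abs_def] F by measurable
  have ib: "integrable lborel (\<lambda>\<omega>. (b n \<omega>)\<^sup>2)" for n
  proof (rule Bochner_Integration.integrable_bound)
    have "(\<lambda>\<omega>. (\<bar>\<omega>\<bar> powr \<mu> * cmod (fourier (zero_ext u) \<omega>))\<^sup>2) \<in> borel_measurable borel"
      by measurable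
    then have "integrable lborel (\<lambda>\<omega>. (\<bar>\<omega>\<bar> powr \<mu> * cmod (fourier (zero_ext u) \<omega>))\<^sup>2)"
      using u by (simp add: H0_unit_def integrable_completion)
    then show "integrable lborel (\<lambda>\<omega>. 2 * (\<bar>\<omega>\<bar> powr \<mu> * cmod (fourier (\<phi> n) \<omega>))\<^sup>2 +
        2 * (\<bar>\<omega>\<bar> powr \<mu> * cmod (fourier (zero_ext u) \<omega>))\<^sup>2)"
      by (intro Bochner_Integration.integrable_add integrable_mult_right
          test_weighted_fourier_integrable[OF \<phi> \<mu>])
    have "(b n \<omega>)\<^sup>2 \<le> 2 * (\<bar>\<omega>\<bar> powr \<mu> * cmod (fourier (\<phi> n) \<omega>))\<^sup>2 +
        2 * (\<bar>\<omega>\<bar> powr \<mu> * cmod (fourier (zero_ext u) \<omega>))\<^sup>2" for \<omega>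
    proof (rule square_diff_le)
      show "b n \<omega> \<le> \<bar>\<omega>\<bar> powr \<mu> * cmod (fourier (\<phi> n) \<omega>) + \<bar>\<omega>\<bar> powr \<mu> * cmod (fourier (zero_ext u) \<omega>)"
        unfolding b_def F distrib_left[symmetric] by (intro mult_left_mono norm_triangle_ineq4) auto
    qed (simp add: b_def)
    then show "AE \<omega> in lborel. norm ((b n \<omega>)\<^sup>2) \<le> norm (2 * (\<bar>\<omega>\<bar> powr \<mu> * cmod (fourier (\<phi> n) \<omega>))\<^sup>2 +
        2 * (\<bar>\<omega>\<bar> powr \<mu> * cmod (fourier (zero_ext u) \<omega>))\<^sup>2)"
      by auto
  qed (use b_meas in measurable)
  have B_lborel: "B n = (LINT \<omega>|lborel. (b n \<omega>)\<^sup>2)" for n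
    unfolding B_def using b_meas by (intro integral_completion) simp
  have distA: "(LINT x|lborel. (\<phi> m x - \<phi> n x)\<^sup>2) \<le> 2 * A m + 2 * A n" for m n
    using L2_unit_distance_le[OF test_L2_unit[OF \<phi>] test_L2_unit[OF \<phi>] uL2, of m n]
      test_square_integral[OF test_diff[OF \<phi>[of m] \<phi>[of n]]]
    by (simp add: A_def)
  have distB: "fourier_energy \<mu> (\<lambda>x. \<phi> m x - \<phi> n x) \<le> 2 * B m + 2 * B n" for m n
  proof -
    have "fourier_energy \<mu> (\<lambda>x. \<phi> m x - \<phi> n x) \<le>
        (LINT \<omega>|lborel. 2 * (b m \<omega>)\<^sup>2 + 2 * (b n \<omega>)\<^sup>2)"
    proof (rule integral_mono)
      show "integrable lborel (\<lambda>\<omega>. (\<bar>\<omega>\<bar> powr \<mu> * cmod (fourier (\<lambda>x. \<phi> m x - \<phi> n x) \<omega>))\<^sup>2)"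
        by (intro test_weighted_fourier_integrable test_diff \<phi> \<mu>)
      fix \<omega>
      show "(\<bar>\<omega>\<bar> powr \<mu> * cmod (fourier (\<lambda>x. \<phi> m x - \<phi> n x) \<omega>))\<^sup>2 \<le> 2 * (b m \<omega>)\<^sup>2 + 2 * (b n \<omega>)\<^sup>2"
      proof (rule square_diff_le)
        have "fourier (\<lambda>x. \<phi> m x - \<phi> n x) \<omega> = fourier (\<phi> m) \<omega> - fourier (\<phi> n) \<omega>"
          by (rule fourier_diff[OF i\<phi> i\<phi>])
        also have "\<dots> = (fourier (\<phi> m) \<omega> - fourier (zero_ext u) \<omega>) - (fourier (\<phi> n) \<omega> - fourier (zero_ext u) \<omega>)"
          by simp
        finally have "cmod (fourier (\<lambda>x. \<phi> m x - \<phi> n x) \<omega>) \<le>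
            cmod (fourier (\<phi> m) \<omega> - fourier (zero_ext u) \<omega>) + cmod (fourier (\<phi> n) \<omega> - fourier (zero_ext u) \<omega>)"
          by (metis norm_triangle_ineq4)
        then show "\<bar>\<omega>\<bar> powr \<mu> * cmod (fourier (\<lambda>x. \<phi> m x - \<phi> n x) \<omega>) \<le> b m \<omega> + b n \<omega>"
          unfolding b_def F distrib_left[symmetric] by (rule mult_left_mono) simp
      qed simp
    qed (use ib in auto)
    also have "\<dots> = 2 * B m + 2 * B n"
      using ib[of m] ib[of n] by (simp add: B_lborel)
    finally show ?thesis .
  qed
  show ?thesis
  proof (rule that[OF \<phi>])
    show "(\<lambda>n. L2_sq (\<lambda>x. \<phi> n x - u x)) \<longlonglongrightarrow> 0"
      using A0 by (simp add: A_def[abs_def])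
    fix e :: real assume "e > 0"
    have "\<forall>\<^sub>F n in sequentially. A n < e / 4 \<and> B n < e / 4"
      using order_tendstoD(2)[OF A0, of "e / 4"] order_tendstoD(2)[OF B0, of "e / 4"] \<open>e > 0\<close>
      by (simp add: eventually_conj_iff)
    then obtain N where N: "\<And>n. n \<ge> N \<Longrightarrow> A n < e / 4 \<and> B n < e / 4"
      by (auto simp: eventually_sequentially)
    show "\<exists>N. \<forall>m\<ge>N. \<forall>n\<ge>N. (LINT x|lborel. (\<phi> m x - \<phi> n x)\<^sup>2) < e \<and>
       fourier_energy \<mu> (\<lambda>x. \<phi> m x - \<phi> n x) < e"
    proof (intro exI allI impI conjI)
      fix m n assume "N \<le> m" "N \<le> n"
      then have "2 * A m + 2 * A n < e" "2 * B m + 2 * B n < e" using N[of m] N[of n] by auto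
      with distA[of m n] distB[of m n]
      show "(LINT x|lborel. (\<phi> m x - \<phi> n x)\<^sup>2) < e"
        "fourier_energy \<mu> (\<lambda>x. \<phi> m x - \<phi> n x) < e"
        by linarith+
    qed
  qed
qed

lemma test_H0_unit:
  assumes \<phi>: "\<phi> \<in> test_functions" and \<mu>: "0 \<le> \<mu>" "\<mu> \<le> 1"
  shows "\<phi> \<in> H0_unit \<mu>"
proof -
  have "integrable lebesgue (\<lambda>\<omega>. (\<bar>\<omega>\<bar> powr \<mu> * cmod (fourier \<phi> \<omega>))\<^sup>2)"
    using test_weighted_fourier_integrable[OF assms] test_measurable[OF \<phi>]
    by (subst integrable_completion) auto
  moreover have "sobolev_norm \<mu> (\<lambda>x. \<phi> x - \<phi> x) = 0"
    by (simp add: sobolev_norm_def zero_ext_def fourier_def)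
  ultimately show ?thesis
    unfolding H0_unit_def using test_L2_unit[OF \<phi>] zero_ext_test[OF \<phi>] \<phi>
    by (auto intro!: exI[of _ "\<lambda>n. \<phi>"])
qed

lemma test_integration_by_parts:
  assumes \<phi>: "\<phi> \<in> test_functions" and \<psi>: "smooth \<psi>"
  shows "(LINT x|lborel. \<psi> x * deriv \<phi> x) = - (LINT x|lborel. deriv \<psi> x * \<phi> x)"
proof -
  have 1: "(\<lambda>x. \<psi> x * deriv \<phi> x) \<in> test_functions" "(\<lambda>x. deriv \<psi> x * \<phi> x) \<in> test_functions"
    using test_mult_smooth[OF test_deriv[OF \<phi>] \<psi>] test_mult_smooth[OF \<phi> smooth_deriv[OF \<psi>]] by auto
  have "(LINT x|lborel. deriv \<psi> x * \<phi> x + \<psi> x * deriv \<phi> x) = 0"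
  proof (rule integral_deriv_compact_support)
    show "((\<lambda>x. \<psi> x * \<phi> x) has_vector_derivative deriv \<psi> x * \<phi> x + \<psi> x * deriv \<phi> x) (at x)" for x
      using DERIV_mult[OF smooth_has_deriv[OF \<psi>, of x] smooth_has_deriv[OF test_smooth[OF \<phi>], of x]]
      by (simp add: has_real_derivative_iff_has_vector_derivative mult.commute)
    show "continuous_on UNIV (\<lambda>x. deriv \<psi> x * \<phi> x + \<psi> x * deriv \<phi> x)"
      by (intro smooth_continuous smooth_add test_smooth 1)
  qed (use test_outside[OF \<phi>] test_outside[OF test_deriv[OF \<phi>]] in auto)
  then show ?thesis
    using test_integrable[OF 1(1)] test_integrable[OF 1(2)] by simp
qed

lemma test_has_weak_deriv:
  assumes \<phi>: "\<phi> \<in> test_functions"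
  shows "has_weak_deriv \<phi> (deriv \<phi>)"
proof (rule has_weak_derivI)
  fix \<psi> assume \<psi>: "\<psi> \<in> test_functions"
  show "L2_inner \<phi> (deriv \<psi>) = - L2_inner (deriv \<phi>) \<psi>"
    using test_integration_by_parts[OF \<psi> test_smooth[OF \<phi>]]
    by (simp add: L2_inner_test_lborel test_measurable test_deriv \<phi> \<psi>)
qed (auto intro: test_L2_unit test_deriv \<phi>)

text \<open>Plancherel's theorem turns the energy with exponent \<open>1\<close> into the \<open>L\<^sup>2\<close> norm of the derivative, so
  the derivatives of the approximating test functions are Cauchy in \<open>L\<^sup>2\<close>.\<close>

lemma H0_unit_1_subset_H1: "H0_unit 1 \<subseteq> H1_unit"
proof
  fix v assume v: "v \<in> H0_unit 1"
  then have vL2: "v \<in> L2_unit" by (simp add: H0_unit_def)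
  obtain \<phi> where \<phi>: "\<And>n::nat. \<phi> n \<in> test_functions"
    and lim: "(\<lambda>n. L2_sq (\<lambda>x. \<phi> n x - v x)) \<longlonglongrightarrow> 0"
    and Cau: "\<And>e. e > 0 \<Longrightarrow> \<exists>N. \<forall>m\<ge>N. \<forall>n\<ge>N. (LINT x|lborel. (\<phi> m x - \<phi> n x)\<^sup>2) < e \<and>
       fourier_energy 1 (\<lambda>x. \<phi> m x - \<phi> n x) < e"
    using H0_unit_approx[OF v] by auto
  have eq: "fourier_energy 1 (\<lambda>x. \<phi> m x - \<phi> n x) =
      2 * pi * L2_sq (\<lambda>x. deriv (\<phi> m) x - deriv (\<phi> n) x)" for m n
  proof -
    let ?d = "\<lambda>x. \<phi> m x - \<phi> n x"
    have d: "?d \<in> test_functions" by (intro test_diff \<phi>)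
    have "2 * pi * (LINT x|lborel. (deriv ?d x)\<^sup>2) = (LINT \<omega>|lborel. (cmod (fourier (deriv ?d) \<omega>))\<^sup>2)"
      by (rule test_plancherel(2)[OF test_deriv[OF d]])
    then show ?thesis
      using test_square_integral[OF test_deriv[OF d]]
      by (simp add: fourier_deriv[OF d, unfolded deriv_test_diff[OF \<phi> \<phi>]] norm_mult
          deriv_test_diff[OF \<phi> \<phi>])
  qed
  show "v \<in> H1_unit"
  proof (rule weak_deriv_closed[where w = \<phi> and g = "\<lambda>n. deriv (\<phi> n)"])
    show "L2_inner (\<phi> n) (deriv \<psi>) = - L2_inner (deriv (\<phi> n)) \<psi>" if "\<psi> \<in> test_functions" for n \<psi>
      using test_has_weak_deriv[OF \<phi>] that by (auto simp: has_weak_deriv_def)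
    fix e :: real assume "e > 0"
    then obtain N where N: "\<forall>m\<ge>N. \<forall>n\<ge>N. 2 * pi * L2_sq (\<lambda>x. deriv (\<phi> m) x - deriv (\<phi> n) x) < 2 * pi * e"
      using Cau[of "2 * pi * e"] unfolding eq by auto
    then show "\<exists>N. \<forall>m\<ge>N. \<forall>n\<ge>N. L2_sq (\<lambda>x. deriv (\<phi> m) x - deriv (\<phi> n) x) < e"
      by (intro exI[of _ N]) simp
  qed (auto intro: test_L2_unit test_deriv \<phi> vL2 lim)
qed

section \<open>The fractional integral of a Sobolev function\<close>

text \<open>For \<open>\<mu> > 1 / 2\<close> the weight \<open>1 / (1 + \<bar>\<omega>\<bar>\<^sup>2\<^sup>\<mu>)\<close> is integrable, and Young's inequality with
  parameter \<open>\<epsilon>\<close> bounds the \<open>L\<^sup>1\<close> norm of the Fourier transform by the Sobolev norm.\<close>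

lemma test_sup_bound:
  assumes \<mu>: "1 / 2 < \<mu>" "\<mu> \<le> 1"
  obtains C where "C > 0" "\<And>\<phi> \<epsilon> x. \<phi> \<in> test_functions \<Longrightarrow> \<epsilon> > 0 \<Longrightarrow>
    (LINT x|lborel. (\<phi> x)\<^sup>2) \<le> \<epsilon>\<^sup>2 \<Longrightarrow>
    fourier_energy \<mu> \<phi> \<le> \<epsilon>\<^sup>2 \<Longrightarrow> \<bar>\<phi> x\<bar> \<le> C * \<epsilon>"
proof -
  define m where "m \<omega> = 1 + \<bar>\<omega>\<bar> powr (2 * \<mu>)" for \<omega> :: real
  define A where "A = (LINT \<omega>|lborel. 1 / m \<omega>)"
  have m: "m \<omega> > 0" for \<omega> by (simp add: m_def add_pos_nonneg)
  have im: "integrable lborel (\<lambda>\<omega>. 1 / m \<omega>)"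
    unfolding m_def using \<mu> by (intro integrable_inverse_powr) simp
  have A: "A \<ge> 0" unfolding A_def using m by (intro integral_nonneg_AE) (auto simp: less_imp_le)
  have sq: "m \<omega> * c\<^sup>2 = c\<^sup>2 + (\<bar>\<omega>\<bar> powr \<mu> * c)\<^sup>2" for \<omega> c
  proof -
    have "\<bar>\<omega>\<bar> powr (2 * \<mu>) = (\<bar>\<omega>\<bar> powr \<mu>)\<^sup>2"
      by (simp add: power2_eq_square flip: powr_add)
    then show ?thesis by (simp add: m_def power_mult_distrib algebra_simps)
  qed
  have bound: "\<bar>\<phi> x\<bar> \<le> (A + 2 * pi + 1) * \<epsilon>"
    if \<phi>: "\<phi> \<in> test_functions" and \<epsilon>: "\<epsilon> > 0" and L2: "(LINT x|lborel. (\<phi> x)\<^sup>2) \<le> \<epsilon>\<^sup>2"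
      and N: "fourier_energy \<mu> \<phi> \<le> \<epsilon>\<^sup>2" for \<phi> \<epsilon> x
  proof -
    let ?F = "\<lambda>\<omega>. cmod (fourier \<phi> \<omega>)"
    have pw: "2 * ?F \<omega> \<le> \<epsilon> * (1 / m \<omega>) + ((?F \<omega>)\<^sup>2 + (\<bar>\<omega>\<bar> powr \<mu> * ?F \<omega>)\<^sup>2) / \<epsilon>" for \<omega>
    proof -
      have "0 \<le> (\<epsilon> - m \<omega> * ?F \<omega>)\<^sup>2 / (\<epsilon> * m \<omega>)"
        using m[of \<omega>] \<epsilon> by (intro divide_nonneg_pos) auto
      also have "\<dots> = \<epsilon> * (1 / m \<omega>) - 2 * ?F \<omega> + m \<omega> * (?F \<omega>)\<^sup>2 / \<epsilon>"
        using m[of \<omega>] \<epsilon> by (simp add: power2_eq_square field_simps)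
      finally show ?thesis by (simp add: sq)
    qed
    obtain B where B: "\<And>x. \<bar>\<phi> x\<bar> \<le> B" using test_bounded[OF \<phi>] by blast
    have i1: "integrable lborel ?F" using fourier_test_integrable[OF \<phi>] by simp
    have i2: "integrable lborel (\<lambda>\<omega>. (?F \<omega>)\<^sup>2)" by (rule test_plancherel(1)[OF \<phi>])
    have i3: "integrable lborel (\<lambda>\<omega>. (\<bar>\<omega>\<bar> powr \<mu> * ?F \<omega>)\<^sup>2)"
      using \<mu> by (intro test_weighted_fourier_integrable \<phi>) auto
    have "2 * pi * \<bar>\<phi> x\<bar> \<le> (LINT \<omega>|lborel. ?F \<omega>)"
      by (rule abs_le_integral_fourier[OF test_integrable[OF \<phi>] smooth_continuous[OF test_smooth[OF \<phi>]]
            B fourier_test_integrable[OF \<phi>]])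
    then have "2 * (2 * pi * \<bar>\<phi> x\<bar>) \<le> (LINT \<omega>|lborel. 2 * ?F \<omega>)" by simp
    also have "\<dots> \<le> (LINT \<omega>|lborel. \<epsilon> * (1 / m \<omega>) + ((?F \<omega>)\<^sup>2 + (\<bar>\<omega>\<bar> powr \<mu> * ?F \<omega>)\<^sup>2) / \<epsilon>)"
      using i1 i2 i3 im pw
      by (intro integral_mono Bochner_Integration.integrable_add integrable_mult_right integrable_divide_zero) auto
    also have "\<dots> = \<epsilon> * A + ((LINT \<omega>|lborel. (?F \<omega>)\<^sup>2) + (LINT \<omega>|lborel. (\<bar>\<omega>\<bar> powr \<mu> * ?F \<omega>)\<^sup>2)) / \<epsilon>"
      unfolding A_def using i2 i3 im
      by (subst Bochner_Integration.integral_add) (auto intro!: integrable_mult_right simp del: times_divide_eq_right)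
    also have "\<dots> \<le> \<epsilon> * A + (2 * pi * \<epsilon>\<^sup>2 + \<epsilon>\<^sup>2) / \<epsilon>"
      using L2 N \<epsilon> unfolding test_plancherel(2)[OF \<phi>, symmetric]
      by (intro add_left_mono divide_right_mono add_mono mult_left_mono) auto
    also have "\<dots> = (A + 2 * pi + 1) * \<epsilon>"
      using \<epsilon> by (simp add: power2_eq_square field_simps)
    finally have "2 * (2 * pi * \<bar>\<phi> x\<bar>) \<le> (A + 2 * pi + 1) * \<epsilon>" .
    moreover have "\<bar>\<phi> x\<bar> \<le> 2 * (2 * pi * \<bar>\<phi> x\<bar>)"
      using pi_gt3 mult_right_mono[of 1 "4 * pi" "\<bar>\<phi> x\<bar>"] by simp
    ultimately show ?thesis by linarith
  qed
  show ?thesis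
    by (rule that[of "A + 2 * pi + 1"]) (use A bound pi_gt3 in \<open>auto intro: add_nonneg_pos\<close>)
qed

lemma uniform_limit_imp_L2:
  assumes v: "\<And>n. v n \<in> L2_unit" and V: "V \<in> L2_unit"
    and lim: "\<And>\<epsilon>. \<epsilon> > 0 \<Longrightarrow> \<forall>\<^sub>F n in sequentially. \<forall>x\<in>unit_ival. \<bar>v n x - V x\<bar> \<le> \<epsilon>"
  shows "(\<lambda>n. L2_sq (\<lambda>x. v n x - V x)) \<longlonglongrightarrow> 0"
proof (rule tendstoI)
  interpret finite_measure unit_measure by (rule finite_measure_unit)
  fix e :: real assume "e > 0"
  define \<epsilon> where "\<epsilon> = sqrt (e / 2)"
  have "\<epsilon> > 0" using \<open>e > 0\<close> by (simp add: \<epsilon>_def)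
  from lim[OF this] show "\<forall>\<^sub>F n in sequentially. dist (L2_sq (\<lambda>x. v n x - V x)) 0 < e"
  proof eventually_elim
    case (elim n)
    have "L2_sq (\<lambda>x. v n x - V x) \<le> (LINT x|unit_measure. \<epsilon>\<^sup>2)"
    proof (rule integral_mono)
      show "integrable unit_measure (\<lambda>x. (v n x - V x)\<^sup>2)"
        by (intro L2_unit_integrable_square L2_unit_diff v V)
      fix x assume "x \<in> space unit_measure"
      then have "\<bar>v n x - V x\<bar> \<le> \<bar>\<epsilon>\<bar>" using elim \<open>\<epsilon> > 0\<close> by auto
      then show "(v n x - V x)\<^sup>2 \<le> \<epsilon>\<^sup>2" by (simp add: abs_le_square_iff)
    qed simp
    also have "\<dots> = e / 2" using \<open>e > 0\<close> by (simp add: \<epsilon>_def measure_restrict_space)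
    finally show ?case using \<open>e > 0\<close> by simp
  qed
qed

lemma L2_limit_unique:
  assumes "\<And>n. v n \<in> L2_unit" "u \<in> L2_unit" "w \<in> L2_unit"
    and "(\<lambda>n. L2_sq (\<lambda>x. v n x - u x)) \<longlonglongrightarrow> 0"
    and "(\<lambda>n. L2_sq (\<lambda>x. v n x - w x)) \<longlonglongrightarrow> 0"
  shows "AE x in unit_measure. u x = w x"
proof -
  let ?d = "\<lambda>x. u x - w x"
  have d: "?d \<in> L2_unit" by (rule L2_unit_diff[OF assms(2,3)])
  have "L2_inner u ?d = L2_inner w ?d"
    using L2_inner_tendsto[OF assms(1,2) d assms(4)] L2_inner_tendsto[OF assms(1,3) d assms(5)]
    by (rule LIMSEQ_unique)
  then have "L2_inner ?d ?d = 0"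
    using L2_inner_diff_left[OF assms(2,3) d] by simp
  then have "L2_sq ?d = 0"
    by (simp add: L2_inner_def power2_eq_square)
  then have "AE x in unit_measure. (?d x)\<^sup>2 = 0"
    using L2_unit_integrable_square[OF d] by (subst (asm) integral_nonneg_eq_0_iff_AE) auto
  then show ?thesis by eventually_elim simp
qed

lemma integral_against_kernel_AE:
  fixes U u k d :: "real \<Rightarrow> real"
  assumes U: "continuous_on UNIV U" "\<And>x. x \<notin> unit_ival \<Longrightarrow> U x = 0"
    and eq: "AE x in unit_measure. u x = U x"
    and S: "S \<in> sets lebesgue" "S \<subseteq> unit_ival"
    and k: "k \<in> borel_measurable borel" "\<And>s. s \<in> S \<Longrightarrow> d s = k s" "\<And>s. s \<in> unit_ival - S \<Longrightarrow> k s = 0"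
  shows "(LINT s|lebesgue_on S. u s * d s) = (LINT s|lborel. k s * U s)"
proof -
  have Um: "U \<in> borel_measurable borel" by (rule borel_measurable_continuous_onI[OF U(1)])
  have m: "(\<lambda>s. k s * U s) \<in> borel_measurable lebesgue"
    using k(1) Um by (intro measurable_completion) simp
  have "AE s in lebesgue. s \<in> unit_ival \<longrightarrow> u s = U s"
    using eq by (simp add: AE_restrict_space_iff)
  then have ae: "AE s in lebesgue. k s * U s = indicator S s *\<^sub>R (u s * d s)"
  proof eventually_elim
    case (elim s)
    consider "s \<in> S" | "s \<in> unit_ival - S" | "s \<notin> unit_ival" by blast
    then show ?case
      by cases (use elim k S(2) U(2)[of s] in \<open>auto simp: indicator_def\<close>)
  qed
  have "(LINT s|lebesgue_on S. u s * d s) = (LINT s|lebesgue. indicator S s *\<^sub>R (u s * d s))"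
    using S(1) by (intro integral_restrict_space) simp
  also have "\<dots> = (LINT s|lebesgue. k s * U s)"
    by (rule integral_cong_AE[OF borel_measurable_AE[OF m ae] m]) (use ae in \<open>auto simp: eq_commute\<close>)
  also have "\<dots> = (LINT s|lborel. k s * U s)"
    using k(1) Um by (intro integral_completion) simp
  finally show ?thesis .
qed

text \<open>For \<open>x\<close> and \<open>s\<close> in \<open>[0,1]\<close> the difference \<open>x - s\<close> stays in the range where the kernel is not truncated.
  The endpoints are included: there the formula gives the boundary values.\<close>

lemma frac_int_eq_convolution:
  assumes \<beta>: "0 < \<beta>" and U: "continuous_on UNIV U" "\<And>x. x \<notin> unit_ival \<Longrightarrow> U x = 0" "\<And>x. \<bar>U x\<bar> \<le> B"
    and eq: "AE x in unit_measure. u x = U x" and x: "x \<in> {0..1}"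
  shows "frac_int \<beta> \<theta> u x = 1 / Gamma \<beta> * convolution (kernel \<beta> \<theta>) U x"
proof -
  let ?h = "half_kernel \<beta>"
  have Um: "U \<in> borel_measurable borel" by (rule borel_measurable_continuous_onI[OF U(1)])
  have left: "(LINT s|lebesgue_on {0<..<x}. u s / (x - s) powr (1 - \<beta>)) = (LINT s|lborel. ?h (x - s) * U s)"
    unfolding divide_inverse
  proof (rule integral_against_kernel_AE[OF U(1,2) eq])
    show "inverse ((x - s) powr (1 - \<beta>)) = ?h (x - s)" if "s \<in> {0<..<x}" for s
      using that x by (simp add: half_kernel_def flip: powr_minus)
    show "?h (x - s) = 0" if "s \<in> unit_ival - {0<..<x}" for s
      using that by (cases "s = x") (auto simp: half_kernel_def)
  qed (use x in auto)
  have right: "(LINT s|lebesgue_on {x<..<1}. u s / (s - x) powr (1 - \<beta>)) = (LINT s|lborel. ?h (s - x) * U s)"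
    unfolding divide_inverse
  proof (rule integral_against_kernel_AE[OF U(1,2) eq])
    show "inverse ((s - x) powr (1 - \<beta>)) = ?h (s - x)" if "s \<in> {x<..<1}" for s
      using that x by (simp add: half_kernel_def flip: powr_minus)
    show "?h (s - x) = 0" if "s \<in> unit_ival - {x<..<1}" for s
      using that by (cases "s = x") (auto simp: half_kernel_def)
  qed (use x in auto)
  have ih: "integrable lborel (\<lambda>t. ?h t * U (x - t))" "integrable lborel (\<lambda>t. ?h (- t) * U (x - t))"
    using convolution_integrand[OF half_kernel_integrable[OF \<beta>] Um U(3), of x]
      convolution_integrand[of "\<lambda>t. ?h (- t)", OF _ Um U(3), of x]
      lborel_integrable_real_affine[OF half_kernel_integrable[OF \<beta>], of "-1" 0] by simp_all
  have l: "(LINT s|lborel. ?h (x - s) * U s) = (LINT t|lborel. ?h t * U (x - t))"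
    by (subst lborel_integral_real_affine[where c = "-1" and t = x]) auto
  have r: "(LINT s|lborel. ?h (s - x) * U s) = (LINT t|lborel. ?h (- t) * U (x - t))"
    by (subst lborel_integral_real_affine[where c = "-1" and t = x]) auto
  have "convolution (kernel \<beta> \<theta>) U x =
      (LINT t|lborel. \<theta> * (?h t * U (x - t)) + (1 - \<theta>) * (?h (- t) * U (x - t)))"
    unfolding convolution_def kernel_def by (rule Bochner_Integration.integral_cong) (auto simp: algebra_simps)
  also have "\<dots> = \<theta> * (LINT t|lborel. ?h t * U (x - t)) + (1 - \<theta>) * (LINT t|lborel. ?h (- t) * U (x - t))"
    using ih by simp
  finally have conv: "convolution (kernel \<beta> \<theta>) U x =
      \<theta> * (LINT t|lborel. ?h t * U (x - t)) + (1 - \<theta>) * (LINT t|lborel. ?h (- t) * U (x - t))" .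
  show ?thesis
    unfolding frac_int_def frac_int_left_def frac_int_right_def left right l r conv
    by (simp add: algebra_simps diff_divide_distrib)
qed

lemma convolution_diff:
  assumes "integrable lborel k" "\<phi> \<in> borel_measurable borel" "\<And>x. \<bar>\<phi> x\<bar> \<le> B"
    "\<psi> \<in> borel_measurable borel" "\<And>x. \<bar>\<psi> x\<bar> \<le> B'"
  shows "convolution k (\<lambda>x. \<phi> x - \<psi> x) x = convolution k \<phi> x - convolution k \<psi> x"
  using convolution_integrand[OF assms(1-3), of x] convolution_integrand[OF assms(1,4,5), of x]
  by (simp add: convolution_def right_diff_distrib)

text \<open>Under the integral over the shift \<open>t\<close>, this is integration by parts for a translate of \<open>\<phi>\<close>.\<close>

lemma convolution_integration_by_parts:
  assumes k: "integrable lborel k" and \<phi>: "\<phi> \<in> test_functions" and \<psi>: "\<psi> \<in> test_functions"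
  shows "(LINT x|lborel. convolution k \<phi> x * deriv \<psi> x) = - (LINT x|lborel. convolution k (deriv \<phi>) x * \<psi> x)"
proof -
  have swap: "(LINT x|lborel. convolution k \<eta> x * \<zeta> x) = (LINT t|lborel. k t * (LINT x|lborel. \<eta> (x - t) * \<zeta> x))"
    if \<eta>: "\<eta> \<in> test_functions" and \<zeta>: "\<zeta> \<in> test_functions" for \<eta> \<zeta>
  proof -
    have [measurable]: "k \<in> borel_measurable borel" "\<eta> \<in> borel_measurable borel" "\<zeta> \<in> borel_measurable borel"
      using k \<eta> \<zeta> by (auto simp: test_measurable)
    obtain B where B: "\<And>x. \<bar>\<zeta> x\<bar> \<le> B" using test_bounded[OF \<zeta>] by blast
    have "integrable (lborel \<Otimes>\<^sub>M lborel) (\<lambda>(t, x). (k t * \<eta> (x - t)) * \<zeta> x)"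
      by (rule convolution_product_integrable[OF k test_integrable[OF \<eta>], where B = B])
        (use abs_mult_le[OF B] in auto)
    from lborel_pair.Fubini_integral[OF this]
    show ?thesis
      by (simp add: convolution_def mult.assoc flip: integral_mult_left_zero integral_mult_right_zero)
  qed
  have inner: "(LINT x|lborel. \<phi> (x - t) * deriv \<psi> x) = - (LINT x|lborel. deriv \<phi> (x - t) * \<psi> x)" for t
  proof -
    have s: "smooth (\<lambda>x. \<phi> (1 * x + - t))" by (rule smooth_affine[OF test_smooth[OF \<phi>]])
    have "((\<lambda>x. \<phi> (1 * x + - t)) has_real_derivative deriv \<phi> (1 * x + - t) * 1) (at x)" for x
      by (rule DERIV_chain2[OF smooth_has_deriv[OF test_smooth[OF \<phi>]]]) (auto intro!: derivative_eq_intros)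
    then have "deriv (\<lambda>x. \<phi> (1 * x + - t)) x = deriv \<phi> (1 * x + - t)" for x
      by (intro DERIV_imp_deriv) simp
    then show ?thesis using test_integration_by_parts[OF \<psi> s] by simp
  qed
  show ?thesis
    unfolding swap[OF \<phi> test_deriv[OF \<psi>]] swap[OF test_deriv[OF \<phi>] \<psi>] inner by simp
qed

text \<open>A single approximating sequence converges uniformly, by \<open>test_sup_bound\<close>, and is Cauchy in the
  energy; the boundary values use the former and the weak derivative uses the latter.\<close>

lemma H0_unit_continuous_limit:
  assumes u: "u \<in> H0_unit \<mu>" and \<mu>: "1 / 2 < \<mu>" "\<mu> \<le> 1"
  obtains \<phi> U B where "\<And>n::nat. \<phi> n \<in> test_functions"
    "continuous_on UNIV U" "\<And>x. x \<notin> unit_ival \<Longrightarrow> U x = 0" "\<And>x. \<bar>U x\<bar> \<le> B"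
    "AE x in unit_measure. u x = U x"
    "\<And>\<epsilon>. \<epsilon> > 0 \<Longrightarrow> \<forall>\<^sub>F n in sequentially. \<forall>x. \<bar>\<phi> n x - U x\<bar> \<le> \<epsilon>"
    "\<And>e. e > 0 \<Longrightarrow> \<exists>N. \<forall>m\<ge>N. \<forall>n\<ge>N.
       fourier_energy \<mu> (\<lambda>x. \<phi> m x - \<phi> n x) < e"
proof -
  have uL2: "u \<in> L2_unit" using u by (simp add: H0_unit_def)
  have "0 \<le> \<mu>" using \<mu> by simp
  from H0_unit_approx[OF u this \<mu>(2)] obtain \<phi> where \<phi>: "\<And>n::nat. \<phi> n \<in> test_functions"
    and lim: "(\<lambda>n. L2_sq (\<lambda>x. \<phi> n x - u x)) \<longlonglongrightarrow> 0"
    and Cau: "\<And>e. e > 0 \<Longrightarrow> \<exists>N. \<forall>m\<ge>N. \<forall>n\<ge>N. (LINT x|lborel. (\<phi> m x - \<phi> n x)\<^sup>2) < e \<and>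
       fourier_energy \<mu> (\<lambda>x. \<phi> m x - \<phi> n x) < e"
    by blast
  obtain C where C: "C > 0" "\<And>\<phi> \<epsilon> x. \<phi> \<in> test_functions \<Longrightarrow> \<epsilon> > 0 \<Longrightarrow>
    (LINT x|lborel. (\<phi> x)\<^sup>2) \<le> \<epsilon>\<^sup>2 \<Longrightarrow>
    fourier_energy \<mu> \<phi> \<le> \<epsilon>\<^sup>2 \<Longrightarrow> \<bar>\<phi> x\<bar> \<le> C * \<epsilon>"
    using test_sup_bound[OF \<mu>] by blast
  have "uniformly_Cauchy_on UNIV \<phi>"
    unfolding uniformly_Cauchy_on_def
  proof (intro allI impI)
    fix e :: real assume "e > 0"
    define \<epsilon> where "\<epsilon> = e / (2 * C)"
    have \<epsilon>: "\<epsilon> > 0" "C * \<epsilon> < e" using \<open>e > 0\<close> C(1) by (simp_all add: \<epsilon>_def field_simps)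
    obtain N where N: "\<And>m n. m \<ge> N \<Longrightarrow> n \<ge> N \<Longrightarrow> (LINT x|lborel. (\<phi> m x - \<phi> n x)\<^sup>2) < \<epsilon>\<^sup>2 \<and>
       fourier_energy \<mu> (\<lambda>x. \<phi> m x - \<phi> n x) < \<epsilon>\<^sup>2"
      using Cau[of "\<epsilon>\<^sup>2"] \<epsilon>(1) by auto
    have "dist (\<phi> m x) (\<phi> n x) < e" if "m \<ge> N" "n \<ge> N" for m n x
    proof -
      have "\<bar>\<phi> m x - \<phi> n x\<bar> \<le> C * \<epsilon>"
        by (rule C(2)[OF test_diff[OF \<phi>[of m] \<phi>[of n]] \<epsilon>(1)]) (use N[OF that] in auto)
      then show ?thesis using \<epsilon>(2) by (simp add: dist_real_def)
    qed
    then show "\<exists>M. \<forall>x\<in>UNIV. \<forall>m\<ge>M. \<forall>n\<ge>M. dist (\<phi> m x) (\<phi> n x) < e" by blast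
  qed
  then have "uniformly_convergent_on UNIV \<phi>" by (rule Cauchy_uniformly_convergent)
  then obtain U where U: "uniform_limit UNIV \<phi> U sequentially"
    by (auto simp: uniformly_convergent_on_def)
  have cont: "continuous_on UNIV U"
    by (rule uniform_limit_theorem[OF _ U])
      (intro always_eventually allI smooth_continuous test_smooth \<phi>, simp)
  have zero: "U x = 0" if "x \<notin> unit_ival" for x
  proof -
    have "(\<lambda>n. \<phi> n x) \<longlonglongrightarrow> U x" by (rule tendsto_uniform_limitI[OF U]) simp
    then show ?thesis using test_outside[OF \<phi> that] by (simp add: LIMSEQ_const_iff)
  qed
  have "bounded (U ` {0..1})"
    by (intro compact_imp_bounded compact_continuous_image continuous_on_subset[OF cont]) auto
  then obtain B where B: "B > 0" "\<And>x. x \<in> {0..1} \<Longrightarrow> \<bar>U x\<bar> \<le> B"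
    unfolding bounded_pos by auto
  have B': "\<bar>U x\<bar> \<le> B" for x
    using B zero[of x] by (cases "x \<in> {0..1}") auto
  have unif: "\<forall>\<^sub>F n in sequentially. \<forall>x. \<bar>\<phi> n x - U x\<bar> \<le> \<epsilon>" if "\<epsilon> > 0" for \<epsilon>
    using uniform_limitD[OF U that] by eventually_elim (auto simp: dist_real_def less_imp_le)
  have UL2: "U \<in> L2_unit"
    using borel_measurable_continuous_onI[OF cont] B'
    by (intro L2_unit_bounded[where B = B] measurable_restrict_space1 measurable_completion) auto
  have "(\<lambda>n. L2_sq (\<lambda>x. \<phi> n x - U x)) \<longlonglongrightarrow> 0"
    by (rule uniform_limit_imp_L2[OF test_L2_unit[OF \<phi>] UL2])
      (rule eventually_mono[OF unif], auto)
  then have "AE x in unit_measure. u x = U x"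
    by (rule L2_limit_unique[OF test_L2_unit[OF \<phi>] uL2 UL2 lim])
  from that[OF \<phi> cont zero B' this unif] Cau show ?thesis by meson
qed

text \<open>Convolution with the kernel maps the approximating test functions to functions that converge
  uniformly on \<open>[0,1]\<close> and whose derivatives are Cauchy in \<open>L\<^sup>2\<close>. One of the two one-sided integrals is
  empty at each endpoint, which leaves the stated boundary values.\<close>

theorem frac_int_H1:
  assumes \<beta>: "0 < \<beta>" "\<beta> < 1 / 2" and \<theta>: "0 \<le> \<theta>" "\<theta> \<le> 1" and u: "u \<in> H0_unit (1 - \<beta>)"
  shows "frac_int \<beta> \<theta> u \<in> H1_unit"
    and "boundary_values (frac_int \<beta> \<theta> u) ((1 - \<theta>) * frac_int_right \<beta> u 0) (\<theta> * frac_int_left \<beta> u 1)"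
proof -
  let ?k = "kernel \<beta> \<theta>" and ?c = "1 / Gamma \<beta>"
  let ?T = "\<lambda>\<eta> x. ?c * convolution ?k \<eta> x"
  have \<beta>1: "\<beta> < 1" using \<beta> by simp
  have \<mu>: "1 / 2 < 1 - \<beta>" "1 - \<beta> \<le> 1" using \<beta> by auto
  from H0_unit_continuous_limit[OF u \<mu>] obtain \<phi> U B where \<phi>: "\<And>n::nat. \<phi> n \<in> test_functions"
    and U: "continuous_on UNIV U" "\<And>x. x \<notin> unit_ival \<Longrightarrow> U x = 0" "\<And>x. \<bar>U x\<bar> \<le> B"
    and eq: "AE x in unit_measure. u x = U x"
    and unif: "\<And>\<epsilon>. \<epsilon> > 0 \<Longrightarrow> \<forall>\<^sub>F n in sequentially. \<forall>x. \<bar>\<phi> n x - U x\<bar> \<le> \<epsilon>"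
    and Cau: "\<And>e. e > 0 \<Longrightarrow> \<exists>N. \<forall>m\<ge>N. \<forall>n\<ge>N.
       fourier_energy (1 - \<beta>) (\<lambda>x. \<phi> m x - \<phi> n x) < e"
    by blast
  have Um: "U \<in> borel_measurable borel" by (rule borel_measurable_continuous_onI[OF U(1)])
  have k: "integrable lborel ?k" by (rule kernel_integrable[OF \<beta>(1)])
  have conv: "frac_int \<beta> \<theta> u x = ?T U x" if "x \<in> {0..1}" for x
    by (rule frac_int_eq_convolution[OF \<beta>(1) U eq that])
  have cont_L2: "(\<lambda>x. c * v x) \<in> L2_unit" if "continuous_on UNIV v" "\<And>x. \<bar>v x\<bar> \<le> b" for v c b
    using borel_measurable_continuous_onI[OF that(1)] that(2)
    by (intro L2_unit_scale L2_unit_bounded[where B = b] measurable_restrict_space1 measurable_completion) auto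
  have cont_convU: "continuous_on UNIV (convolution ?k U)"
    by (rule convolution_continuous[OF k U(1,3)])
  have WL2: "?T U \<in> L2_unit"
    by (rule cont_L2[OF cont_convU convolution_bound[OF k Um U(3)]])
  have test_L2: "?T \<eta> \<in> L2_unit" if \<eta>: "\<eta> \<in> test_functions" for \<eta>
  proof -
    obtain b where b: "\<And>x. \<bar>\<eta> x\<bar> \<le> b" using test_bounded[OF \<eta>] by blast
    have "continuous_on UNIV \<eta>" by (intro smooth_continuous test_smooth \<eta>)
    from cont_L2[OF convolution_continuous[OF k this b] convolution_bound[OF k test_measurable[OF \<eta>] b]]
    show ?thesis .
  qed
  have "?T U \<in> H1_unit"
  proof (rule weak_deriv_closed[where w = "\<lambda>n. ?T (\<phi> n)"
        and g = "\<lambda>n. ?T (deriv (\<phi> n))"])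
    show "?T (\<phi> n) \<in> L2_unit" "(?T (deriv (\<phi> n))) \<in> L2_unit" for n
      by (intro test_L2 test_deriv \<phi>)+
    show "?T U \<in> L2_unit" by (rule WL2)
    show "L2_inner (?T (\<phi> n)) (deriv \<psi>) =
        - L2_inner (?T (deriv (\<phi> n))) \<psi>" if \<psi>: "\<psi> \<in> test_functions" for n \<psi>
    proof -
      have m: "?T \<eta> \<in> borel_measurable borel" if "\<eta> \<in> test_functions" for \<eta>
        using convolution_integrable[OF k test_integrable[OF that]] by auto
      have "L2_inner (?T (\<phi> n)) (deriv \<psi>) =
          ?c * (LINT x|lborel. convolution ?k (\<phi> n) x * deriv \<psi> x)"
        by (simp only: L2_inner_test_lborel[OF test_deriv[OF \<psi>] m[OF \<phi>]] mult.assoc integral_mult_right_zero)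
      also have "\<dots> = - (?c * (LINT x|lborel. convolution ?k (deriv (\<phi> n)) x * \<psi> x))"
        by (simp only: convolution_integration_by_parts[OF k \<phi> \<psi>] mult_minus_right)
      also have "\<dots> = - L2_inner (?T (deriv (\<phi> n))) \<psi>"
        by (simp only: L2_inner_test_lborel[OF \<psi> m[OF test_deriv[OF \<phi>]]] mult.assoc integral_mult_right_zero)
      finally show ?thesis .
    qed
    show "(\<lambda>n. L2_sq (\<lambda>x. ?T (\<phi> n) x - ?T U x)) \<longlonglongrightarrow> 0"
    proof (rule uniform_limit_imp_L2[OF test_L2[OF \<phi>] WL2])
      fix \<epsilon> :: real assume "\<epsilon> > 0"
      define K where "K = \<bar>?c\<bar> * (LINT t|lborel. \<bar>?k t\<bar>) + 1"
      have K: "K > 0" by (auto simp: K_def intro!: add_nonneg_pos)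
      have "\<epsilon> / K > 0" using \<open>\<epsilon> > 0\<close> K by simp
      from unif[OF this]
      show "\<forall>\<^sub>F n in sequentially. \<forall>x\<in>unit_ival. \<bar>?T (\<phi> n) x - ?T U x\<bar> \<le> \<epsilon>"
      proof eventually_elim
        case (elim n)
        show ?case
        proof
          fix x
          obtain b where b: "\<And>x. \<bar>\<phi> n x\<bar> \<le> b" using test_bounded[OF \<phi>[of n]] by blast
          have "\<bar>?T (\<phi> n) x - ?T U x\<bar> =
              \<bar>?c\<bar> * \<bar>convolution ?k (\<lambda>x. \<phi> n x - U x) x\<bar>"
            by (simp only: convolution_diff[OF k test_measurable[OF \<phi>] b Um U(3)] right_diff_distrib[symmetric] abs_mult)
          also have "\<dots> \<le> \<bar>?c\<bar> * ((\<epsilon> / K) * (LINT t|lborel. \<bar>?k t\<bar>))"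
            using elim test_measurable[OF \<phi>[of n]] Um by (intro mult_left_mono convolution_bound[OF k]) auto
          also have "\<dots> = (\<epsilon> / K) * (K - 1)" by (simp add: K_def)
          also have "\<dots> \<le> (\<epsilon> / K) * K" using \<open>\<epsilon> / K > 0\<close> by (intro mult_left_mono) auto
          also have "\<dots> = \<epsilon>" using K by simp
          finally show "\<bar>?T (\<phi> n) x - ?T U x\<bar> \<le> \<epsilon>" .
        qed
      qed
    qed
    fix e :: real assume "e > 0"
    define D where "D = ?c\<^sup>2 * (2 + 1 / \<beta>)\<^sup>2 + 1"
    have D: "D > 0" by (simp add: D_def add_nonneg_pos)
    obtain N where N: "\<And>m n. m \<ge> N \<Longrightarrow> n \<ge> N \<Longrightarrow>
        fourier_energy (1 - \<beta>) (\<lambda>x. \<phi> m x - \<phi> n x) < e / D"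
      using Cau[of "e / D"] \<open>e > 0\<close> D by auto
    have "L2_sq (\<lambda>x. ?T (deriv (\<phi> m)) x - ?T (deriv (\<phi> n)) x) < e"
      if mn: "m \<ge> N" "n \<ge> N" for m n
    proof -
      let ?d = "\<lambda>x. \<phi> m x - \<phi> n x"
      have d: "?d \<in> test_functions" by (intro test_diff \<phi>)
      let ?g = "convolution ?k (deriv ?d)"
      let ?E = "fourier_energy (1 - \<beta>) ?d"
      obtain b b' where b: "\<And>x. \<bar>deriv (\<phi> m) x\<bar> \<le> b" "\<And>x. \<bar>deriv (\<phi> n) x\<bar> \<le> b'"
        using test_bounded[OF test_deriv[OF \<phi>[of m]]] test_bounded[OF test_deriv[OF \<phi>[of n]]] by metis
      have g: "?g x = convolution ?k (deriv (\<phi> m)) x - convolution ?k (deriv (\<phi> n)) x" for x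
        unfolding deriv_test_diff[OF \<phi> \<phi>]
        by (rule convolution_diff[OF k test_measurable[OF test_deriv[OF \<phi>]] b(1) test_measurable[OF test_deriv[OF \<phi>]] b(2)])
      note en = kernel_convolution_energy[OF \<beta>(1) \<beta>1 \<theta> d]
      have "L2_sq (\<lambda>x. ?T (deriv (\<phi> m)) x - ?T (deriv (\<phi> n)) x) =
          ?c\<^sup>2 * L2_sq ?g"
        by (simp only: g right_diff_distrib[symmetric] power_mult_distrib integral_mult_right_zero)
      also have "\<dots> \<le> ?c\<^sup>2 * ((2 + 1 / \<beta>)\<^sup>2 * ?E)"
      proof (rule mult_left_mono)
        have gm: "(\<lambda>x. (?g x)\<^sup>2) \<in> borel_measurable lborel" using en(1) by auto
        have "L2_sq ?g = (LINT x|lebesgue. indicator unit_ival x *\<^sub>R (?g x)\<^sup>2)"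
          by (rule integral_restrict_space) simp
        also have "\<dots> = (LINT x|lborel. indicator unit_ival x *\<^sub>R (?g x)\<^sup>2)"
          using gm by (intro integral_completion) auto
        also have "\<dots> \<le> (LINT x|lborel. (?g x)\<^sup>2)"
          using en(1) by (intro integral_mono integrable_mult_indicator) (auto simp: indicator_def)
        also have "\<dots> \<le> 2 * pi * (LINT x|lborel. (?g x)\<^sup>2)"
          using pi_gt3 mult_right_mono[of 1 "2 * pi" "LINT x|lborel. (?g x)\<^sup>2"] by simp
        also have "\<dots> \<le> (2 + 1 / \<beta>)\<^sup>2 * ?E" by (rule en(2))
        finally show "L2_sq ?g \<le> (2 + 1 / \<beta>)\<^sup>2 * ?E" .
      qed simp
      also have "\<dots> = (D - 1) * ?E" by (simp add: D_def)
      also have "\<dots> \<le> D * ?E" by (intro mult_right_mono) auto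
      also have "\<dots> < D * (e / D)" using N[OF mn] D by (intro mult_strict_left_mono)
      also have "\<dots> = e" using D by simp
      finally show ?thesis .
    qed
    then show "\<exists>N. \<forall>m\<ge>N. \<forall>n\<ge>N. (LINT x|unit_measure.
        (?T (deriv (\<phi> m)) x - ?T (deriv (\<phi> n)) x)\<^sup>2) < e"
      by blast
  qed
  then show "frac_int \<beta> \<theta> u \<in> H1_unit"
    by (rule H1_unit_cong_AE) (rule AE_I2, use conv in auto)
  show "boundary_values (frac_int \<beta> \<theta> u) ((1 - \<theta>) * frac_int_right \<beta> u 0) (\<theta> * frac_int_left \<beta> u 1)"
    unfolding boundary_values_def
  proof (intro exI[of _ "frac_int \<beta> \<theta> u"] conjI)
    have "continuous_on {0..1} (?T U)"
      by (intro continuous_intros continuous_on_subset[OF cont_convU]) auto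
    then show "continuous_on {0..1} (frac_int \<beta> \<theta> u)"
      by (rule continuous_on_eq) (use conv in auto)
  qed (auto simp: frac_int_def frac_int_left_def[of _ _ 0] frac_int_right_def[of _ _ 1])
qed

section \<open>Primitives and boundary values\<close>

text \<open>Fubini's theorem is applied on the product of Borel measures, which calls for Borel measurable
  representatives.\<close>

lemma unit_borel_representative:
  fixes h :: "real \<Rightarrow> real"
  assumes "integrable unit_measure h"
  obtains h' :: "real \<Rightarrow> real" where "integrable lborel h'" "\<And>x. x \<notin> unit_ival \<Longrightarrow> h' x = 0"
    "AE x in unit_measure. h x = h' x"
proof -
  have i: "integrable lebesgue (\<lambda>x. indicator unit_ival x * h x)"
    using assms by (simp add: integrable_restrict_space)
  then have "(\<lambda>x. indicator unit_ival x * h x) \<in> borel_measurable lebesgue" by auto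
  from completion_ex_borel_measurable_real[OF this]
  obtain g where g: "g \<in> borel_measurable lborel" "AE x in lborel. indicator unit_ival x * h x = g x" by blast
  define h' where "h' x = indicator unit_ival x * g x" for x
  have m: "h' \<in> borel_measurable borel" unfolding h'_def[abs_def] using g(1) by simp
  have ae: "AE x in lebesgue. indicator unit_ival x * h x = h' x"
    using AE_completion[OF g(2)]
  proof eventually_elim
    case (elim x)
    then show ?case by (cases "x \<in> unit_ival") (simp_all add: h'_def)
  qed
  have "integrable lebesgue h'"
    by (rule integrable_cong_AE_imp[OF i _ ae]) (rule measurable_completion, use m in simp)
  then have "integrable lborel h'" using m by (simp add: integrable_completion)
  moreover have "AE x in unit_measure. h x = h' x"
  proof -
    have "AE x in lebesgue. x \<in> unit_ival \<longrightarrow> h x = h' x"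
      using ae by eventually_elim (auto simp: indicator_def)
    then show ?thesis by (simp add: AE_restrict_space_iff)
  qed
  ultimately show ?thesis by (intro that[of h']) (auto simp: h'_def)
qed

text \<open>Exchanging the integrals leaves the integral of \<open>deriv \<psi>\<close> over \<open>[t,1]\<close>, which is \<open>- \<psi> t\<close>.\<close>

lemma primitive_integration_by_parts:
  assumes h: "integrable lborel h" "\<And>x. x \<notin> unit_ival \<Longrightarrow> h x = 0" and \<psi>: "\<psi> \<in> test_functions"
  shows "(LINT x|lborel. (LINT t|lborel. indicator {0..x} t * h t) * deriv \<psi> x) = - (LINT t|lborel. h t * \<psi> t)"
proof -
  note d\<psi> = test_deriv[OF \<psi>]
  have [measurable]: "h \<in> borel_measurable borel" "deriv \<psi> \<in> borel_measurable borel"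
    using h(1) test_measurable[OF d\<psi>] by auto
  let ?F = "\<lambda>t x. h t * ((if 0 \<le> t \<and> t \<le> x then 1 else 0) * deriv \<psi> x)"
  have "integrable (lborel \<Otimes>\<^sub>M lborel) (case_prod ?F)"
  proof (rule Bochner_Integration.integrable_bound)
    show "integrable (lborel \<Otimes>\<^sub>M lborel) (\<lambda>(t, x). h t * deriv \<psi> x)"
    proof (rule lborel_pair.Fubini_integrable)
      show "integrable lborel (\<lambda>t. LINT x|lborel. norm (case (t, x) of (t, x) \<Rightarrow> h t * deriv \<psi> x))"
        using h(1) by (simp add: abs_mult)
    qed (use test_integrable[OF d\<psi>] in auto)
    show "AE p in lborel \<Otimes>\<^sub>M lborel. norm (case_prod ?F p) \<le> norm (case p of (t, x) \<Rightarrow> h t * deriv \<psi> x)"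
      by auto
  qed measurable
  note fub = lborel_pair.Fubini_integral[OF this]
  have "(LINT x|lborel. (LINT t|lborel. indicator {0..x} t * h t) * deriv \<psi> x) =
      (LINT x|lborel. LINT t|lborel. ?F t x)"
    unfolding integral_mult_left_zero[symmetric]
    by (intro Bochner_Integration.integral_cong refl) (auto simp: indicator_def)
  also have "\<dots> = (LINT t|lborel. LINT x|lborel. ?F t x)" by (rule fub)
  also have "\<dots> = (LINT t|lborel. - (h t * \<psi> t))"
  proof (rule Bochner_Integration.integral_cong[OF refl])
    fix t
    show "(LINT x|lborel. ?F t x) = - (h t * \<psi> t)"
    proof (cases "t \<in> unit_ival")
      case False
      then show ?thesis using h(2) by simp
    next
      case True
      have "(LINT x|lborel. indicator {t..1} x *\<^sub>R deriv \<psi> x) = \<psi> 1 - \<psi> t"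
      proof (rule integral_FTC_atLeastAtMost)
        show "(\<psi> has_vector_derivative deriv \<psi> x) (at x within {t..1})" for x
          using smooth_has_deriv[OF test_smooth[OF \<psi>], of x]
          by (auto simp: has_real_derivative_iff_has_vector_derivative intro: has_vector_derivative_at_within)
      qed (use True smooth_continuous[OF test_smooth[OF d\<psi>]] in auto)
      moreover have "(if 0 \<le> t \<and> t \<le> x then 1 else 0) * deriv \<psi> x = indicator {t..1} x *\<^sub>R deriv \<psi> x" for x
        using True test_outside[OF d\<psi>, of x] by (auto simp: indicator_def)
      ultimately show ?thesis
        using test_outside[OF \<psi>, of 1] by (simp only: integral_mult_right_zero) simp
    qed
  qed
  finally show ?thesis by simp
qed

lemma continuous_AE_eq:
  fixes p q :: "real \<Rightarrow> real"
  assumes "continuous_on {0..1} p" "continuous_on {0..1} q" "AE x in unit_measure. p x = q x" "x \<in> {0..1}"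
  shows "p x = q x"
proof -
  define C where "C = {x \<in> {0..1}. p x = q x}"
  have "closed C"
  proof -
    have "C = {0..1} \<inter> (\<lambda>x. p x - q x) -` {0}" by (auto simp: C_def)
    then show ?thesis
      by (simp add: continuous_closed_preimage continuous_on_diff assms)
  qed
  have "AE x in lebesgue. x \<in> unit_ival \<longrightarrow> p x = q x"
    using assms(3) by (simp add: AE_restrict_space_iff)
  then have "AE x\<in>unit_ival in lebesgue. x \<in> C"
    by eventually_elim (auto simp: C_def)
  from mem_closed_if_AE_lebesgue_open[OF _ \<open>closed C\<close> this]
  have "unit_ival \<subseteq> C" by auto
  then have "closure unit_ival \<subseteq> C" using \<open>closed C\<close> by (rule closure_minimal)
  moreover have "closure unit_ival = {0..1::real}" by simp
  ultimately show ?thesis using assms(4) by (auto simp: C_def)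
qed

text \<open>The fundamental theorem of calculus for \<open>H\<^sup>1\<close> functions: \<open>z\<close> and the primitive of \<open>g\<close> have the
  same weak derivative, so they differ by a constant, which the continuous representatives identify
  with the boundary value at \<open>0\<close>.\<close>

lemma boundary_values_FTC:
  assumes z: "z \<in> L2_unit" and g: "g \<in> L2_unit" and zg: "has_weak_deriv z g"
    and bv: "boundary_values z a b"
  shows "b - a = (LINT t|unit_measure. g t)"
    and "(AE x in unit_measure. g x = 0) \<Longrightarrow> AE x in unit_measure. z x = a"
proof -
  obtain h where h: "integrable lborel h" "\<And>x. x \<notin> unit_ival \<Longrightarrow> h x = 0"
    "AE x in unit_measure. g x = h x"
    using unit_borel_representative[OF L2_unit_integrable[OF g]] by blast
  have [measurable]: "h \<in> borel_measurable borel" using h(1) by auto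
  have hm: "h \<in> borel_measurable unit_measure"
    by (rule unit_measurable_AE[OF L2_unit_measurable[OF g] h(3)])
  define y where "y x = (LINT t|lborel. indicator {0..x} t * h t)" for x
  have "continuous_on {0..1} (\<lambda>x. integral {0..x} h)"
    using integrable_on_lborel[OF h(1)]
    by (intro indefinite_integral_continuous_1) (rule integrable_on_subinterval, auto)
  moreover have "y x = integral {0..x} h" for x
  proof -
    have "set_integrable lborel {0..x} h"
      unfolding set_integrable_def using h(1) by (intro integrable_mult_indicator) auto
    from set_borel_integral_eq_integral(2)[OF this] show ?thesis
      by (simp add: y_def set_lebesgue_integral_def)
  qed
  ultimately have ycont: "continuous_on {0..1} y" by simp
  have y0: "y 0 = 0"
  proof -
    have "(\<lambda>t. indicator {0..0} t * h t) = (\<lambda>t. 0)" using h(2)[of 0] by (auto simp: indicator_def)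
    then show ?thesis by (simp add: y_def)
  qed
  have y1: "y 1 = (LINT t|unit_measure. g t)"
  proof -
    have "(LINT t|unit_measure. g t) = (LINT t|unit_measure. h t)"
      by (rule integral_cong_AE[OF L2_unit_measurable[OF g] hm h(3)])
    also have "\<dots> = (LINT t|lebesgue. indicator unit_ival t *\<^sub>R h t)"
      by (rule integral_restrict_space) simp
    also have "\<dots> = (LINT t|lborel. indicator unit_ival t *\<^sub>R h t)"
      by (rule integral_completion) measurable
    also have "\<dots> = y 1"
      unfolding y_def using h(2) by (intro Bochner_Integration.integral_cong) (auto simp: indicator_def)
    finally show ?thesis ..
  qed
  have ym: "y \<in> borel_measurable borel"
  proof -
    have "(\<lambda>x. LINT t|lborel. (if 0 \<le> t \<and> t \<le> x then 1 else 0) * h t) \<in> borel_measurable borel"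
      by measurable
    moreover have "y = (\<lambda>x. LINT t|lborel. (if 0 \<le> t \<and> t \<le> x then 1 else 0) * h t)"
      by (auto simp: y_def fun_eq_iff indicator_def intro!: Bochner_Integration.integral_cong)
    ultimately show ?thesis by simp
  qed
  have "bounded (y ` {0..1})" by (intro compact_imp_bounded compact_continuous_image ycont) auto
  then obtain B where "\<forall>v\<in>y ` {0..1}. norm v \<le> B" unfolding bounded_iff by blast
  then have B: "\<bar>y x\<bar> \<le> B" if "x \<in> {0..1}" for x using that by auto
  have yL2: "y \<in> L2_unit"
    using ym B by (intro L2_unit_bounded[where B = B] measurable_restrict_space1 measurable_completion) auto
  have d: "(\<lambda>x. z x - y x) \<in> L2_unit" by (rule L2_unit_diff[OF z yL2])
  obtain c where c: "AE x in unit_measure. z x - y x = c"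
  proof (rule du_Bois_Reymond[OF L2_unit_integrable[OF d]])
    fix \<phi> assume \<phi>: "\<phi> \<in> test_functions"
    have "L2_inner z (deriv \<phi>) = - L2_inner g \<phi>" using zg \<phi> by (auto simp: has_weak_deriv_def)
    also have "L2_inner g \<phi> = L2_inner h \<phi>"
      unfolding L2_inner_def
    proof (rule integral_cong_AE)
      show "AE x in unit_measure. g x * \<phi> x = h x * \<phi> x" using h(3) by eventually_elim simp
    qed (use L2_unit_measurable[OF g] hm L2_unit_measurable[OF test_L2_unit[OF \<phi>]] in auto)
    also have "- L2_inner h \<phi> = L2_inner y (deriv \<phi>)"
      using primitive_integration_by_parts[OF h(1,2) \<phi>] ym
      by (simp add: L2_inner_test_lborel \<phi> test_deriv y_def)
    finally show "L2_inner (\<lambda>x. z x - y x) (deriv \<phi>) = 0"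
      by (simp add: L2_inner_diff_left[OF z yL2 test_L2_unit[OF test_deriv[OF \<phi>]]])
  qed
  obtain z' where z': "continuous_on {0..1} z'" "AE x in unit_measure. z x = z' x" "z' 0 = a" "z' 1 = b"
    using bv unfolding boundary_values_def by blast
  have eq: "z' x = c + y x" if "x \<in> {0..1}" for x
  proof (rule continuous_AE_eq[OF z'(1) _ _ that])
    show "continuous_on {0..1} (\<lambda>x. c + y x)" by (intro continuous_intros ycont)
    show "AE x in unit_measure. z' x = c + y x" using c z'(2) by eventually_elim simp
  qed
  have "a = c" using eq[of 0] y0 z'(3) by simp
  moreover have "b = c + y 1" using eq[of 1] z'(4) by simp
  ultimately show "b - a = (LINT t|unit_measure. g t)" using y1 by simp
  assume g0: "AE x in unit_measure. g x = 0"
  have "y x = 0" for x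
  proof -
    have "AE x in unit_measure. h x = 0" using g0 h(3) by eventually_elim simp
    then have "AE x in lebesgue. x \<in> unit_ival \<longrightarrow> h x = 0" by (simp add: AE_restrict_space_iff)
    then have "AE x in lebesgue. h x = 0" by eventually_elim (use h(2) in auto)
    then have "AE t in lebesgue. indicator {0..x} t * h t = 0" by eventually_elim simp
    then have "(LINT t|lebesgue. indicator {0..x} t * h t) = 0"
      by (rule integral_eq_zero_AE)
    moreover have "(LINT t|lebesgue. indicator {0..x} t * h t) = y x"
      unfolding y_def by (rule integral_completion) measurable
    ultimately show ?thesis by simp
  qed
  with c \<open>a = c\<close> show "AE x in unit_measure. z x = a" by simp
qed

section \<open>Equivalence of the two formulations\<close>

lemma L2_inner_cong_AE:
  assumes "p \<in> L2_unit" "v \<in> L2_unit" "AE x in unit_measure. p x = q x" "AE x in unit_measure. v x = w x"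
  shows "L2_inner p v = L2_inner q w"
  unfolding L2_inner_def
proof (rule integral_cong_AE)
  show "(\<lambda>x. p x * v x) \<in> borel_measurable unit_measure"
    by (intro borel_measurable_times L2_unit_measurable assms)
  show "(\<lambda>x. q x * w x) \<in> borel_measurable unit_measure"
    by (rule borel_measurable_times; rule L2_unit_measurable, rule L2_unit_cong_AE) (use assms in auto)
  show "AE x in unit_measure. p x * v x = q x * w x"
    using assms(3,4) by eventually_elim simp
qed

lemma L2_inner_combination:
  assumes "p \<in> L2_unit" "q \<in> L2_unit" "r \<in> L2_unit" "s \<in> L2_unit" "v \<in> L2_unit"
  shows "L2_inner (\<lambda>x. p x - a * q x - b * r x - s x) v =
    L2_inner p v - a * L2_inner q v - b * L2_inner r v - L2_inner s v"
proof -
  have i: "integrable unit_measure (\<lambda>x. w x * v x)" if "w \<in> L2_unit" for w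
    by (rule L2_unit_integrable_mult[OF that assms(5)])
  have "L2_inner (\<lambda>x. p x - a * q x - b * r x - s x) v =
      (LINT x|unit_measure. p x * v x - a * (q x * v x) - b * (r x * v x) - s x * v x)"
    unfolding L2_inner_def by (rule Bochner_Integration.integral_cong) (auto simp: algebra_simps)
  then show ?thesis
    using i[OF assms(1)] i[OF assms(2)] i[OF assms(3)] i[OF assms(4)] by (simp add: L2_inner_def)
qed

lemma boundary_values_combination:
  assumes "boundary_values p p0 p1" "boundary_values q q0 q1" "boundary_values r r0 r1" "boundary_values s s0 s1"
  shows "boundary_values (\<lambda>x. p x - a * q x - b * r x - s x)
    (p0 - a * q0 - b * r0 - s0) (p1 - a * q1 - b * r1 - s1)"
proof -
  obtain p' where p': "continuous_on {0..1} p'" "AE x in unit_measure. p x = p' x" "p' 0 = p0" "p' 1 = p1"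
    using assms(1) unfolding boundary_values_def by blast
  obtain q' where q': "continuous_on {0..1} q'" "AE x in unit_measure. q x = q' x" "q' 0 = q0" "q' 1 = q1"
    using assms(2) unfolding boundary_values_def by blast
  obtain r' where r': "continuous_on {0..1} r'" "AE x in unit_measure. r x = r' x" "r' 0 = r0" "r' 1 = r1"
    using assms(3) unfolding boundary_values_def by blast
  obtain s' where s': "continuous_on {0..1} s'" "AE x in unit_measure. s x = s' x" "s' 0 = s0" "s' 1 = s1"
    using assms(4) unfolding boundary_values_def by blast
  have "continuous_on {0..1} (\<lambda>x. p' x - a * q' x - b * r' x - s' x)"
    by (intro continuous_intros p' q' r' s')
  moreover have "AE x in unit_measure. p x - a * q x - b * r x - s x = p' x - a * q' x - b * r' x - s' x"
    using p'(2) q'(2) r'(2) s'(2) by eventually_elim simp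
  ultimately show ?thesis
    unfolding boundary_values_def using p'(3,4) q'(3,4) r'(3,4) s'(3,4)
    by (intro exI[of _ "\<lambda>x. p' x - a * q' x - b * r' x - s' x"]) simp
qed

theorem theorem6p1:
  fixes \<beta> \<theta> K_m K_M :: real
    and K w_l w_r w_f u :: "real \<Rightarrow> real"
    and f :: "(real \<Rightarrow> real) \<Rightarrow> real"
  assumes "0 < \<beta>" and "\<beta> < 1 / 2"
    and "0 \<le> \<theta>" and "\<theta> \<le> 1"
    and "K \<in> borel_measurable (lebesgue_on unit_ival)"
    and "0 < K_m"
    and "\<And>x. x \<in> unit_ival \<Longrightarrow> K_m \<le> K x \<and> K x \<le> K_M"
    and "f \<in> H_minus1_unit"
    and "diffusion_weak_solution K (\<lambda>v. 0) 1 0 w_l"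
    and "diffusion_weak_solution K (\<lambda>v. 0) 0 1 w_r"
    and "diffusion_weak_solution K f 0 0 w_f"
  shows "petrov_galerkin_solution K \<beta> \<theta> f u \<longleftrightarrow>
    (u \<in> H0_unit (1 - \<beta>) \<and>
     (AE x in lebesgue_on unit_ival.
        frac_int \<beta> \<theta> u x - (1 - \<theta>) * frac_int_right \<beta> u 0 * w_l x
          - \<theta> * frac_int_left \<beta> u 1 * w_r x = w_f x))"
proof (cases "u \<in> H0_unit (1 - \<beta>)")
  case False
  then show ?thesis by (simp add: petrov_galerkin_solution_def)
next
  case u: True
  define W where "W = frac_int \<beta> \<theta> u"
  define c\<^sub>l where "c\<^sub>l = (1 - \<theta>) * frac_int_right \<beta> u 0"
  define c\<^sub>r where "c\<^sub>r = \<theta> * frac_int_left \<beta> u 1"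
  define z where "z x = W x - c\<^sub>l * w_l x - c\<^sub>r * w_r x - w_f x" for x
  define g where "g x = weak_deriv W x - c\<^sub>l * weak_deriv w_l x - c\<^sub>r * weak_deriv w_r x - weak_deriv w_f x" for x
  have W_H1: "W \<in> H1_unit" and W_bv: "boundary_values W c\<^sub>l c\<^sub>r"
    using frac_int_H1[OF assms(1-4) u] by (simp_all add: W_def c\<^sub>l_def c\<^sub>r_def)
  have H1: "w_l \<in> H1_unit" "w_r \<in> H1_unit" "w_f \<in> H1_unit"
    using assms(9-11) by (auto simp: diffusion_weak_solution_def)
  note W = H1_unit_weak_deriv[OF W_H1] and l = H1_unit_weak_deriv[OF H1(1)]
    and r = H1_unit_weak_deriv[OF H1(2)] and f = H1_unit_weak_deriv[OF H1(3)]
  have zL2: "z \<in> L2_unit" and gL2: "g \<in> L2_unit"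
    unfolding z_def[abs_def] g_def[abs_def] by (intro L2_unit_diff L2_unit_scale W l r f)+
  have zg: "has_weak_deriv z g"
  proof (rule has_weak_derivI[OF zL2 gL2])
    fix \<phi> assume \<phi>: "\<phi> \<in> test_functions"
    have ibp: "L2_inner w (deriv \<phi>) = - L2_inner (weak_deriv w) \<phi>" if "w \<in> H1_unit" for w
      using H1_unit_weak_deriv(3)[OF that] \<phi> by (auto simp: has_weak_deriv_def)
    show "L2_inner z (deriv \<phi>) = - L2_inner g \<phi>"
      unfolding z_def[abs_def] g_def[abs_def]
        L2_inner_combination[OF W(1) l(1) r(1) f(1) test_L2_unit[OF test_deriv[OF \<phi>]]]
        L2_inner_combination[OF W(2) l(2) r(2) f(2) test_L2_unit[OF \<phi>]]
      by (simp add: ibp W_H1 H1)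
  qed
  have z_bv: "boundary_values z 0 0"
    using boundary_values_combination[OF W_bv, of w_l 1 0 w_r 0 1 w_f 0 0 c\<^sub>l c\<^sub>r] assms(9-11)
    by (simp add: z_def[abs_def] diffusion_weak_solution_def)
  have K_bound: "\<bar>K x\<bar> \<le> K_M" and K_pos: "K x > 0" if "x \<in> unit_ival" for x
    using assms(6) assms(7)[OF that] by auto
  have K_L2: "(\<lambda>x. K x * p x) \<in> L2_unit" if "p \<in> L2_unit" for p
    by (rule L2_unit_mult_bounded[OF that assms(5) K_bound])
  \<comment> \<open>The residual of the Galerkin equation is the form applied to \<open>z\<close>: the liftings \<open>w_l\<close> and \<open>w_r\<close>
    contribute nothing, and \<open>w_f\<close> contributes \<open>f\<close>.\<close>
  have residual: "L2_inner (\<lambda>x. K x * weak_deriv W x) (weak_deriv v) - f v =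
      L2_inner (\<lambda>x. K x * g x) (weak_deriv v)" if v: "v \<in> H0_unit 1" for v
  proof -
    have dv: "weak_deriv v \<in> L2_unit"
      using H0_unit_1_subset_H1 v by (auto intro: H1_unit_weak_deriv)
    have "(\<lambda>x. K x * g x) = (\<lambda>x. K x * weak_deriv W x - c\<^sub>l * (K x * weak_deriv w_l x)
        - c\<^sub>r * (K x * weak_deriv w_r x) - K x * weak_deriv w_f x)"
      by (simp add: g_def fun_eq_iff algebra_simps)
    then show ?thesis
      using L2_inner_combination[OF K_L2[OF W(2)] K_L2[OF l(2)] K_L2[OF r(2)] K_L2[OF f(2)] dv]
        assms(9-11) v
      by (simp add: diffusion_weak_solution_def)
  qed
  have "(\<forall>v\<in>H0_unit 1. L2_inner (\<lambda>x. K x * weak_deriv W x) (weak_deriv v) = f v) \<longleftrightarrow>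
      (AE x in unit_measure. z x = 0)"
  proof
    assume pg: "\<forall>v\<in>H0_unit 1. L2_inner (\<lambda>x. K x * weak_deriv W x) (weak_deriv v) = f v"
    have Kg: "(\<lambda>x. K x * g x) \<in> L2_unit" by (rule K_L2[OF gL2])
    obtain c where c: "AE x in unit_measure. K x * g x = c"
    proof (rule du_Bois_Reymond[OF L2_unit_integrable[OF Kg]])
      fix \<phi> assume \<phi>: "\<phi> \<in> test_functions"
      have v: "\<phi> \<in> H0_unit 1" by (rule test_H0_unit[OF \<phi>]) auto
      have "L2_inner (\<lambda>x. K x * g x) (deriv \<phi>) = L2_inner (\<lambda>x. K x * g x) (weak_deriv \<phi>)"
        using weak_deriv_AE_eq[OF test_has_weak_deriv[OF \<phi>]]
        by (intro L2_inner_cong_AE Kg test_L2_unit test_deriv \<phi>) (auto simp: eq_commute)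
      then show "L2_inner (\<lambda>x. K x * g x) (deriv \<phi>) = 0"
        using residual[OF v] pg v by simp
    qed
    have g_eq: "AE x in unit_measure. g x = c * (1 / K x)"
      using c AE_space
    proof eventually_elim
      case (elim x)
      then show ?case using K_pos[of x] by (simp add: field_simps)
    qed
    have iK: "(\<lambda>x. 1 / K x) \<in> L2_unit"
    proof (rule L2_unit_bounded)
      show "(\<lambda>x. 1 / K x) \<in> borel_measurable unit_measure" using assms(5) by simp
      show "\<bar>1 / K x\<bar> \<le> 1 / K_m" if "x \<in> unit_ival" for x
        using assms(6) assms(7)[OF that] by (simp add: frac_le)
    qed
    have "0 = (LINT t|unit_measure. g t)"
      using boundary_values_FTC(1)[OF zL2 gL2 zg z_bv] by simp
    also have "\<dots> = (LINT t|unit_measure. c * (1 / K t))"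
      by (rule integral_cong_AE[OF L2_unit_measurable[OF gL2] L2_unit_measurable[OF L2_unit_scale[OF iK]] g_eq])
    also have "\<dots> = c * (LINT t|unit_measure. 1 / K t)"
      by (rule integral_mult_right_zero)
    finally have "c * (LINT t|unit_measure. 1 / K t) = 0" by simp
    moreover have "(LINT t|unit_measure. 1 / K t) \<noteq> 0"
    proof
      assume "(LINT t|unit_measure. 1 / K t) = 0"
      then have "AE t in unit_measure. 1 / K t = 0"
        using L2_unit_integrable[OF iK] K_pos
        by (subst (asm) integral_nonneg_eq_0_iff_AE) (auto intro!: AE_I2 simp: less_imp_le)
      then have "AE t in unit_measure. False"
        using AE_space by eventually_elim (use K_pos in force)
      then show False
        by (simp add: eventually_False ae_filter_eq_bot_iff emeasure_restrict_space)
    qed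
    ultimately have "c = 0" by simp
    then have "AE x in unit_measure. g x = 0" using g_eq by simp
    then show "AE x in unit_measure. z x = 0"
      by (rule boundary_values_FTC(2)[OF zL2 gL2 zg z_bv])
  next
    assume z0: "AE x in unit_measure. z x = 0"
    have zero: "(\<lambda>x. 0) \<in> L2_unit" by (rule L2_unit_bounded[where B = 0]) auto
    have "has_weak_deriv (\<lambda>x. 0) (\<lambda>x. 0)"
      by (rule has_weak_derivI[OF zero zero]) (simp add: L2_inner_def)
    with has_weak_deriv_cong_AE[OF zg zero z0]
    have g0: "AE x in unit_measure. g x = 0" by (rule has_weak_deriv_unique)
    show "\<forall>v\<in>H0_unit 1. L2_inner (\<lambda>x. K x * weak_deriv W x) (weak_deriv v) = f v"
    proof
      fix v assume v: "v \<in> H0_unit 1"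
      have "L2_inner (\<lambda>x. K x * g x) (weak_deriv v) = 0"
        unfolding L2_inner_def
        by (rule integral_eq_zero_AE) (use g0 in \<open>eventually_elim, simp\<close>)
      with residual[OF v] show "L2_inner (\<lambda>x. K x * weak_deriv W x) (weak_deriv v) = f v" by simp
    qed
  qed
  moreover have "(z x = 0) = (W x - c\<^sub>l * w_l x - c\<^sub>r * w_r x = w_f x)" for x
    by (simp add: z_def)
  ultimately show ?thesis
    using u by (simp add: petrov_galerkin_solution_def W_def c\<^sub>l_def c\<^sub>r_def)
qed

end
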